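(* Let $d\ge2$. Let $X_1,X_2,\dots$ be independent real-valued random variables with zero means, unit variances and finite fourth moments. For each $n\geq 1$ and $1\le i\le d$, let $(a^{(ni)}_{uv})_{u,v=1}^n$ be a real symmetric matrix with vanishing diagonal (i.e. $a^{(ni)}_{uv}=a^{(ni)}_{vu}$, $a^{(ni)}_{uu}=0$), and define $$F^{(n)}_i:=\sum_{1\le u\le v\le n}a^{(ni)}_{uv}X_uX_v,\qquad F^{(n)}:=(F^{(n)}_1,\dots,F^{(n)}_d).$$ Let $Y$ be a centered $d$-dimensional Gaussian vector with covariance matrix $C=(C_{ij})_{d\times d}$ (not necessarily positive definite). Suppose that $$\lim_{n\to\infty}E[F^{(n)}_iF^{(n)}_j]=\lim_{n\to\infty}\sum_{1\le u\le v\le n}a^{(ni)}_{uv}a^{(nj)}_{uv}=C_{ij},\quad 1\le i,j\le d,$$ $$\lim_{n\to\infty}\sum_{u,v=1}^n\Big(\sum_{k=1}^n a^{(ni)}_{ku}a^{(nj)}_{kv}\Big)^2=0,\quad 1\le i,j\le d,$$ $$\lim_{n\to\infty}\max_{1\le u\le n}\sum_{v=1}^n(a^{(ni)}_{uv})^2=0,\quad 1\le i\le d.$$ Then $F^{(n)}$ converges to $Y$ in distribution as $n\to\infty$. Moreover, for every $g\in\mathcal{C}^3(\mathbb{R}^d)$ with $\|g''\|_\infty+\|g'''\|_\infty<\infty$, the following bound holds: \begin{align*} |E[g(F^{(n)})]-E[g(Y)]|&\le\frac{\|g''\|_\infty}{2}\sum_{i,j=1}^d|C_{ij}-E[F^{(n)}_iF^{(n)}_j]|\\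 &+\frac{\|g''\|_\infty}{2^{3/2}}\sum_{i,j=1}^d\sqrt{\max\{2,\max_{1\le u\le n}\mathrm{Var}(X_u^2)\}\sum_{u,v=1}^n\Big(\sum_{k=1}^n a^{(ni)}_{ku}a^{(nj)}_{kv}\Big)^2}\\ &+\frac{\|g''\|_\infty}{2^{3/2}}\sum_{i,j=1}^d\sqrt{8\max_{1\le v\le n}\mathrm{Var}(X_v^2)\max_{1\le v\le n}E|X_v|^4\sum_{k=1}^n\Big(\sum_{v=1}^n(a^{(ni)}_{kv})^2\Big)\Big(\sum_{v=1}^n(a^{(nj)}_{kv})^2\Big)}\\ &+\frac{2^{3/2}\max_{1\le v\le n}E|X_v|^4\,\|g'''\|_\infty d^2}{3}\sum_{i=1}^d\sum_{k=1}^n\Big(\sum_{u=1}^n(a^{(ni)}_{ku})^2\Big)^{3/2}. \end{align*}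
   Context: $\mathcal{C}^3(\mathbb{R}^d)$ is the space of three times continuously differentiable real-valued functions on $\mathbb{R}^d$. For $g\in\mathcal{C}^k(\mathbb{R}^d)$, $\|g^{(k)}\|_\infty:=\max_{1\le i_1\le\dots\le i_k\le d}\sup_{x\in\mathbb{R}^d}\big|\frac{\partial^k g}{\partial x_{i_1}\cdots\partial x_{i_k}}(x)\big|$; $g''=g^{(2)}$, $g'''=g^{(3)}$.
   Formalization: Convergence in distribution is proved under the added assumption that the fourth moments E|X_v|^4 are bounded uniformly in v; with merely finite fourth moments it is false. The quantitative bound needs no such assumption. *)

theory Defs
  imports "HOL-Probability.Probability"
begin

definition partial_deriv :: "'d::finite \<Rightarrow> (real^'d \<Rightarrow> real) \<Rightarrow> real^'d \<Rightarrow> real" where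
  "partial_deriv i g x = deriv (\<lambda>t. g (x + t *\<^sub>R axis i 1)) 0"

definition has_partial_deriv :: "'d::finite \<Rightarrow> (real^'d \<Rightarrow> real) \<Rightarrow> bool" where
  "has_partial_deriv i g \<longleftrightarrow>
     (\<forall>x. (\<lambda>t. g (x + t *\<^sub>R axis i 1)) field_differentiable (at 0))"

fun times_cont_diff :: "nat \<Rightarrow> (real^'d::finite \<Rightarrow> real) \<Rightarrow> bool" where
  "times_cont_diff 0 g \<longleftrightarrow> continuous_on UNIV g"
| "times_cont_diff (Suc k) g \<longleftrightarrow>
     continuous_on UNIV g \<and>
     (\<forall>i. has_partial_deriv i g \<and> times_cont_diff k (partial_deriv i g))"

text \<open>The index list \<open>[i1, \<dots>, ik]\<close> stands for the iterated partial derivative in the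
  coordinates \<open>i1, \<dots>, ik\<close>, the last one being taken first. Values are in \<^typ>\<open>ennreal\<close>,
  so that unbounded derivatives have norm \<open>\<infinity>\<close>.\<close>

definition deriv_sup_norm :: "nat \<Rightarrow> (real^'d::{finite,linorder} \<Rightarrow> real) \<Rightarrow> ennreal" where
  "deriv_sup_norm k g =
     Max ((\<lambda>is. SUP x. ennreal \<bar>foldr partial_deriv is g x\<bar>) ` {is. length is = k \<and> sorted is})"

definition covariance :: "'a measure \<Rightarrow> ('a \<Rightarrow> real) \<Rightarrow> ('a \<Rightarrow> real) \<Rightarrow> real" where
  "covariance M U V =
     (\<integral>\<omega>. (U \<omega> - (\<integral>\<omega>. U \<omega> \<partial>M)) * (V \<omega> - (\<integral>\<omega>. V \<omega> \<partial>M)) \<partial>M)"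

text \<open>Point masses count as Gaussian laws (variance 0), so that a Gaussian vector may have a
  singular covariance matrix.\<close>

definition gaussian_law :: "real \<Rightarrow> real \<Rightarrow> real measure" where
  "gaussian_law m s =
     (if s = 0 then return borel m else density lborel (\<lambda>x. ennreal (normal_density m s x)))"

definition gaussian_vector :: "'a measure \<Rightarrow> ('a \<Rightarrow> real^'d::finite) \<Rightarrow> bool" where
  "gaussian_vector M Y \<longleftrightarrow>
     Y \<in> borel_measurable M \<and>
     (\<forall>t. \<exists>m s. s \<ge> 0 \<and> distr M borel (\<lambda>\<omega>. t \<bullet> Y \<omega>) = gaussian_law m s)"

definition centered_gaussian_vector ::
    "'a measure \<Rightarrow> ('a \<Rightarrow> real^'d::finite) \<Rightarrow> real^'d^'d \<Rightarrow> bool" where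
  "centered_gaussian_vector M Y C \<longleftrightarrow>
     gaussian_vector M Y \<and>
     (\<forall>i. (\<integral>\<omega>. Y \<omega> $ i \<partial>M) = 0) \<and>
     (\<forall>i j. covariance M (\<lambda>\<omega>. Y \<omega> $ i) (\<lambda>\<omega>. Y \<omega> $ j) = C $ i $ j)"

definition converges_in_distribution ::
    "'a measure \<Rightarrow> (nat \<Rightarrow> 'a \<Rightarrow> 'c::euclidean_space) \<Rightarrow> 'b measure \<Rightarrow> ('b \<Rightarrow> 'c) \<Rightarrow> bool" where
  "converges_in_distribution M F N Y \<longleftrightarrow>
     (\<forall>h :: 'c \<Rightarrow> real. continuous_on UNIV h \<and> bounded (range h) \<longrightarrow>
        (\<lambda>n. \<integral>\<omega>. h (F n \<omega>) \<partial>M) \<longlonglongrightarrow> (\<integral>\<omega>. h (Y \<omega>) \<partial>N))"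

definition quad_sums ::
    "(nat \<Rightarrow> 'd \<Rightarrow> nat \<Rightarrow> nat \<Rightarrow> real) \<Rightarrow> (nat \<Rightarrow> 'a \<Rightarrow> real) \<Rightarrow> nat \<Rightarrow> 'a \<Rightarrow> real^'d::finite" where
  "quad_sums a X n \<omega> = (\<chi> i. \<Sum>u=1..n. \<Sum>v=u..n. a n i u v * X u \<omega> * X v \<omega>)"

end

theory Submission
  imports Defs
begin

text \<open>
  Interpolate by \<open>\<phi>(r) = E g(sin r F + cos r Y)\<close> with F and Y independent. In \<open>\<phi>'(r)\<close> the Y-part is
  handled by Gaussian integration by parts and the F-part by its discrete analogue: with
  \<open>A\<^sub>k = \<Sum>\<^sub>v a\<^sub>k\<^sub>v X\<^sub>v\<close> one has \<open>F\<^sub>i = (\<Sum>\<^sub>k X\<^sub>k A\<^sub>k\<^sub>i)/2\<close> and \<open>F = W\<^sub>k + X\<^sub>k A\<^sub>k\<close>, where \<open>W\<^sub>k\<close> and \<open>A\<^sub>k\<close> are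
  independent of \<open>X\<^sub>k\<close>, so expanding around \<open>W\<^sub>k\<close> gives
  \<open>E F\<^sub>i h(F) \<approx> \<Sum>\<^sub>j E \<Gamma>\<^sub>i\<^sub>j h\<^sub>j(F)\<close> with \<open>\<Gamma>\<^sub>i\<^sub>j = (\<Sum>\<^sub>k A\<^sub>k\<^sub>i A\<^sub>k\<^sub>j)/2\<close> and an error of third order. The mean of
  \<open>\<Gamma>\<^sub>i\<^sub>j\<close> is \<open>E F\<^sub>i F\<^sub>j\<close> and its variance is governed by the contractions.

  Gaussian integration by parts for a possibly singular covariance follows by differentiating the
  rotation invariance \<open>cos r Y + sin r Y' \<sim> Y\<close>, which rests on the multivariate uniqueness theorem for
  characteristic functions. For convergence in distribution, test functions with bounded
  derivatives suffice because the second moments of F are bounded.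
\<close>

section \<open>Partial derivatives\<close>

text \<open>The trigonometric path is chosen so that the two integrations by parts match.
  Differentiation multiplies the F-part by \<open>cos r\<close> and the Y-part by
  \<open>- sin r\<close>; integrating by parts then brings out the inner factors
  \<open>sin r\<close> and \<open>cos r\<close>. Both main terms thus carry
  \<open>sin r * cos r\<close>, one with \<Gamma> and one with \<open>C\<close>, and only their
  difference survives. The third-order error carries \<open>(sin r)\<^sup>2 * cos r\<close>. A
  quarter turn yields the factors 1/2 and 1/3. Two obstacles shape the analysis. Only the second and
  third derivatives of the test function are bounded, so it may grow quadratically, and every
  interchange of limit and expectation is dominated by a quadratic polynomial in the norms of F and
  Y. The derivative norms are maxima over sorted index lists, so partial derivatives must be shown
  to commute before the norms control all of them. The constants obtained, K/4 and sqrt 3 / 3, lie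
  below those of the theorem.\<close>

lemma has_partial_deriv_line:
  assumes "has_partial_deriv i g"
  shows "((\<lambda>t. g (x + t *\<^sub>R axis i 1)) has_real_derivative partial_deriv i g (x + s *\<^sub>R axis i 1)) (at s)"
proof -
  have "((\<lambda>t. g ((x + s *\<^sub>R axis i 1) + t *\<^sub>R axis i 1)) has_real_derivative
      partial_deriv i g (x + s *\<^sub>R axis i 1)) (at 0)"
    using assms unfolding has_partial_deriv_def partial_deriv_def
    by (metis DERIV_deriv_iff_field_differentiable)
  then have "((\<lambda>t. g ((x + s *\<^sub>R axis i 1) + t *\<^sub>R axis i 1)) has_real_derivative
      partial_deriv i g (x + s *\<^sub>R axis i 1)) (at (s - s))" by simp
  then have "((\<lambda>t. g ((x + s *\<^sub>R axis i 1) + (t - s) *\<^sub>R axis i 1)) has_real_derivative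
      partial_deriv i g (x + s *\<^sub>R axis i 1) * 1) (at s)"
    by (rule DERIV_chain2[where g="\<lambda>t. t - s"]) (auto intro!: derivative_eq_intros)
  then show ?thesis by (simp add: algebra_simps)
qed

text \<open>Mean value theorem on a coordinate line. Locating the point only by
  \<open>\<bar>s\<bar> \<le> \<bar>r\<bar>\<close> lets one statement serve steps of either sign and
  \<open>r = 0\<close>.\<close>

lemma increment_along_axis:
  assumes "has_partial_deriv i g"
  shows "\<exists>s. \<bar>s\<bar> \<le> \<bar>r\<bar> \<and> g (x + r *\<^sub>R axis i 1) - g x = r * partial_deriv i g (x + s *\<^sub>R axis i 1)"
proof -
  have D: "\<And>s. ((\<lambda>t. g (x + t *\<^sub>R axis i 1)) has_real_derivative
      partial_deriv i g (x + s *\<^sub>R axis i 1)) (at s)"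
    by (rule has_partial_deriv_line[OF assms])
  consider "r = 0" | "r > 0" | "r < 0" by linarith
  then show ?thesis
  proof cases
    case 1 then show ?thesis by auto
  next
    case 2
    from MVT2[OF this, of "\<lambda>t. g (x + t *\<^sub>R axis i 1)" "\<lambda>s. partial_deriv i g (x + s *\<^sub>R axis i 1)"] D
    obtain z where "0 < z" "z < r" "g (x + r *\<^sub>R axis i 1) - g x = r * partial_deriv i g (x + z *\<^sub>R axis i 1)"
      by auto
    then show ?thesis by (intro exI[of _ z]) auto
  next
    case 3
    from MVT2[OF this, of "\<lambda>t. g (x + t *\<^sub>R axis i 1)" "\<lambda>s. partial_deriv i g (x + s *\<^sub>R axis i 1)"] D
    obtain z where "r < z" "z < 0" "g x - g (x + r *\<^sub>R axis i 1) = - r * partial_deriv i g (x + z *\<^sub>R axis i 1)"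
      by auto
    then show ?thesis by (intro exI[of _ z]) auto
  qed
qed

text \<open>\<open>S\<close> is the set of coordinates in which the increment may be nonzero.
  Enlarging \<open>S\<close> by one coordinate adds a move along one axis, where the mean value
  theorem applies, and continuity of that partial derivative moves its argument back to
  \<open>x\<close>. Measured in the l1 norm the errors simply add up.\<close>

lemma continuous_partials_increment:
  fixes g :: "real^'d::finite \<Rightarrow> real"
  assumes hp: "\<And>i. has_partial_deriv i g"
    and cont: "\<And>i. continuous_on UNIV (partial_deriv i g)"
    and "finite S" "e > 0"
  shows "\<exists>r>0. \<forall>h. norm h < r \<longrightarrow> (\<forall>i. i \<notin> S \<longrightarrow> h $ i = 0) \<longrightarrow>
     \<bar>g (x + h) - g x - (\<Sum>i\<in>S. h $ i * partial_deriv i g x)\<bar> \<le> e * (\<Sum>i\<in>S. \<bar>h $ i\<bar>)"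
  using \<open>finite S\<close>
proof (induction S)
  case empty
  have "h = 0" if "\<forall>i. h $ i = 0" for h :: "real^'d"
    using that by (simp add: vec_eq_iff)
  then have "\<bar>g (x + h) - g x\<bar> \<le> 0" if "\<forall>i. h $ i = 0" for h
    using that by fastforce
  then show ?case by (intro exI[of _ 1]) auto
next
  case (insert k S)
  then obtain r1 where r1: "r1 > 0" "\<And>h. norm h < r1 \<Longrightarrow> (\<forall>i. i \<notin> S \<longrightarrow> h $ i = 0) \<Longrightarrow>
     \<bar>g (x + h) - g x - (\<Sum>i\<in>S. h $ i * partial_deriv i g x)\<bar> \<le> e * (\<Sum>i\<in>S. \<bar>h $ i\<bar>)"
    by blast
  have "isCont (partial_deriv k g) x"
    using cont by (simp add: continuous_on_eq_continuous_at)
  then obtain r2 where r2: "r2 > 0" "\<And>y. dist y x < r2 \<Longrightarrow> dist (partial_deriv k g y) (partial_deriv k g x) < e"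
    using \<open>e > 0\<close> unfolding continuous_at_eps_delta by blast
  show ?case
  \<comment> \<open>The intermediate point lies within \<open>norm h' + \<bar>s\<bar>\<close>, at
    most twice \<open>norm h\<close>, of \<open>x\<close>; hence \<open>r2/2\<close>.\<close>
  proof (intro exI[of _ "min r1 (r2/2)"] conjI allI impI)
    fix h :: "real^'d"
    assume n: "norm h < min r1 (r2/2)" and z: "\<forall>i. i \<notin> insert k S \<longrightarrow> h $ i = 0"
    define h' where "h' = (\<chi> i. if i = k then 0 else h $ i)"
    have hh: "h = h' + h $ k *\<^sub>R axis k 1"
      by (simp add: vec_eq_iff h'_def axis_def)
    have n': "norm h' \<le> norm h"
      by (rule norm_le_componentwise_cart) (simp add: h'_def)
    have nk: "\<bar>h $ k\<bar> \<le> norm h" by (rule component_le_norm_cart)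
    have z': "\<forall>i. i \<notin> S \<longrightarrow> h' $ i = 0" using z by (auto simp: h'_def)
    obtain s where s: "\<bar>s\<bar> \<le> \<bar>h $ k\<bar>"
      "g ((x + h') + h $ k *\<^sub>R axis k 1) - g (x + h') = h $ k * partial_deriv k g ((x + h') + s *\<^sub>R axis k 1)"
      using increment_along_axis[OF hp] by blast
    have "dist ((x + h') + s *\<^sub>R axis k 1) x \<le> norm h' + \<bar>s\<bar>"
      by (simp add: dist_norm add.assoc) (metis mult.right_neutral norm_axis_1 norm_scaleR norm_triangle_ineq real_norm_def)
    also have "\<dots> < r2" using n n' nk s(1) by linarith
    finally have c: "\<bar>partial_deriv k g ((x + h') + s *\<^sub>R axis k 1) - partial_deriv k g x\<bar> \<le> e"
      using r2(2) by (force simp: dist_real_def)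
    have ss: "(\<Sum>i\<in>S. h' $ i * partial_deriv i g x) = (\<Sum>i\<in>S. h $ i * partial_deriv i g x)"
      "(\<Sum>i\<in>S. \<bar>h' $ i\<bar>) = (\<Sum>i\<in>S. \<bar>h $ i\<bar>)"
      using insert.hyps by (auto simp: h'_def intro!: sum.cong)
    have "norm h' < r1" using n n' by linarith
    from r1(2)[OF this z'] have a: "\<bar>g (x + h') - g x - (\<Sum>i\<in>S. h $ i * partial_deriv i g x)\<bar> \<le> e * (\<Sum>i\<in>S. \<bar>h $ i\<bar>)"
      by (simp add: ss)
    have b: "\<bar>h $ k * (partial_deriv k g ((x + h') + s *\<^sub>R axis k 1) - partial_deriv k g x)\<bar> \<le> e * \<bar>h $ k\<bar>"
      unfolding abs_mult using c by (metis abs_ge_zero mult.commute mult_left_mono)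
    have "g (x + h) - g x - (\<Sum>i\<in>insert k S. h $ i * partial_deriv i g x)
       = (g (x + h') - g x - (\<Sum>i\<in>S. h $ i * partial_deriv i g x))
       + h $ k * (partial_deriv k g ((x + h') + s *\<^sub>R axis k 1) - partial_deriv k g x)"
      using s(2) insert.hyps by (subst (1) hh) (simp add: algebra_simps)
    then show "\<bar>g (x + h) - g x - (\<Sum>i\<in>insert k S. h $ i * partial_deriv i g x)\<bar>
        \<le> e * (\<Sum>i\<in>insert k S. \<bar>h $ i\<bar>)"
      using a b insert.hyps by (simp add: distrib_left)
  qed (use r1 r2 in auto)
qed

lemma continuous_partials_has_derivative:
  fixes g :: "real^'d::finite \<Rightarrow> real"
  assumes "\<And>i. has_partial_deriv i g"
    and "\<And>i. continuous_on UNIV (partial_deriv i g)"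
  shows "(g has_derivative (\<lambda>h. \<Sum>i\<in>UNIV. h $ i * partial_deriv i g x)) (at x)"
  unfolding has_derivative_at_alt
proof (intro conjI allI impI)
  show "bounded_linear (\<lambda>h. \<Sum>i\<in>UNIV. h $ i * partial_deriv i g x)"
    by (intro bounded_linear_sum bounded_linear_mult_const bounded_linear_vec_nth)
next
  fix e :: real assume "e > 0"
  \<comment> \<open>The increment is controlled in the l1 norm, which is at most
    \<open>CARD('d)\<close> times the Euclidean norm; the quotient compensates for this.\<close>
  then have e: "e / real CARD('d) > 0" by simp
  obtain r where r: "r > 0" "\<And>h. norm h < r \<Longrightarrow>
     \<bar>g (x + h) - g x - (\<Sum>i\<in>UNIV. h $ i * partial_deriv i g x)\<bar>
       \<le> e / real CARD('d) * (\<Sum>i\<in>UNIV. \<bar>h $ i\<bar>)"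
    using continuous_partials_increment[OF assms finite[of UNIV] e, where x = x] by auto
  have "norm (g y - g x - (\<Sum>i\<in>UNIV. (y - x) $ i * partial_deriv i g x)) \<le> e * norm (y - x)"
    if "norm (y - x) < r" for y
  proof -
    have "(\<Sum>i\<in>UNIV. \<bar>(y - x) $ i\<bar>) \<le> real CARD('d) * norm (y - x)"
      using sum_bounded_above[of UNIV "\<lambda>i. \<bar>(y - x) $ i\<bar>" "norm (y - x)"] component_le_norm_cart[of "y - x"] by simp
    then have "e / real CARD('d) * (\<Sum>i\<in>UNIV. \<bar>(y - x) $ i\<bar>) \<le> e / real CARD('d) * (real CARD('d) * norm (y - x))"
      using e by (intro mult_left_mono) auto
    then show ?thesis using r(2)[OF that] by simp
  qed
  then show "\<exists>d>0. \<forall>y. norm (y - x) < d \<longrightarrow>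
      norm (g y - g x - (\<Sum>i\<in>UNIV. (y - x) $ i * partial_deriv i g x)) \<le> e * norm (y - x)"
    using r(1) by blast
qed

section \<open>Symmetry of mixed partial derivatives and bounds by the derivative norms\<close>

lemma second_difference_mean_value:
  assumes gi: "has_partial_deriv i g" and gij: "has_partial_deriv j (partial_deriv i g)" and "r > 0"
  shows "\<exists>s t. \<bar>s\<bar> \<le> r \<and> \<bar>t\<bar> \<le> r \<and>
    g (x + r *\<^sub>R axis i 1 + r *\<^sub>R axis j 1) - g (x + r *\<^sub>R axis i 1) - g (x + r *\<^sub>R axis j 1) + g x
      = r * (r * partial_deriv j (partial_deriv i g) (x + s *\<^sub>R axis i 1 + t *\<^sub>R axis j 1))"
proof -
  define f where "f s = g (x + r *\<^sub>R axis j 1 + s *\<^sub>R axis i 1) - g (x + s *\<^sub>R axis i 1)" for s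
  have "(f has_real_derivative partial_deriv i g (x + r *\<^sub>R axis j 1 + s *\<^sub>R axis i 1)
      - partial_deriv i g (x + s *\<^sub>R axis i 1)) (at s)" for s
    unfolding f_def by (intro DERIV_diff has_partial_deriv_line gi)
  from MVT2[OF \<open>r > 0\<close> this] obtain s where s: "0 < s" "s < r"
    "f r - f 0 = r * (partial_deriv i g (x + s *\<^sub>R axis i 1 + r *\<^sub>R axis j 1) - partial_deriv i g (x + s *\<^sub>R axis i 1))"
    by (auto simp: algebra_simps)
  obtain t where t: "\<bar>t\<bar> \<le> \<bar>r\<bar>" "partial_deriv i g (x + s *\<^sub>R axis i 1 + r *\<^sub>R axis j 1) - partial_deriv i g (x + s *\<^sub>R axis i 1)
     = r * partial_deriv j (partial_deriv i g) (x + s *\<^sub>R axis i 1 + t *\<^sub>R axis j 1)"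
    using increment_along_axis[OF gij] by blast
  show ?thesis
    using s t \<open>r > 0\<close> by (intro exI[of _ s] exI[of _ t]) (auto simp: f_def algebra_simps)
qed

text \<open>The second difference of \<open>g\<close> over a small square is symmetric in
  \<open>i\<close> and \<open>j\<close>, and \<open>second_difference_mean_value\<close> equates it
  with \<open>r * r\<close> times either mixed derivative at a nearby point. As the square shrinks,
  continuity identifies the two at \<open>x\<close>.\<close>

lemma mixed_partials_commute:
  fixes g :: "real^'d::finite \<Rightarrow> real"
  assumes gi: "has_partial_deriv i g" and gij: "has_partial_deriv j (partial_deriv i g)"
    and gj: "has_partial_deriv j g" and gji: "has_partial_deriv i (partial_deriv j g)"
    and cij: "continuous_on UNIV (partial_deriv j (partial_deriv i g))"
    and cji: "continuous_on UNIV (partial_deriv i (partial_deriv j g))"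
  shows "partial_deriv j (partial_deriv i g) = partial_deriv i (partial_deriv j g)"
proof
  fix x
  let ?p = "partial_deriv j (partial_deriv i g)" and ?q = "partial_deriv i (partial_deriv j g)"
  have "\<bar>?p x - ?q x\<bar> \<le> e" if "e > 0" for e
  proof -
    have "isCont ?p x" "isCont ?q x"
      using cij cji by (simp_all add: continuous_on_eq_continuous_at)
    then obtain a b where ab: "a > 0" "b > 0" "\<And>y. dist y x < a \<Longrightarrow> dist (?p y) (?p x) < e/2"
       "\<And>y. dist y x < b \<Longrightarrow> dist (?q y) (?q x) < e/2"
      using \<open>e > 0\<close> unfolding continuous_at_eps_delta by (metis half_gt_zero)
    \<comment> \<open>Intermediate points are within \<open>2 * r\<close> of \<open>x\<close>; a
      third keeps this strictly below both radii.\<close>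
    define r where "r = min a b / 3"
    have r: "r > 0" "2 * r < a" "2 * r < b" using ab by (auto simp: r_def)
    have near: "dist (x + s *\<^sub>R axis k 1 + t *\<^sub>R axis l 1) x \<le> 2 * r"
      if "\<bar>s\<bar> \<le> r" "\<bar>t\<bar> \<le> r" for s t k l
    proof -
      have "norm (s *\<^sub>R axis k (1::real) + t *\<^sub>R axis l 1 :: real^'d) \<le> \<bar>s\<bar> + \<bar>t\<bar>"
        by (metis mult.right_neutral norm_axis_1 norm_scaleR norm_triangle_ineq real_norm_def)
      then show ?thesis using that by (simp add: dist_norm add.assoc)
    qed
    obtain s t where 1: "\<bar>s\<bar> \<le> r" "\<bar>t\<bar> \<le> r"
       "g (x + r *\<^sub>R axis i 1 + r *\<^sub>R axis j 1) - g (x + r *\<^sub>R axis i 1) - g (x + r *\<^sub>R axis j 1) + g x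
      = r * (r * ?p (x + s *\<^sub>R axis i 1 + t *\<^sub>R axis j 1))"
      using second_difference_mean_value[OF gi gij r(1)] by blast
    obtain s' t' where 2: "\<bar>s'\<bar> \<le> r" "\<bar>t'\<bar> \<le> r"
       "g (x + r *\<^sub>R axis j 1 + r *\<^sub>R axis i 1) - g (x + r *\<^sub>R axis j 1) - g (x + r *\<^sub>R axis i 1) + g x
      = r * (r * ?q (x + s' *\<^sub>R axis j 1 + t' *\<^sub>R axis i 1))"
      using second_difference_mean_value[OF gj gji r(1)] by blast
    have "r * (r * ?p (x + s *\<^sub>R axis i 1 + t *\<^sub>R axis j 1)) = r * (r * ?q (x + s' *\<^sub>R axis j 1 + t' *\<^sub>R axis i 1))"
      unfolding 1(3)[symmetric] 2(3)[symmetric] by (simp add: algebra_simps)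
    then have "?p (x + s *\<^sub>R axis i 1 + t *\<^sub>R axis j 1) = ?q (x + s' *\<^sub>R axis j 1 + t' *\<^sub>R axis i 1)"
      using r by simp
    moreover have "dist (?p (x + s *\<^sub>R axis i 1 + t *\<^sub>R axis j 1)) (?p x) < e/2"
      using near[OF 1(1,2), of i j] r by (intro ab) linarith
    moreover have "dist (?q (x + s' *\<^sub>R axis j 1 + t' *\<^sub>R axis i 1)) (?q x) < e/2"
      using near[OF 2(1,2), of j i] r by (intro ab) linarith
    ultimately show ?thesis by (simp add: dist_real_def abs_if split: if_splits)
  qed
  then show "?p x = ?q x" by (metis abs_le_zero_iff dense_ge eq_iff_diff_eq_0)
qed

lemma times_cont_diff_cont: "times_cont_diff k g \<Longrightarrow> continuous_on UNIV g"
  by (cases k) auto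

lemma times_cont_diff_Suc_imp: "times_cont_diff (Suc k) g \<Longrightarrow> times_cont_diff k g"
  by (induction k arbitrary: g) (auto intro: times_cont_diff_cont)

lemma times_cont_diff_commute:
  assumes "times_cont_diff (Suc (Suc k)) g"
  shows "partial_deriv i (partial_deriv j g) = partial_deriv j (partial_deriv i g)"
  by (rule mixed_partials_commute) (use assms in \<open>auto dest: times_cont_diff_cont\<close>)

text \<open>\<open>insort\<close> moves \<open>i\<close> past the smaller indices one swap at a
  time. Each swap needs two orders of differentiability after the indices behind it have been used
  up, and the hypothesis on \<open>g\<close> leaves exactly enough.\<close>

lemma foldr_partial_deriv_insort:
  fixes g :: "real^'d::{finite,linorder} \<Rightarrow> real"
  assumes "times_cont_diff (Suc (length is)) g"
  shows "foldr partial_deriv (insort i is) g = partial_deriv i (foldr partial_deriv is g)"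
  using assms
proof (induction "is")
  case (Cons j js)
  \<comment> \<open>Every index consumes one order of differentiability; \<open>m\<close> orders
    remain.\<close>
  have "times_cont_diff m (foldr partial_deriv is g)" if "times_cont_diff (m + length is) g" for m "is" 
    using that
  proof (induction "is" arbitrary: m)
    case (Cons a "is")
    have "times_cont_diff (Suc m + length is) g"
      using Cons.prems by (simp only: length_Cons add_Suc_right add_Suc)
    from Cons.IH[OF this] show ?case by simp
  qed simp
  from this[of "Suc (Suc 0)" js] have "times_cont_diff (Suc (Suc 0)) (foldr partial_deriv js g)"
    using Cons.prems by simp
  from times_cont_diff_commute[OF this, of i j]
  have c: "partial_deriv i (partial_deriv j (foldr partial_deriv js g)) =
      partial_deriv j (partial_deriv i (foldr partial_deriv js g))" .
  have "times_cont_diff (Suc (length js)) g"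
    using Cons.prems times_cont_diff_Suc_imp[of "Suc (length js)" g] by (simp only: length_Cons)
  from Cons.IH[OF this] c show ?case by simp
qed simp

text \<open>\<open>deriv_sup_norm\<close> sees only sorted index lists, whereas Taylor expansion
  produces derivatives in arbitrary order.\<close>

lemma foldr_partial_deriv_sort:
  fixes g :: "real^'d::{finite,linorder} \<Rightarrow> real"
  assumes "times_cont_diff (length is) g"
  shows "foldr partial_deriv (sort is) g = foldr partial_deriv is g"
  using assms
proof (induction "is")
  case (Cons j js)
  have "times_cont_diff (length js) g"
    using Cons.prems times_cont_diff_Suc_imp[of "length js" g] by (simp only: length_Cons)
  moreover have "times_cont_diff (Suc (length (sort js))) g"
    using Cons.prems by (simp only: length_Cons length_sort)
  ultimately show ?case
    using Cons.IH foldr_partial_deriv_insort[of "sort js" g j] by simp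
qed simp

text \<open>Finiteness of the norm matters because \<open>enn2real\<close> sends infinity to 0,
  which would bound nothing.\<close>

lemma abs_partial_le_deriv_sup_norm:
  fixes g :: "real^'d::{finite,linorder} \<Rightarrow> real"
  assumes "times_cont_diff (length is) g" "deriv_sup_norm (length is) g < \<infinity>"
  shows "\<bar>foldr partial_deriv is g x\<bar> \<le> enn2real (deriv_sup_norm (length is) g)"
proof -
  have fin: "finite {js :: 'd list. length js = length is \<and> sorted js}"
    using finite_lists_length_eq[of "UNIV :: 'd set" "length is"] by (rule rev_finite_subset) auto
  have "ennreal \<bar>foldr partial_deriv is g x\<bar> \<le> (SUP x. ennreal \<bar>foldr partial_deriv (sort is) g x\<bar>)"
    unfolding foldr_partial_deriv_sort[OF assms(1)] by (rule SUP_upper) simp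
  also have "\<dots> \<le> deriv_sup_norm (length is) g"
    unfolding deriv_sup_norm_def using fin by (intro Max_ge) auto
  finally show ?thesis
    using assms(2) by (metis abs_ge_zero enn2real_ennreal enn2real_mono infinity_ennreal_def)
qed

section \<open>Moments of linear and quadratic forms\<close>

text \<open>Sums and multiples stay in this class and a product of two members is integrable; most
  integrability questions below reduce to these closure properties.\<close>

definition square_integrable :: "'a measure \<Rightarrow> ('a \<Rightarrow> real) \<Rightarrow> bool" where
  "square_integrable M f \<longleftrightarrow> f \<in> borel_measurable M \<and> integrable M (\<lambda>x. (f x)\<^sup>2)"

lemma square_integrable_cmult: "square_integrable M f \<Longrightarrow> square_integrable M (\<lambda>x. c * f x)"
  by (auto simp: square_integrable_def power_mult_distrib)

lemma square_integrable_add: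
  assumes "square_integrable M f" "square_integrable M g"
  shows "square_integrable M (\<lambda>x. f x + g x)"
proof -
  have [measurable]: "f \<in> borel_measurable M" "g \<in> borel_measurable M"
    using assms by (simp_all add: square_integrable_def)
  have "integrable M (\<lambda>x. (f x + g x)\<^sup>2)"
  proof (rule Bochner_Integration.integrable_bound)
    show "integrable M (\<lambda>x. 2 * (f x)\<^sup>2 + 2 * (g x)\<^sup>2)"
      using assms by (auto simp: square_integrable_def)
    have "(a + b)\<^sup>2 \<le> 2 * a\<^sup>2 + 2 * b\<^sup>2" for a b :: real
      using zero_le_power2[of "a - b"] by (simp add: power2_eq_square algebra_simps)
    then show "AE x in M. norm ((f x + g x)\<^sup>2) \<le> norm (2 * (f x)\<^sup>2 + 2 * (g x)\<^sup>2)"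
      by (intro AE_I2) (simp only: real_norm_def abs_of_nonneg zero_le_power2, smt (verit) zero_le_power2)
  qed measurable
  then show ?thesis using assms by (auto simp: square_integrable_def)
qed

lemma square_integrable_sum:
  assumes "\<And>i. i \<in> A \<Longrightarrow> square_integrable M (f i)"
  shows "square_integrable M (\<lambda>x. \<Sum>i\<in>A. f i x)"
  using assms
proof (induction A rule: infinite_finite_induct)
  case (insert a A)
  then show ?case by (simp add: square_integrable_add)
qed (auto simp: square_integrable_def)

lemma square_integrable_abs: "square_integrable M f \<Longrightarrow> square_integrable M (\<lambda>x. \<bar>f x\<bar>)"
  by (auto simp: square_integrable_def intro: borel_measurable_abs)

lemma square_integrable_mult_integrable:
  assumes "square_integrable M f" "square_integrable M g"
  shows "integrable M (\<lambda>x. f x * g x)"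
proof (rule Bochner_Integration.integrable_bound)
  have [measurable]: "f \<in> borel_measurable M" "g \<in> borel_measurable M"
    using assms by (simp_all add: square_integrable_def)
  show "(\<lambda>x. f x * g x) \<in> borel_measurable M" by measurable
  show "integrable M (\<lambda>x. (f x)\<^sup>2 + (g x)\<^sup>2)"
    using assms by (auto simp: square_integrable_def)
  have "\<bar>a * b\<bar> \<le> a\<^sup>2 + b\<^sup>2" for a b :: real
    using sum_squares_bound[of "\<bar>a\<bar>" "\<bar>b\<bar>"] mult_nonneg_nonneg[OF abs_ge_zero abs_ge_zero, of a b]
    by (simp only: abs_mult power2_abs mult.assoc)
  then show "AE x in M. norm (f x * g x) \<le> norm ((f x)\<^sup>2 + (g x)\<^sup>2)" by simp
qed

lemma square_integrable_mult:
  assumes [measurable]: "f \<in> borel_measurable M" "g \<in> borel_measurable M"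
    and "integrable M (\<lambda>x. f x ^ 4)" "integrable M (\<lambda>x. g x ^ 4)"
  shows "square_integrable M (\<lambda>x. f x * g x)"
proof -
  have "square_integrable M (\<lambda>x. (f x)\<^sup>2)" "square_integrable M (\<lambda>x. (g x)\<^sup>2)"
    using assms by (auto simp: square_integrable_def)
  from square_integrable_mult_integrable[OF this] show ?thesis
    by (auto simp: square_integrable_def power_mult_distrib)
qed

lemma (in prob_space) square_integrable_const: "square_integrable M (\<lambda>x. c)"
  by (simp add: square_integrable_def)

lemma (in prob_space) square_integrable_imp_integrable:
  "square_integrable M f \<Longrightarrow> integrable M f"
  using square_integrable_mult_integrable[OF _ square_integrable_const[of 1]] by simp

lemma (in prob_space) square_integrable_abs_bound:
  assumes "square_integrable M g" "f \<in> borel_measurable M" "\<And>x. \<bar>f x\<bar> \<le> \<bar>g x\<bar>"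
  shows "square_integrable M f"
proof -
  have "integrable M (\<lambda>x. (f x)\<^sup>2)"
  proof (rule Bochner_Integration.integrable_bound)
    show "integrable M (\<lambda>x. (g x)\<^sup>2)" using assms(1) by (simp add: square_integrable_def)
    show "(\<lambda>x. (f x)\<^sup>2) \<in> borel_measurable M" using assms(2) by measurable
    show "AE x in M. norm ((f x)\<^sup>2) \<le> norm ((g x)\<^sup>2)"
      using assms(3) by (simp add: abs_le_square_iff)
  qed
  then show ?thesis using assms by (simp add: square_integrable_def)
qed

lemma (in prob_space) integrable_power_fourth:
  fixes f :: "'a \<Rightarrow> real"
  assumes [measurable]: "f \<in> borel_measurable M" and "integrable M (\<lambda>x. f x ^ 4)" "k \<le> 4"
  shows "integrable M (\<lambda>x. f x ^ k)"
proof (rule Bochner_Integration.integrable_bound)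
  show "integrable M (\<lambda>x. 1 + f x ^ 4)" using assms by auto
  have "\<bar>a\<bar> ^ k \<le> 1 + \<bar>a\<bar> ^ 4" for a :: real
  proof (cases "\<bar>a\<bar> \<le> 1")
    case True then show ?thesis by (meson abs_ge_zero le_add_same_cancel1 order_trans power_le_one zero_le_power)
  next
    case False then show ?thesis using power_increasing[OF \<open>k \<le> 4\<close>, of "\<bar>a\<bar>"] by simp
  qed
  then show "AE x in M. norm (f x ^ k) \<le> norm (1 + f x ^ 4)"
    by (simp add: power_abs) 
qed simp

lemma (in prob_space) expectation_abs_le_sqrt:
  assumes "square_integrable M f"
  shows "expectation (\<lambda>x. \<bar>f x\<bar>) \<le> sqrt (expectation (\<lambda>x. (f x)\<^sup>2))"
proof -
  have i: "integrable M (\<lambda>x. \<bar>f x\<bar>)" using square_integrable_imp_integrable[OF assms] by simp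
  have s: "integrable M (\<lambda>x. \<bar>f x\<bar>\<^sup>2)" using assms by (simp add: square_integrable_def)
  have "0 \<le> variance (\<lambda>x. \<bar>f x\<bar>)" by (intro Bochner_Integration.integral_nonneg) auto
  also have "\<dots> = expectation (\<lambda>x. \<bar>f x\<bar>\<^sup>2) - (expectation (\<lambda>x. \<bar>f x\<bar>))\<^sup>2"
    by (rule variance_eq[OF i s])
  finally show ?thesis by (intro real_le_rsqrt) simp
qed

text \<open>Cauchy-Schwarz for \<open>\<bar>f\<bar>\<close> and \<open>f\<^sup>2\<close>, read off
  from the fact that the mean of \<open>(\<bar>f\<bar> * r - f\<^sup>2)\<^sup>2\<close> is a
  quadratic polynomial in \<open>r\<close> without negative values.\<close>

lemma (in prob_space) expectation_abs_cube_le: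
  fixes f :: "'a \<Rightarrow> real"
  assumes [measurable]: "f \<in> borel_measurable M" and f4: "integrable M (\<lambda>x. f x ^ 4)"
  shows "expectation (\<lambda>x. \<bar>f x\<bar> ^ 3) \<le> sqrt (expectation (\<lambda>x. (f x)\<^sup>2)) * sqrt (expectation (\<lambda>x. f x ^ 4))"
proof -
  have sq: "integrable M (\<lambda>x. (f x)\<^sup>2)" by (rule integrable_power_fourth[OF _ f4]) simp_all
  have cu: "integrable M (\<lambda>x. \<bar>f x\<bar> ^ 3)"
    using integrable_power_fourth[OF _ f4, of 3] by (simp add: power_abs flip: power_abs)
  let ?a = "expectation (\<lambda>x. (f x)\<^sup>2)" and ?b = "expectation (\<lambda>x. f x ^ 4)" and ?c = "expectation (\<lambda>x. \<bar>f x\<bar> ^ 3)"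
  have q: "0 \<le> ?a * r\<^sup>2 - 2 * ?c * r + ?b" for r
  proof -
    have "0 \<le> expectation (\<lambda>x. (\<bar>f x\<bar> * r - (f x)\<^sup>2)\<^sup>2)" by (intro Bochner_Integration.integral_nonneg) auto
    also have "(\<lambda>x. (\<bar>f x\<bar> * r - (f x)\<^sup>2)\<^sup>2) = (\<lambda>x. r\<^sup>2 * (f x)\<^sup>2 - 2 * r * \<bar>f x\<bar> ^ 3 + f x ^ 4)"
      by (auto simp: fun_eq_iff power2_eq_square power3_eq_cube power4_eq_xxxx algebra_simps abs_if)
    also have "expectation \<dots> = r\<^sup>2 * ?a - 2 * r * ?c + ?b"
      using sq cu f4 by simp
    finally show ?thesis by (simp add: algebra_simps)
  qed
  have a0: "?a \<ge> 0" and b0: "?b \<ge> 0" and c0: "?c \<ge> 0" by (auto intro!: Bochner_Integration.integral_nonneg)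
  have "?c\<^sup>2 \<le> ?a * ?b"
  proof (cases "?a = 0")
    case True
    have "?c = 0"
    proof (rule ccontr)
      assume "?c \<noteq> 0"
      \<comment> \<open>Without its leading coefficient the polynomial is affine; at this argument
        it equals -1.\<close>
      then show False using q[of "(?b + 1) / (2 * ?c)"] True c0 by simp
    qed
    then show ?thesis using a0 b0 by simp
  next
    case False
    then have "?a > 0" using a0 by linarith
    \<comment> \<open>\<open>?c / ?a\<close> is the minimizer of the quadratic polynomial.\<close>
    moreover have "?a * (?c / ?a)\<^sup>2 - 2 * ?c * (?c / ?a) + ?b = ?b - ?c\<^sup>2 / ?a"
      using False by (simp add: power2_eq_square field_simps)
    ultimately have "?c\<^sup>2 / ?a \<le> ?b" using q[of "?c / ?a"] by linarith
    then show ?thesis using \<open>?a > 0\<close> by (simp only: pos_divide_le_eq mult.commute)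
  qed
  then show ?thesis using c0 by (simp add: real_le_rsqrt flip: real_sqrt_mult)
qed

section \<open>Forms in independent standardized variables\<close>

locale indep_standardized = prob_space M for M :: "'a measure" +
  fixes X :: "nat \<Rightarrow> 'a \<Rightarrow> real" and I :: "nat set"
  assumes indep: "indep_vars (\<lambda>_. borel) X I"
    and fourth: "\<And>v. v \<in> I \<Longrightarrow> integrable M (\<lambda>w. X v w ^ 4)"
    and mean: "\<And>v. v \<in> I \<Longrightarrow> expectation (X v) = 0"
    and unit_variance: "\<And>v. v \<in> I \<Longrightarrow> expectation (\<lambda>w. (X v w)\<^sup>2) = 1"
begin

lemma X_measurable: "v \<in> I \<Longrightarrow> X v \<in> borel_measurable M"
  using indep by (auto simp: indep_vars_def)

lemma X_power_integrable: "v \<in> I \<Longrightarrow> k \<le> 4 \<Longrightarrow> integrable M (\<lambda>w. X v w ^ k)"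
  by (rule integrable_power_fourth[OF X_measurable fourth])

lemma X_integrable: "v \<in> I \<Longrightarrow> integrable M (X v)"
  using X_power_integrable[of v 1] by simp

lemma X_square_integrable: "v \<in> I \<Longrightarrow> square_integrable M (X v)"
  by (simp add: square_integrable_def X_measurable X_power_integrable)

text \<open>Functions of the coordinates in \<open>J\<close> are represented by functionals \<open>H\<close> of the whole
  sequence that do not change under restriction to \<open>J\<close>.\<close>

lemma indep_split:
  assumes k: "k \<in> I" "k \<notin> J" and J: "J \<subseteq> I"
    and f[measurable]: "f \<in> borel_measurable borel"
    and H[measurable]: "H \<in> borel_measurable (PiM J (\<lambda>_. borel))"
    and dep: "\<And>p. H (restrict p J) = H p"
    and fi: "integrable M (\<lambda>w. f (X k w))" and Hi: "integrable M (\<lambda>w. H (\<lambda>v. X v w))"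
  shows indep_split_integrable: "integrable M (\<lambda>w. f (X k w) * H (\<lambda>v. X v w) :: real)"
    and indep_split_expectation: "expectation (\<lambda>w. f (X k w) * H (\<lambda>v. X v w)) =
      expectation (\<lambda>w. f (X k w)) * expectation (\<lambda>w. H (\<lambda>v. X v w))"
proof -
  have "indep_var (PiM {k} (\<lambda>_. borel)) (\<lambda>w. restrict (\<lambda>i. X i w) {k}) (PiM J (\<lambda>_. borel)) (\<lambda>w. restrict (\<lambda>i. X i w) J)"
    using k J by (intro indep_var_restrict[OF indep]) auto
  then have "indep_var borel ((\<lambda>p. f (p k)) \<circ> (\<lambda>w. restrict (\<lambda>i. X i w) {k})) borel (H \<circ> (\<lambda>w. restrict (\<lambda>i. X i w) J))"
    by (rule indep_var_compose) measurable
  then have iv: "indep_var borel (\<lambda>w. f (X k w)) borel (\<lambda>w. H (\<lambda>v. X v w))"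
    by (simp add: comp_def dep)
  show "integrable M (\<lambda>w. f (X k w) * H (\<lambda>v. X v w) :: real)"
    by (rule indep_var_integrable[OF iv fi Hi])
  show "expectation (\<lambda>w. f (X k w) * H (\<lambda>v. X v w)) =
      expectation (\<lambda>w. f (X k w)) * expectation (\<lambda>w. H (\<lambda>v. X v w))"
    by (rule indep_var_lebesgue_integral[OF iv fi Hi])
qed

lemma linear_form_measurable:
  "J \<subseteq> I \<Longrightarrow> (\<lambda>w. \<Sum>v\<in>J. c v * X v w) \<in> borel_measurable M"
  by (intro borel_measurable_sum borel_measurable_times borel_measurable_const X_measurable) auto

lemma linear_form_fourth_integrable:
  assumes "finite J" "J \<subseteq> I"
  shows "integrable M (\<lambda>w. (\<Sum>v\<in>J. c v * X v w) ^ 4)"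
  using assms
proof (induction J)
  case (insert k J)
  have *: "(a + b) ^ 4 \<le> 8 * (a ^ 4 + b ^ 4)" for a b :: real
  proof -
    have "(a + b) ^ 4 = ((a + b)\<^sup>2)\<^sup>2" by simp
    also have "\<dots> \<le> (2 * (a\<^sup>2 + b\<^sup>2))\<^sup>2"
    proof (rule power_mono)
      show "(a + b)\<^sup>2 \<le> 2 * (a\<^sup>2 + b\<^sup>2)"
        using zero_le_power2[of "a - b"] by (simp add: power2_eq_square algebra_simps)
    qed simp
    also have "\<dots> \<le> 8 * (a ^ 4 + b ^ 4)"
      using zero_le_power2[of "a\<^sup>2 - b\<^sup>2"] by (simp add: power2_eq_square power4_eq_xxxx algebra_simps)
    finally show ?thesis .
  qed
  have "integrable M (\<lambda>w. (c k * X k w + (\<Sum>v\<in>J. c v * X v w)) ^ 4)"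
  proof (rule Bochner_Integration.integrable_bound)
    show "integrable M (\<lambda>w. 8 * (c k ^ 4 * X k w ^ 4 + (\<Sum>v\<in>J. c v * X v w) ^ 4))"
      using insert fourth by auto
    show "(\<lambda>w. (c k * X k w + (\<Sum>v\<in>J. c v * X v w)) ^ 4) \<in> borel_measurable M"
      using insert.prems X_measurable[of k] linear_form_measurable[of J] by auto
    show "AE x in M. norm ((c k * X k x + (\<Sum>v\<in>J. c v * X v x)) ^ 4)
         \<le> norm (8 * (c k ^ 4 * X k x ^ 4 + (\<Sum>v\<in>J. c v * X v x) ^ 4))"
      using *[of "c k * X k _"] by (simp add: power_mult_distrib)
  qed
  then show ?case using insert by simp
qed simp

lemma linear_form_square_integrable:
  "J \<subseteq> I \<Longrightarrow> square_integrable M (\<lambda>w. \<Sum>v\<in>J. c v * X v w)"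
  by (intro square_integrable_sum square_integrable_cmult X_square_integrable) auto

lemma linear_form_functional_measurable:
  "(\<lambda>p. \<Sum>v\<in>J. c v * p v) \<in> borel_measurable (PiM J (\<lambda>_. borel :: real measure))"
  by (intro borel_measurable_sum borel_measurable_times borel_measurable_const measurable_component_singleton)

lemma linear_form_expectation:
  "J \<subseteq> I \<Longrightarrow> expectation (\<lambda>w. \<Sum>v\<in>J. c v * X v w) = 0"
  by (subst Bochner_Integration.integral_sum) (auto simp: X_integrable mean subset_iff)

lemma linear_form_second_moment:
  assumes "finite J" "J \<subseteq> I"
  shows "expectation (\<lambda>w. (\<Sum>v\<in>J. c v * X v w)\<^sup>2) = (\<Sum>v\<in>J. (c v)\<^sup>2)"
  using assms
proof (induction J)
  case (insert k J)
  define S where "S p = (\<Sum>v\<in>J. c v * p v)" for p :: "nat \<Rightarrow> real"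
  have k: "k \<in> I" "k \<notin> J" and J: "J \<subseteq> I" using insert by auto
  have S_dep: "S (restrict p J) = S p" for p by (simp add: S_def)
  have S_meas: "S \<in> borel_measurable (PiM J (\<lambda>_. borel))"
    unfolding S_def by (rule linear_form_functional_measurable)
  have sq: "square_integrable M (\<lambda>w. S (\<lambda>v. X v w))"
    unfolding S_def by (rule linear_form_square_integrable[OF J])
  note sp = indep_split[OF k J, of "\<lambda>x. x" S, OF _ S_meas S_dep, simplified,
     OF X_integrable[OF k(1)] square_integrable_imp_integrable[OF sq]]
  have "expectation (\<lambda>w. (\<Sum>v\<in>insert k J. c v * X v w)\<^sup>2)
     = expectation (\<lambda>w. (c k)\<^sup>2 * (X k w)\<^sup>2 + 2 * c k * (X k w * S (\<lambda>v. X v w)) + (S (\<lambda>v. X v w))\<^sup>2)"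
    using insert.hyps by (simp add: S_def power2_eq_square algebra_simps)
  also have "\<dots> = (c k)\<^sup>2 + (\<Sum>v\<in>J. (c v)\<^sup>2)"
    using sp sq X_power_integrable[OF k(1), of 2] insert.IH[OF J]
    by (simp add: square_integrable_def unit_variance mean k S_def)
  finally show ?case using insert.hyps by simp
qed simp

text \<open>When a variable is added, the binomial terms with exactly one factor \<open>X k\<close>
  or exactly one factor of the old sum have mean zero. The remaining mixed term
  \<open>6 * (c k)\<^sup>2 * ?s\<close> is absorbed by the mixed term of
  \<open>3 * m * ((c k)\<^sup>2 + ?s)\<^sup>2\<close>, and this is where \<open>1 \<le> m\<close>
  enters.\<close>

lemma linear_form_fourth_moment:
  assumes "finite J" "J \<subseteq> I" and m: "1 \<le> m" "\<And>v. v \<in> J \<Longrightarrow> expectation (\<lambda>w. X v w ^ 4) \<le> m"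
  shows "expectation (\<lambda>w. (\<Sum>v\<in>J. c v * X v w) ^ 4) \<le> 3 * m * (\<Sum>v\<in>J. (c v)\<^sup>2)\<^sup>2"
  using assms(1,2) m(2)
proof (induction J)
  case empty
  show ?case by simp
next
  case (insert k J)
  define S where "S p = (\<Sum>v\<in>J. c v * p v)" for p :: "nat \<Rightarrow> real"
  let ?S = "\<lambda>w. S (\<lambda>v. X v w)" and ?s = "\<Sum>v\<in>J. (c v)\<^sup>2"
  have k: "k \<in> I" "k \<notin> J" and J: "J \<subseteq> I" using insert by auto
  have S_dep: "S (restrict p J) = S p" for p by (simp add: S_def)
  have S_meas[measurable]: "S \<in> borel_measurable (PiM J (\<lambda>_. borel))"
    unfolding S_def by (rule linear_form_functional_measurable)
  have Sm: "?S \<in> borel_measurable M" unfolding S_def by (rule linear_form_measurable[OF J])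
  have S4: "integrable M (\<lambda>w. ?S w ^ 4)"
    unfolding S_def by (rule linear_form_fourth_integrable[OF insert.hyps(1) J])
  have E: "expectation (\<lambda>w. X k w ^ i * ?S w ^ j) = expectation (\<lambda>w. X k w ^ i) * expectation (\<lambda>w. ?S w ^ j)"
    and Ei: "integrable M (\<lambda>w. X k w ^ i * ?S w ^ j)" if "i \<le> 4" "j \<le> 4" for i j
    using indep_split[OF k J, of "\<lambda>x. x ^ i" "\<lambda>p. S p ^ j"] S_dep that
      X_power_integrable[OF k(1)] integrable_power_fourth[OF Sm S4] by auto
  \<comment> \<open>The zeroth and first powers are written out so that all five binomial terms are
    instances of \<open>E\<close> and \<open>Ei\<close>.\<close>
  have "expectation (\<lambda>w. (\<Sum>v\<in>insert k J. c v * X v w) ^ 4)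
     = expectation (\<lambda>w. c k ^ 4 * (X k w ^ 4 * ?S w ^ 0) + 4 * c k ^ 3 * (X k w ^ 3 * ?S w ^ 1)
         + 6 * (c k)\<^sup>2 * (X k w ^ 2 * ?S w ^ 2) + 4 * c k * (X k w ^ 1 * ?S w ^ 3) + X k w ^ 0 * ?S w ^ 4)"
    using insert.hyps by (simp add: S_def power2_eq_square power3_eq_cube power4_eq_xxxx algebra_simps)
  also have "\<dots> = c k ^ 4 * expectation (\<lambda>w. X k w ^ 4) + 6 * (c k)\<^sup>2 * ?s + expectation (\<lambda>w. ?S w ^ 4)"
    using Ei[of 4 0] Ei[of 3 1] Ei[of 2 2] Ei[of 1 3] Ei[of 0 4] E[of 4 0] E[of 3 1] E[of 2 2] E[of 1 3] E[of 0 4]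
      linear_form_expectation[OF J, of c] linear_form_second_moment[OF insert.hyps(1) J, of c]
      mean[OF k(1)] unit_variance[OF k(1)]
    by (simp add: S_def prob_space)
  also have "\<dots> \<le> c k ^ 4 * m + 6 * (c k)\<^sup>2 * ?s + 3 * m * ?s\<^sup>2"
  proof -
    have "c k ^ 4 * expectation (\<lambda>w. X k w ^ 4) \<le> c k ^ 4 * m"
      using insert.prems(2)[of k] by (intro mult_left_mono) auto
    moreover have "expectation (\<lambda>w. ?S w ^ 4) \<le> 3 * m * ?s\<^sup>2"
      unfolding S_def using insert.IH[OF J] insert.prems(2) by blast
    ultimately show ?thesis by linarith
  qed
  also have "\<dots> \<le> 3 * m * ((c k)\<^sup>2 + ?s)\<^sup>2"
  proof -
    have s0: "?s \<ge> 0" by (intro sum_nonneg) auto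
    have "(c k)\<^sup>2 * ?s \<le> m * ((c k)\<^sup>2 * ?s)" using mult_right_mono[OF m(1), of "(c k)\<^sup>2 * ?s"] s0 by simp
    moreover have "c k ^ 4 * m \<ge> 0" using m by simp
    moreover have "3 * m * ((c k)\<^sup>2 + ?s)\<^sup>2 = 3 * (c k ^ 4 * m) + 6 * (m * ((c k)\<^sup>2 * ?s)) + 3 * m * ?s\<^sup>2"
      by (simp add: power2_eq_square power4_eq_xxxx algebra_simps)
    ultimately show ?thesis by linarith
  qed
  finally show ?case by (simp only: sum.insert[OF insert.hyps])
qed

lemma product_square_integrable:
  "u \<in> I \<Longrightarrow> v \<in> I \<Longrightarrow> square_integrable M (\<lambda>w. X u w * X v w)"
  by (rule square_integrable_mult) (simp_all add: X_measurable fourth)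

lemma quadratic_form_square_integrable:
  assumes "J \<subseteq> I"
  shows "square_integrable M (\<lambda>w. \<Sum>u\<in>J. \<Sum>v\<in>J. B u v * (X u w * X v w))"
  by (rule square_integrable_sum, rule square_integrable_sum, rule square_integrable_cmult)
    (use assms in \<open>auto intro: product_square_integrable\<close>)

text \<open>A new index \<open>k\<close> adds \<open>X k * L\<close> and
  \<open>B k k * ((X k)\<^sup>2 - 1)\<close> to the centered form, and the three pieces are
  orthogonal. The first new piece costs a factor 2, from the square of \<open>B k v + B v k\<close>,
  the second the variance of \<open>(X k)\<^sup>2\<close>. \<open>K\<close> has to dominate both,
  which explains the maximum with 2 in the theorem.\<close>

lemma quadratic_form_variance:
  fixes B :: "nat \<Rightarrow> nat \<Rightarrow> real"
  assumes "finite J" "J \<subseteq> I" and K: "2 \<le> K" "\<And>v. v \<in> J \<Longrightarrow> expectation (\<lambda>w. X v w ^ 4) - 1 \<le> K"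
  defines "Q \<equiv> \<lambda>J p. (\<Sum>u\<in>J. \<Sum>v\<in>J. B u v * (p u * p v)) - (\<Sum>u\<in>J. B u u)"
  shows "expectation (\<lambda>w. Q J (\<lambda>v. X v w)) = 0 \<and>
    expectation (\<lambda>w. (Q J (\<lambda>v. X v w))\<^sup>2) \<le> K * (\<Sum>u\<in>J. \<Sum>v\<in>J. (B u v)\<^sup>2)"
  using assms(1,2) K(2)
proof (induction J)
  case empty
  show ?case by (simp add: Q_def)
next
  case (insert k J)
  define L where "L p = (\<Sum>v\<in>J. (B k v + B v k) * p v)" for p :: "nat \<Rightarrow> real"
  let ?L = "\<lambda>w. L (\<lambda>v. X v w)" and ?Q = "\<lambda>w. Q J (\<lambda>v. X v w)" and ?X = "X k" and ?b = "B k k"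
  have k: "k \<in> I" "k \<notin> J" and J: "J \<subseteq> I" and fin: "finite J" using insert by auto
  have L_dep: "L (restrict p J) = L p" and Q_dep: "Q J (restrict p J) = Q J p" for p
    by (simp_all add: L_def Q_def)
  have L_meas[measurable]: "L \<in> borel_measurable (PiM J (\<lambda>_. borel))"
    unfolding L_def by (rule linear_form_functional_measurable)
  have Q_meas[measurable]: "Q J \<in> borel_measurable (PiM J (\<lambda>_. borel))"
    unfolding Q_def
    by (intro borel_measurable_diff borel_measurable_sum borel_measurable_times borel_measurable_const measurable_component_singleton)
  have Lsq: "square_integrable M ?L" unfolding L_def by (rule linear_form_square_integrable[OF J])
  have Qsq: "square_integrable M ?Q"
    using square_integrable_add[OF quadratic_form_square_integrable[OF J, of B] square_integrable_const[of "- (\<Sum>u\<in>J. B u u)"]]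
    by (simp add: Q_def)
  note Li = square_integrable_imp_integrable[OF Lsq] and Qi = square_integrable_imp_integrable[OF Qsq]
  have L2i: "integrable M (\<lambda>w. (?L w)\<^sup>2)" and Q2i: "integrable M (\<lambda>w. (?Q w)\<^sup>2)"
    using Lsq Qsq by (auto simp: square_integrable_def)
  have QLi: "integrable M (\<lambda>w. ?Q w * ?L w)" by (rule square_integrable_mult_integrable[OF Qsq Lsq])
  note Xi = X_power_integrable[OF k(1)]
  have X1: "integrable M ?X" using Xi[of 1] by simp
  have x2: "integrable M (\<lambda>w. ?X w ^ 2 - 1)" "expectation (\<lambda>w. ?X w ^ 2 - 1) = 0"
    using Xi[of 2] unit_variance[OF k(1)] by (auto simp: prob_space)
  have x3: "integrable M (\<lambda>w. ?X w ^ 3 - ?X w)" using Xi[of 3] X1 by auto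
  note s1 = indep_split[OF k J, of "\<lambda>x. x\<^sup>2" "\<lambda>p. (L p)\<^sup>2", OF _ _ _ _ L2i]
  note s2 = indep_split[OF k J, of "\<lambda>x. x" "\<lambda>p. Q J p * L p", OF _ _ _ _ QLi]
  note s3 = indep_split[OF k J, of "\<lambda>x. x\<^sup>2 - 1" "Q J", OF _ _ _ _ Qi]
  note s4 = indep_split[OF k J, of "\<lambda>x. x^3 - x" L, OF _ _ _ _ Li]
  note s5 = indep_split[OF k J, of "\<lambda>x. x" L, OF _ _ _ _ Li]
  have e1: "integrable M (\<lambda>w. (?X w)\<^sup>2 * (?L w)\<^sup>2)"
       "expectation (\<lambda>w. (?X w)\<^sup>2 * (?L w)\<^sup>2) = expectation (\<lambda>w. (?L w)\<^sup>2)"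
    using s1 Xi[of 2] unit_variance[OF k(1)] by (auto simp: L_dep)
  have e2: "integrable M (\<lambda>w. ?X w * (?Q w * ?L w))" "expectation (\<lambda>w. ?X w * (?Q w * ?L w)) = 0"
    using s2 X1 mean[OF k(1)] by (auto simp: L_dep Q_dep)
  have e3: "integrable M (\<lambda>w. (?X w ^ 2 - 1) * ?Q w)" "expectation (\<lambda>w. (?X w ^ 2 - 1) * ?Q w) = 0"
    using s3 x2 by (auto simp: Q_dep)
  \<comment> \<open>The third moment of \<open>X k\<close> need not vanish; the cross term
    containing it disappears because \<open>L\<close> has mean zero.\<close>
  have "expectation ?L = 0" unfolding L_def by (rule linear_form_expectation[OF J])
  then have e4: "integrable M (\<lambda>w. (?X w ^ 3 - ?X w) * ?L w)" "expectation (\<lambda>w. (?X w ^ 3 - ?X w) * ?L w) = 0"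
    and e5: "integrable M (\<lambda>w. ?X w * ?L w)" "expectation (\<lambda>w. ?X w * ?L w) = 0"
    using s4 s5 x3 X1 by (auto simp: L_dep)
  have x4: "integrable M (\<lambda>w. (?X w ^ 2 - 1)\<^sup>2)"
     "expectation (\<lambda>w. (?X w ^ 2 - 1)\<^sup>2) = expectation (\<lambda>w. ?X w ^ 4) - 1"
  proof -
    have eq: "(\<lambda>w. (?X w ^ 2 - 1)\<^sup>2) = (\<lambda>w. ?X w ^ 4 - 2 * ?X w ^ 2 + 1)"
      by (auto simp: fun_eq_iff power2_eq_square power4_eq_xxxx algebra_simps)
    show "integrable M (\<lambda>w. (?X w ^ 2 - 1)\<^sup>2)" unfolding eq using Xi[of 2] Xi[of 4] by auto
    show "expectation (\<lambda>w. (?X w ^ 2 - 1)\<^sup>2) = expectation (\<lambda>w. ?X w ^ 4) - 1"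
      unfolding eq using Xi[of 2] Xi[of 4] unit_variance[OF k(1)] by (simp add: prob_space)
  qed
  have Qins: "Q (insert k J) p = Q J p + p k * L p + ?b * (p k ^ 2 - 1)" for p
    using k(2) fin unfolding Q_def L_def
    by (simp add: sum.distrib sum_distrib_left power2_eq_square ring_distribs mult_ac)
  have mean0: "expectation (\<lambda>w. Q (insert k J) (\<lambda>v. X v w)) = 0"
    unfolding Qins using Qi e5 x2 insert.IH[OF J] insert.prems(2) by simp
  have "expectation (\<lambda>w. (Q (insert k J) (\<lambda>v. X v w))\<^sup>2)
      = expectation (\<lambda>w. (?Q w)\<^sup>2 + (?X w)\<^sup>2 * (?L w)\<^sup>2 + ?b\<^sup>2 * (?X w ^ 2 - 1)\<^sup>2
         + 2 * (?X w * (?Q w * ?L w)) + 2 * ?b * ((?X w ^ 2 - 1) * ?Q w)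
         + 2 * ?b * ((?X w ^ 3 - ?X w) * ?L w))"
    unfolding Qins by (intro arg_cong[where f=expectation] ext)
       (simp add: power2_eq_square power3_eq_cube algebra_simps)
  also have "\<dots> = expectation (\<lambda>w. (?Q w)\<^sup>2) + expectation (\<lambda>w. (?L w)\<^sup>2)
      + ?b\<^sup>2 * (expectation (\<lambda>w. ?X w ^ 4) - 1)"
    using Q2i e1 e2 e3 e4 x4 by simp
  also have "\<dots> \<le> K * (\<Sum>u\<in>J. \<Sum>v\<in>J. (B u v)\<^sup>2) + K * (\<Sum>v\<in>J. (B k v)\<^sup>2 + (B v k)\<^sup>2) + K * ?b\<^sup>2"
  proof -
    have "expectation (\<lambda>w. (?L w)\<^sup>2) = (\<Sum>v\<in>J. (B k v + B v k)\<^sup>2)"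
      unfolding L_def by (rule linear_form_second_moment[OF fin J])
    also have "\<dots> \<le> (\<Sum>v\<in>J. 2 * ((B k v)\<^sup>2 + (B v k)\<^sup>2))"
    proof (rule sum_mono)
      fix v show "(B k v + B v k)\<^sup>2 \<le> 2 * ((B k v)\<^sup>2 + (B v k)\<^sup>2)"
        using zero_le_power2[of "B k v - B v k"] by (simp add: power2_eq_square algebra_simps)
    qed
    also have "\<dots> \<le> K * (\<Sum>v\<in>J. (B k v)\<^sup>2 + (B v k)\<^sup>2)"
      unfolding sum_distrib_left[symmetric] using K(1) by (intro mult_right_mono sum_nonneg) auto
    finally have "expectation (\<lambda>w. (?L w)\<^sup>2) \<le> K * (\<Sum>v\<in>J. (B k v)\<^sup>2 + (B v k)\<^sup>2)" .
    moreover have "?b\<^sup>2 * (expectation (\<lambda>w. ?X w ^ 4) - 1) \<le> K * ?b\<^sup>2"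
      using mult_left_mono[OF insert.prems(2)[of k], of "?b\<^sup>2"] by (simp add: mult.commute)
    moreover have "expectation (\<lambda>w. (?Q w)\<^sup>2) \<le> K * (\<Sum>u\<in>J. \<Sum>v\<in>J. (B u v)\<^sup>2)"
      using insert.IH[OF J] insert.prems(2) by blast
    ultimately show ?thesis by linarith
  qed
  also have "\<dots> = K * (\<Sum>u\<in>insert k J. \<Sum>v\<in>insert k J. (B u v)\<^sup>2)"
    using k(2) fin by (simp add: sum.distrib algebra_simps)
  finally show ?case by (rule conjI[OF mean0])
qed

end

section \<open>Multivariate uniqueness of characteristic functions\<close>

lemma trig_integrable:
  fixes f :: "'a \<Rightarrow> real"
  assumes "finite_measure M" and [measurable]: "f \<in> borel_measurable M"
  shows "integrable M (\<lambda>x. cos (f x))" "integrable M (\<lambda>x. sin (f x))"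
  using assms by (auto intro!: finite_measure.integrable_const_bound[where B=1])

lemma char_eq_cos_sin:
  assumes "real_distribution P"
  shows "char P s = Complex (\<integral>x. cos (s * x) \<partial>P) (\<integral>x. sin (s * x) \<partial>P)"
proof -
  interpret real_distribution P by fact
  have i: "integrable P (\<lambda>x. iexp (s * x))"
    by (intro integrable_const_bound[where B=1]) (auto simp del: of_real_mult)
  have "Re (char P s) = (\<integral>x. Re (iexp (s * x)) \<partial>P)" "Im (char P s) = (\<integral>x. Im (iexp (s * x)) \<partial>P)"
    unfolding char_def using i by (simp_all only: integral_Re integral_Im)
  then show ?thesis by (simp add: complex_eq_iff Re_exp Im_exp)
qed

text \<open>Levy's uniqueness theorem concerns probability measures on the line, so the measure with
  density \<open>w\<close> is normalized by its mass \<open>c\<close> and projected to coordinate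
  \<open>i\<close>; the hypotheses say that the two resulting characteristic functions agree. For
  \<open>c = 0\<close> there is nothing to normalize, but \<open>w \<ge> 0\<close> makes both
  integrals vanish.\<close>

lemma weighted_coordinate_uniqueness:
  fixes M N :: "(real^'d::finite) measure" and w :: "real^'d \<Rightarrow> real"
  assumes M: "finite_measure M" "sets M = sets borel" and N: "finite_measure N" "sets N = sets borel"
    and w[measurable]: "w \<in> borel_measurable borel" and wb: "\<And>x. 0 \<le> w x" "\<And>x. w x \<le> B"
    and c: "\<And>s. (\<integral>x. w x * cos (s * x $ i) \<partial>M) = (\<integral>x. w x * cos (s * x $ i) \<partial>N)"
    and s: "\<And>s. (\<integral>x. w x * sin (s * x $ i) \<partial>M) = (\<integral>x. w x * sin (s * x $ i) \<partial>N)"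
  shows "(\<integral>x. w x * indicator {x. x $ i \<le> a} x \<partial>M) = (\<integral>x. w x * indicator {x. x $ i \<le> a} x \<partial>N)"
proof -
  define c where "c = (\<integral>x. w x \<partial>M)"
  \<comment> \<open>At frequency 0 the cosine hypothesis compares the masses of the two weighted
    measures.\<close>
  have cN: "c = (\<integral>x. w x \<partial>N)" using c[of 0] by (simp add: c_def)
  let ?d = "\<lambda>L. density L (\<lambda>x. ennreal (w x / c))" and ?D = "\<lambda>L. distr (density L (\<lambda>x. ennreal (w x / c))) borel (\<lambda>x. x $ i)"
  have key: "integrable L w" "c = 0 \<Longrightarrow> (\<integral>x. w x * indicator {x. x $ i \<le> a} x \<partial>L) = 0"
    "c \<noteq> 0 \<Longrightarrow> real_distribution (?D L)"
    "f \<in> borel_measurable borel \<Longrightarrow> c \<noteq> 0 \<Longrightarrow>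
       (\<integral>x. f x \<partial>?D L) = (\<integral>x. w x * f (x $ i) \<partial>L) / c"
    if L: "finite_measure L" and sL: "sets L = sets borel" and cL: "c = (\<integral>x. w x \<partial>L)"
    for L and f :: "real \<Rightarrow> real"
  proof -
    have [measurable_cong]: "sets L = sets borel" by (rule sL)
    have [measurable]: "w \<in> borel_measurable L" by simp
    show wi: "integrable L w"
      by (rule finite_measure.integrable_const_bound[OF L, where B=B]) (use wb in auto)
    have c0: "c \<ge> 0" unfolding cL using wb by (intro Bochner_Integration.integral_nonneg)
    show "(\<integral>x. w x * indicator {x. x $ i \<le> a} x \<partial>L) = 0" if "c = 0"
    proof -
      have "(\<integral>x. w x * indicator {x. x $ i \<le> a} x \<partial>L) \<le> (\<integral>x. w x \<partial>L)"
        by (rule integral_mono') (use wi wb in \<open>auto simp: indicator_def\<close>)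
      moreover have "(\<integral>x. w x * indicator {x. x $ i \<le> a} x \<partial>L) \<ge> 0"
        using wb by (intro Bochner_Integration.integral_nonneg) auto
      ultimately show ?thesis using that cL by simp
    qed
    assume c1: "c \<noteq> 0"
    have ew: "ennreal (w x / c) = ennreal (w x) * ennreal (1 / c)" for x
      using c0 wb by (simp add: ennreal_mult[symmetric])
    have "emeasure (?d L) (space (?d L)) = (\<integral>\<^sup>+x. ennreal (w x / c) \<partial>L)"
      by (subst emeasure_density) (auto intro!: nn_integral_cong simp: indicator_def)
    also have "\<dots> = ennreal (\<integral>x. w x / c \<partial>L)"
      by (rule nn_integral_eq_integral) (use wi c0 wb in auto)
    also have "\<dots> = 1" using c1 cL by simp
    finally have P: "prob_space (?d L)" by (rule prob_spaceI)
    have "prob_space (?D L)"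
      by (rule prob_space.prob_space_distr[OF P]) simp
    then show "real_distribution (?D L)"
      by (simp add: real_distribution_def real_distribution_axioms_def)
    assume [measurable]: "f \<in> borel_measurable borel"
    have "(\<integral>x. f x \<partial>?D L)
       = (\<integral>x. f (x $ i) \<partial>?d L)"
      by (rule integral_distr) auto
    also have "\<dots> = (\<integral>x. (w x / c) *\<^sub>R f (x $ i) \<partial>L)"
      by (rule integral_density) (use wb c0 in auto)
    finally show "(\<integral>x. f x \<partial>?D L) = (\<integral>x. w x * f (x $ i) \<partial>L) / c"
      by simp
  qed
  show ?thesis
  proof (cases "c = 0")
    case True then show ?thesis using key(2)[OF M c_def] key(2)[OF N cN] by simp
  next
    case False
    note kM = key(3)[OF M c_def False] key(4)[OF M c_def _ False]
    note kN = key(3)[OF N cN False] key(4)[OF N cN _ False]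
    have "char (?D M) = char (?D N)"
    proof
      fix r show "char (?D M) r = char (?D N) r"
        using kM(2)[of "\<lambda>x. cos (r * x)"] kN(2)[of "\<lambda>x. cos (r * x)"]
          kM(2)[of "\<lambda>x. sin (r * x)"] kN(2)[of "\<lambda>x. sin (r * x)"] c[of r] s[of r]
        by (simp add: char_eq_cos_sin kM(1) kN(1))
    qed
    then have "?D M = ?D N" by (rule Levy_uniqueness[OF kM(1) kN(1)])
    then have "(\<integral>x. w x * indicator {..a} (x $ i) \<partial>M) = (\<integral>x. w x * indicator {..a} (x $ i) \<partial>N)"
      using kM(2)[of "indicator {..a}"] kN(2)[of "indicator {..a}"] False by simp
    moreover have "indicator {..a} (x $ i) = (indicator {x. x $ i \<le> a} x :: real)" for x :: "real^'d"
      by (auto simp: indicator_def)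
    ultimately show ?thesis by simp
  qed
qed

text \<open>Restricting both measures to a half-space preserves equality of the characteristic functions:
  apply one-dimensional uniqueness to the positive weights 1, 1 + cos and 1 + sin.\<close>

lemma trig_integrals_restrict:
  fixes M N :: "(real^'d::finite) measure" and a :: "'d \<Rightarrow> real"
  assumes M: "finite_measure M" "sets M = sets borel" and N: "finite_measure N" "sets N = sets borel"
    and c: "\<And>t. (\<integral>x. cos (t \<bullet> x) \<partial>M) = (\<integral>x. cos (t \<bullet> x) \<partial>N)"
    and s: "\<And>t. (\<integral>x. sin (t \<bullet> x) \<partial>M) = (\<integral>x. sin (t \<bullet> x) \<partial>N)"
    and "finite S"
  shows "(\<integral>x. indicator {x. \<forall>i\<in>S. x $ i \<le> a i} x * cos (t \<bullet> x) \<partial>M) = (\<integral>x. indicator {x. \<forall>i\<in>S. x $ i \<le> a i} x * cos (t \<bullet> x) \<partial>N) \<and>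
     (\<integral>x. indicator {x. \<forall>i\<in>S. x $ i \<le> a i} x * sin (t \<bullet> x) \<partial>M) = (\<integral>x. indicator {x. \<forall>i\<in>S. x $ i \<le> a i} x * sin (t \<bullet> x) \<partial>N)"
  using \<open>finite S\<close>
proof (induction S arbitrary: t)
  case empty
  then show ?case using c s by simp
next
  case (insert k S)
  let ?A = "{x :: real^'d. \<forall>i\<in>S. x $ i \<le> a i}"
  have [measurable]: "?A \<in> sets borel"
    using \<open>finite S\<close> by measurable
  have int: "integrable L (\<lambda>x. indicator ?A x * cos (f x))" "integrable L (\<lambda>x. indicator ?A x * sin (f x))"
    if L: "finite_measure L" and sL: "sets L = sets borel" and f: "f \<in> borel_measurable borel"
    for L and f :: "real^'d \<Rightarrow> real"
  proof -
    have [measurable_cong]: "sets L = sets borel" by (rule sL)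
    note [measurable] = f
    show "integrable L (\<lambda>x. indicator ?A x * cos (f x))"
      by (rule finite_measure.integrable_const_bound[OF L, where B=1]) (simp_all add: indicator_def, measurable)
    show "integrable L (\<lambda>x. indicator ?A x * sin (f x))"
      by (rule finite_measure.integrable_const_bound[OF L, where B=1]) (simp_all add: indicator_def, measurable)
  qed
  let ?eq = "\<lambda>h :: real^'d \<Rightarrow> real. (\<integral>x. h x \<partial>M) = (\<integral>x. h x \<partial>N)"
  have IHc: "?eq (\<lambda>x. indicator ?A x * cos (u \<bullet> x))"
    and IHs: "?eq (\<lambda>x. indicator ?A x * sin (u \<bullet> x))" for u
    using insert.IH by blast+
  have ax: "(t + r *\<^sub>R axis k 1) \<bullet> x = t \<bullet> x + r * x $ k" "(r *\<^sub>R axis k 1) \<bullet> x = r * x $ k"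
    for t x :: "real^'d" and r
    by (simp_all add: inner_add_left inner_axis')
  \<comment> \<open>Product-to-sum formulas trade a trigonometric factor in coordinate
    \<open>k\<close> for a shift of the frequency \<open>t\<close> by plus or minus
    \<open>r *\<^sub>R axis k 1\<close>. This is why the induction hypothesis must cover every
    frequency.\<close>
  have prods: "indicator ?A x * cos (t \<bullet> x) * cos (r * x $ k) =
        (indicator ?A x * cos ((t + r *\<^sub>R axis k 1) \<bullet> x) + indicator ?A x * cos ((t + (-r) *\<^sub>R axis k 1) \<bullet> x)) / 2"
     "indicator ?A x * cos (t \<bullet> x) * sin (r * x $ k) =
        (indicator ?A x * sin ((t + r *\<^sub>R axis k 1) \<bullet> x) - indicator ?A x * sin ((t + (-r) *\<^sub>R axis k 1) \<bullet> x)) / 2"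
     "indicator ?A x * sin (t \<bullet> x) * cos (r * x $ k) =
        (indicator ?A x * sin ((t + r *\<^sub>R axis k 1) \<bullet> x) + indicator ?A x * sin ((t + (-r) *\<^sub>R axis k 1) \<bullet> x)) / 2"
     "indicator ?A x * sin (t \<bullet> x) * sin (r * x $ k) =
        (indicator ?A x * cos ((t + (-r) *\<^sub>R axis k 1) \<bullet> x) - indicator ?A x * cos ((t + r *\<^sub>R axis k 1) \<bullet> x)) / 2"
     for x r
    unfolding ax by (simp_all add: cos_add sin_add cos_diff sin_diff algebra_simps)
  note intM = int[OF M] and intN = int[OF N]
  have cc: "?eq (\<lambda>x. indicator ?A x * cos (t \<bullet> x) * cos (r * x $ k))"
       "?eq (\<lambda>x. indicator ?A x * cos (t \<bullet> x) * sin (r * x $ k))"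
       "?eq (\<lambda>x. indicator ?A x * sin (t \<bullet> x) * cos (r * x $ k))"
       "?eq (\<lambda>x. indicator ?A x * sin (t \<bullet> x) * sin (r * x $ k))" for r
    unfolding prods by (simp_all add: intM intN IHc IHs)
  have ip: "integrable L (\<lambda>x. indicator ?A x * cos (t \<bullet> x) * cos (r * x $ k))"
       "integrable L (\<lambda>x. indicator ?A x * cos (t \<bullet> x) * sin (r * x $ k))"
       "integrable L (\<lambda>x. indicator ?A x * sin (t \<bullet> x) * cos (r * x $ k))"
       "integrable L (\<lambda>x. indicator ?A x * sin (t \<bullet> x) * sin (r * x $ k))"
    if "finite_measure L" "sets L = sets borel" for r L
    unfolding prods by (simp_all add: int[OF that])
  note ipM = ip[OF M] and ipN = ip[OF N]
  have c0: "?eq (\<lambda>x. indicator ?A x * cos (r * x $ k))"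
     "?eq (\<lambda>x. indicator ?A x * sin (r * x $ k))" for r
    using IHc[of "r *\<^sub>R axis k 1"] IHs[of "r *\<^sub>R axis k 1"] unfolding ax by simp_all
  let ?B = "{x :: real^'d. x $ k \<le> a k}"
  have AB: "indicator {x. \<forall>i\<in>insert k S. x $ i \<le> a i} x = (indicator ?A x * indicator ?B x :: real)" for x
    by (auto simp: indicator_def)
  have intL: "integrable L (\<lambda>x. indicator ?A x * indicator ?B x :: real)"
     "integrable L (\<lambda>x. indicator ?A x * cos (t \<bullet> x) * indicator ?B x)"
     "integrable L (\<lambda>x. indicator ?A x * sin (t \<bullet> x) * indicator ?B x)"
    if L: "finite_measure L" and sL: "sets L = sets borel" for L :: "(real^'d) measure"
  proof -
    have [measurable_cong]: "sets L = sets borel" by (rule sL)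
    show "integrable L (\<lambda>x. indicator ?A x * indicator ?B x :: real)"
      by (rule finite_measure.integrable_const_bound[OF L, where B=1]) (simp_all add: indicator_def, measurable)
    show "integrable L (\<lambda>x. indicator ?A x * cos (t \<bullet> x) * indicator ?B x)"
      by (rule finite_measure.integrable_const_bound[OF L, where B=1]) (simp_all add: indicator_def, measurable)
    show "integrable L (\<lambda>x. indicator ?A x * sin (t \<bullet> x) * indicator ?B x)"
      by (rule finite_measure.integrable_const_bound[OF L, where B=1]) (simp_all add: indicator_def, measurable)
  qed
  note iM = intL[OF M] and iN = intL[OF N]
  have tb: "0 \<le> 1 + cos y" "1 + cos y \<le> 2" "0 \<le> 1 + sin y" "1 + sin y \<le> 2" for y :: real
    using cos_ge_minus_one[of y] cos_le_one[of y] sin_ge_minus_one[of y] sin_le_one[of y] by linarith+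
  have 1: "?eq (\<lambda>x. indicator ?A x * indicator ?B x)"
    by (rule weighted_coordinate_uniqueness[OF M N, where B=1]) (use c0 in \<open>auto simp: indicator_def\<close>)
  have 2: "?eq (\<lambda>x. (indicator ?A x * (1 + cos (t \<bullet> x))) * indicator ?B x)"
  proof (rule weighted_coordinate_uniqueness[OF M N, where B=2])
    show "0 \<le> indicator ?A x * (1 + cos (t \<bullet> x))" "indicator ?A x * (1 + cos (t \<bullet> x)) \<le> 2" for x
      using tb(1,2)[of "t \<bullet> x"] by (simp_all add: indicator_def)
  qed (simp_all add: distrib_left distrib_right cc c0 ipM ipN intM intN)
  have 3: "?eq (\<lambda>x. (indicator ?A x * (1 + sin (t \<bullet> x))) * indicator ?B x)"
  proof (rule weighted_coordinate_uniqueness[OF M N, where B=2])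
    show "0 \<le> indicator ?A x * (1 + sin (t \<bullet> x))" "indicator ?A x * (1 + sin (t \<bullet> x)) \<le> 2" for x
      using tb(3,4)[of "t \<bullet> x"] by (simp_all add: indicator_def)
  qed (simp_all add: distrib_left distrib_right cc c0 ipM ipN intM intN)
  \<comment> \<open>Subtracting the result for weight 1 removes the summand that was added only to
    make the weight nonnegative.\<close>
  have 4: "?eq (\<lambda>x. indicator ?A x * cos (t \<bullet> x) * indicator ?B x)"
    using 1 2 iM iN by (simp add: distrib_left distrib_right)
  have 5: "?eq (\<lambda>x. indicator ?A x * sin (t \<bullet> x) * indicator ?B x)"
    using 1 3 iM iN by (simp add: distrib_left distrib_right)
  show ?case unfolding AB using 4 5 by (simp add: mult_ac)
qed

text \<open>At frequency 0 the cosine integral restricted to an orthant is the measure of that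
  orthant, and orthants form an intersection-stable generator.\<close>

theorem measure_eqI_trig_integrals:
  fixes M N :: "(real^'d::finite) measure"
  assumes M: "finite_measure M" "sets M = sets borel" and N: "finite_measure N" "sets N = sets borel"
    and c: "\<And>t. (\<integral>x. cos (t \<bullet> x) \<partial>M) = (\<integral>x. cos (t \<bullet> x) \<partial>N)"
    and s: "\<And>t. (\<integral>x. sin (t \<bullet> x) \<partial>M) = (\<integral>x. sin (t \<bullet> x) \<partial>N)"
  shows "M = N"
proof (rule measure_eqI_generator_eq[where \<Omega>=UNIV and E="range (\<lambda>a :: real^'d. {..a})" and A="\<lambda>n. {..(\<chi> i. real n)}"])
  show "Int_stable (range (\<lambda>a :: real^'d. {..a}))"
  proof (rule Int_stableI)
    fix A B :: "(real^'d) set" assume "A \<in> range atMost" "B \<in> range atMost"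
    then obtain a b where "A = {..a}" "B = {..b}" by auto
    then have "A \<inter> B = {..(\<chi> i. min (a $ i) (b $ i))}"
      by (auto simp: less_eq_vec_def)
    then show "A \<inter> B \<in> range atMost" by auto
  qed
  show "sets M = sigma_sets UNIV (range atMost)" "sets N = sigma_sets UNIV (range atMost)"
    using M(2) N(2) by (simp_all add: borel_eq_atMost)
  interpret M: finite_measure M by fact
  interpret N: finite_measure N by fact
  show "emeasure M {..(\<chi> i. real n)} \<noteq> \<infinity>" for n by simp
  have "x \<le> (\<chi> i. real (nat \<lceil>\<Sum>j\<in>UNIV. \<bar>x $ j\<bar>\<rceil>))" for x :: "real^'d"
  proof -
    have "x $ i \<le> (\<Sum>j\<in>UNIV. \<bar>x $ j\<bar>)" for i
      using member_le_sum[of i UNIV "\<lambda>j. \<bar>x $ j\<bar>"] by simp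
    moreover have "(\<Sum>j\<in>UNIV. \<bar>x $ j\<bar>) \<le> real (nat \<lceil>\<Sum>j\<in>UNIV. \<bar>x $ j\<bar>\<rceil>)"
      by (rule real_nat_ceiling_ge)
    ultimately show ?thesis by (auto simp: less_eq_vec_def intro: order_trans[OF _ le_of_int_ceiling])
  qed
  then show "(\<Union>n. {..(\<chi> i. real n)}) = (UNIV :: (real^'d) set)" by blast
  fix X :: "(real^'d) set" assume "X \<in> range atMost"
  then obtain a where X: "X = {..a}" by auto
  have A: "{x :: real^'d. \<forall>i\<in>UNIV. x $ i \<le> a $ i} = X" by (auto simp: X less_eq_vec_def)
  have "X \<in> sets borel" by (simp add: X)
  then have "measure M X = measure N X"
    using trig_integrals_restrict[OF M N c s finite, of UNIV "\<lambda>i. a $ i" 0] M(2) N(2) unfolding A by simp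
  then show "emeasure M X = emeasure N X"
    by (simp add: M.emeasure_eq_measure N.emeasure_eq_measure)
qed auto

section \<open>Real Gaussian laws, point masses included\<close>

context prob_space
begin

lemma gaussian_law_point_mass:
  assumes [measurable]: "U \<in> borel_measurable M" and "distr M borel U = gaussian_law m 0"
  shows "AE x in M. U x = m"
proof -
  have "AE y in distr M borel U. y = m"
    unfolding assms(2) gaussian_law_def by (simp add: AE_return)
  then show ?thesis by (subst (asm) AE_distr_iff) auto
qed

lemma gaussian_law_standardize:
  assumes [measurable]: "U \<in> borel_measurable M" and D: "distr M borel U = gaussian_law m s" and "s > 0"
  shows "distributed M lborel (\<lambda>x. (U x - m) / s) std_normal_density"
proof -
  have "distributed M lborel U (normal_density m s)"
  proof -
    have "distr M lborel U = distr M borel U" by (rule distr_cong) simp_all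
    then show ?thesis using D \<open>s > 0\<close> by (simp add: distributed_def gaussian_law_def)
  qed
  then show ?thesis using normal_standard_normal_convert[OF \<open>s > 0\<close>, of U m] by simp
qed

lemma gaussian_law_square_integrable:
  assumes U[measurable]: "U \<in> borel_measurable M" and D: "distr M borel U = gaussian_law m s" and "s \<ge> 0"
  shows "integrable M (\<lambda>x. (U x)\<^sup>2)"
proof (cases "s = 0")
  case True
  have "AE x in M. (U x)\<^sup>2 = m\<^sup>2"
    using gaussian_law_point_mass[OF U, of m] D True by auto
  then show ?thesis by (intro integrable_const_bound[where B="m\<^sup>2"]) auto
next
  case False
  define V where "V x = (U x - m) / s" for x
  have V: "distributed M lborel V std_normal_density"
    unfolding V_def by (rule gaussian_law_standardize) (use assms False in auto)
  have "integrable M (\<lambda>x. V x ^ k)" for k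
    using distributed_integrable[OF V, of "\<lambda>x. x ^ k"] integrable_std_normal_moment[of k] by simp
  from this[of 1] this[of 2] have "integrable M (\<lambda>x. m\<^sup>2 + 2 * m * s * V x + s\<^sup>2 * (V x)\<^sup>2)" by simp
  moreover have "m\<^sup>2 + 2 * m * s * V x + s\<^sup>2 * (V x)\<^sup>2 = (U x)\<^sup>2" for x
    using False by (simp add: V_def field_simps power2_eq_square)
  ultimately show ?thesis by simp
qed

text \<open>Standardizing reduces \<open>s > 0\<close> to the known characteristic function of the
  standard normal law; \<open>s = 0\<close> is a point mass. In both cases the vanishing expectation
  forces \<open>m = 0\<close>, which removes the phase and with it the sine part.\<close>

lemma gaussian_law_char:
  assumes U[measurable]: "U \<in> borel_measurable M" and D: "distr M borel U = gaussian_law m s" and "s \<ge> 0"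
    and E0: "expectation U = 0"
  shows "expectation (\<lambda>x. cos (r * U x)) = exp (- ((r * s)\<^sup>2 / 2)) \<and> expectation (\<lambda>x. sin (r * U x)) = 0"
proof (cases "s = 0")
  case True
  have ae: "AE x in M. U x = m" using gaussian_law_point_mass[OF U, of m] D True by auto
  have "expectation U = expectation (\<lambda>_. m)"
    by (rule integral_cong_AE) (use ae in auto)
  then have "m = 0" using E0 by (simp add: prob_space)
  then have ae: "AE x in M. U x = 0" using ae by simp
  have "expectation (\<lambda>x. cos (r * U x)) = expectation (\<lambda>_. 1)"
    by (rule integral_cong_AE) (use ae in auto)
  moreover have "expectation (\<lambda>x. sin (r * U x)) = expectation (\<lambda>_. 0)"
    by (rule integral_cong_AE) (use ae in auto)
  ultimately show ?thesis using True by (simp add: prob_space)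
next
  case False
  define V where "V x = (U x - m) / s" for x
  have V: "distributed M lborel V std_normal_density"
    unfolding V_def by (rule gaussian_law_standardize) (use assms False in auto)
  have UV: "U x = m + s * V x" for x using False by (simp add: V_def)
  have "integrable M (\<lambda>x. V x ^ 1)"
    using distributed_integrable[OF V, of "\<lambda>x. x ^ 1"] integrable_std_normal_moment[of 1] by simp
  then have Vi: "integrable M V" by simp
  have "expectation V = 0"
    using distributed_integral[OF V, of "\<lambda>x. x"] integral_std_normal_moment_odd[of 0] by simp
  then have "m = 0" using E0 Vi unfolding UV by (simp add: prob_space)
  then have Us: "r * U x = r * s * V x" for x by (simp add: UV)
  have "Complex (\<integral>x. cos (r * s * x) \<partial>std_normal_distribution) (\<integral>x. sin (r * s * x) \<partial>std_normal_distribution)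
      = complex_of_real (exp (- ((r * s)\<^sup>2 / 2)))"
    using char_eq_cos_sin[OF real_dist_normal_dist, of "r * s"] by (simp add: char_std_normal_distribution)
  moreover have "(\<integral>x. f x \<partial>std_normal_distribution) = expectation (\<lambda>x. f (V x))"
    if [measurable]: "f \<in> borel_measurable borel" for f :: "real \<Rightarrow> real"
    using distributed_integral[OF V, of f] by (simp add: integral_density normal_density_nonneg)
  ultimately show ?thesis
    unfolding Us by (simp add: complex_eq_iff)
qed

end

section \<open>Test functions with bounded second derivatives\<close>

lemma pair_integral_product:
  fixes f :: "'a \<Rightarrow> real" and g :: "'b \<Rightarrow> real"
  assumes M: "prob_space M" and N: "prob_space N" and f: "integrable M f" and g: "integrable N g"
  shows pair_integrable_product: "integrable (M \<Otimes>\<^sub>M N) (\<lambda>z. f (fst z) * g (snd z))"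
    and "(\<integral>z. f (fst z) * g (snd z) \<partial>(M \<Otimes>\<^sub>M N)) = (\<integral>x. f x \<partial>M) * (\<integral>y. g y \<partial>N)"
proof -
  interpret M: prob_space M by fact
  interpret N: prob_space N by fact
  interpret pair_prob_space M N ..
  have [measurable]: "f \<in> borel_measurable M" "g \<in> borel_measurable N" using f g by auto
  show i: "integrable (M \<Otimes>\<^sub>M N) (\<lambda>z. f (fst z) * g (snd z))"
    by (rule Fubini_integrable) (use f g in \<open>auto simp: abs_mult\<close>)
  show "(\<integral>z. f (fst z) * g (snd z) \<partial>(M \<Otimes>\<^sub>M N)) = (\<integral>x. f x \<partial>M) * (\<integral>y. g y \<partial>N)"
    using integral_fst'[OF i] by simp
qed

lemma pair_lift_fst:
  fixes f :: "'a \<Rightarrow> real"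
  assumes M: "prob_space M" and N: "prob_space N" and f: "integrable M f"
  shows "integrable (M \<Otimes>\<^sub>M N) (\<lambda>z. f (fst z))"
    and "(\<integral>z. f (fst z) \<partial>(M \<Otimes>\<^sub>M N)) = (\<integral>x. f x \<partial>M)"
  using pair_integral_product[OF M N f, of "\<lambda>_. 1"] prob_space.prob_space[OF N] N
  by (auto simp: prob_space_def finite_measure.integrable_const)

lemma pair_lift_snd:
  fixes f :: "'b \<Rightarrow> real"
  assumes M: "prob_space M" and N: "prob_space N" and f: "integrable N f"
  shows "integrable (M \<Otimes>\<^sub>M N) (\<lambda>z. f (snd z))"
    and "(\<integral>z. f (snd z) \<partial>(M \<Otimes>\<^sub>M N)) = (\<integral>x. f x \<partial>N)"
  using pair_integral_product[OF M N _ f, of "\<lambda>_. 1"] prob_space.prob_space[OF M] M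
  by (auto simp: prob_space_def finite_measure.integrable_const)

text \<open>Dominated convergence for the difference quotients: as \<open>b\<close> holds for all
  \<open>r\<close>, the mean value inequality bounds every quotient by \<open>K x\<close>.\<close>

lemma has_real_derivative_expectation:
  fixes h h' :: "real \<Rightarrow> 'a \<Rightarrow> real"
  assumes h: "\<And>r. integrable M (h r)" and K: "integrable M K"
    and d: "\<And>r x. ((\<lambda>r. h r x) has_real_derivative h' r x) (at r)"
    and b: "\<And>r x. \<bar>h' r x\<bar> \<le> K x"
    and m[measurable]: "\<And>r. h' r \<in> borel_measurable M"
  shows "((\<lambda>r. \<integral>x. h r x \<partial>M) has_real_derivative (\<integral>x. h' r x \<partial>M)) (at r)"
proof -
  have "((\<lambda>s. ((\<integral>x. h (r + s) x \<partial>M) - (\<integral>x. h r x \<partial>M)) / s) \<longlongrightarrow> (\<integral>x. h' r x \<partial>M)) (at 0)"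
    unfolding tendsto_at_iff_sequentially comp_def
  proof (intro allI impI)
    fix s :: "nat \<Rightarrow> real" assume s: "\<forall>i. s i \<in> UNIV - {0}" "s \<longlonglongrightarrow> 0"
    have eq: "((\<integral>x. h (r + s i) x \<partial>M) - (\<integral>x. h r x \<partial>M)) / s i = (\<integral>x. (h (r + s i) x - h r x) / s i \<partial>M)" for i
      using h by simp
    show "(\<lambda>i. ((\<integral>x. h (r + s i) x \<partial>M) - (\<integral>x. h r x \<partial>M)) / s i) \<longlonglongrightarrow> (\<integral>x. h' r x \<partial>M)"
      unfolding eq
    proof (rule integral_dominated_convergence[where w=K])
      show "AE x in M. (\<lambda>i. (h (r + s i) x - h r x) / s i) \<longlonglongrightarrow> h' r x"
      proof (rule AE_I2)
        fix x
        have "((\<lambda>t. (h (r + t) x - h r x) / t) \<longlongrightarrow> h' r x) (at 0)"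
          using d[of x r] by (simp add: DERIV_def)
        from this[unfolded tendsto_at_iff_sequentially comp_def, rule_format, OF _ s(2)] s(1)
        show "(\<lambda>i. (h (r + s i) x - h r x) / s i) \<longlonglongrightarrow> h' r x" by blast
      qed
      show "AE x in M. norm ((h (r + s i) x - h r x) / s i) \<le> K x" for i
      proof (rule AE_I2)
        fix x
        have "norm (h (r + s i) x - h r x) \<le> K x * norm (r + s i - r)"
          by (rule field_differentiable_bound[of UNIV "\<lambda>r. h r x" "\<lambda>r. h' r x"])
             (use d b in auto)
        then show "norm ((h (r + s i) x - h r x) / s i) \<le> K x"
          using s(1) by (simp add: divide_le_eq)
      qed
      show "(\<lambda>x. (h (r + s i) x - h r x) / s i) \<in> borel_measurable M" for i
        using h by (intro borel_measurable_divide borel_measurable_diff) auto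
    qed (use K in auto)
  qed
  then show ?thesis by (simp add: DERIV_def)
qed

text \<open>Partial derivatives are bounded entrywise, and pairing such bounds with an increment
  costs its l1 norm without a dimensional factor.\<close>

definition l1norm :: "real^'d::finite \<Rightarrow> real" where "l1norm v = (\<Sum>i\<in>UNIV. \<bar>v $ i\<bar>)"

lemma l1norm_nonneg: "0 \<le> l1norm v"
  by (simp add: l1norm_def sum_nonneg)

lemma l1norm_component: "\<bar>v $ i\<bar> \<le> l1norm v"
  unfolding l1norm_def by (rule member_le_sum) auto

lemma l1norm_add: "l1norm (u + v) \<le> l1norm u + l1norm v"
  unfolding l1norm_def sum.distrib[symmetric] by (intro sum_mono) auto

lemma l1norm_scale: "l1norm (c *\<^sub>R v) = \<bar>c\<bar> * l1norm v"
  by (simp add: l1norm_def abs_mult sum_distrib_left)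

lemma l1norm_measurable[measurable]: "l1norm \<in> borel_measurable borel"
  unfolding l1norm_def[abs_def] by measurable

lemma vec_nth_measurable[measurable]: "f \<in> borel_measurable M \<Longrightarrow> (\<lambda>x. f x $ i :: real) \<in> borel_measurable M"
  by (rule measurable_compose[of f M borel "\<lambda>v. v $ i" borel]) auto

lemma abs_weighted_sum_le:
  fixes v :: "real^'d::finite"
  assumes "\<And>i. \<bar>w i\<bar> \<le> B"
  shows "\<bar>\<Sum>i\<in>UNIV. v $ i * w i\<bar> \<le> l1norm v * B"
proof -
  have "\<bar>\<Sum>i\<in>UNIV. v $ i * w i\<bar> \<le> (\<Sum>i\<in>UNIV. \<bar>v $ i * w i\<bar>)" by (rule sum_abs)
  also have "\<dots> \<le> (\<Sum>i\<in>UNIV. \<bar>v $ i\<bar> * B)"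
    using assms by (intro sum_mono) (simp add: abs_mult mult_left_mono)
  finally show ?thesis by (simp add: l1norm_def sum_distrib_right)
qed

text \<open>The gradient is an explicit family \<open>f'\<close>, so that affine substitutions and
  quadratic functions can be supplied without evaluating \<open>partial_deriv\<close>.\<close>

locale has_partials =
  fixes f :: "real^'d::finite \<Rightarrow> real" and f' :: "'d \<Rightarrow> real^'d \<Rightarrow> real"
  assumes deriv: "\<And>x. (f has_derivative (\<lambda>h. \<Sum>i\<in>UNIV. h $ i * f' i x)) (at x)"
begin

lemma cont: "continuous_on UNIV f"
  using deriv by (meson continuous_at_imp_continuous_on has_derivative_continuous)

lemma borel: "f \<in> borel_measurable borel"
  by (rule borel_measurable_continuous_onI[OF cont])

lemma along_curve:
  assumes "(\<gamma> has_vector_derivative v) (at s)"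
  shows "((\<lambda>t. f (\<gamma> t)) has_real_derivative (\<Sum>i\<in>UNIV. v $ i * f' i (\<gamma> s))) (at s)"
proof -
  have "((\<lambda>t. f (\<gamma> t)) has_derivative (\<lambda>t. \<Sum>i\<in>UNIV. (t *\<^sub>R v) $ i * f' i (\<gamma> s))) (at s)"
    by (rule has_derivative_compose[OF assms[unfolded has_vector_derivative_def] deriv])
  then show ?thesis
    by (rule has_derivative_imp_has_field_derivative) (simp add: sum_distrib_left mult_ac)
qed

lemma mean_value: "\<exists>z. 0 < z \<and> z < 1 \<and> f (x + v) - f x = (\<Sum>i\<in>UNIV. v $ i * f' i (x + z *\<^sub>R v))"
proof -
  have c: "((\<lambda>t. x + t *\<^sub>R v) has_vector_derivative v) (at s)" for s
    by (auto intro!: derivative_eq_intros)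
  show ?thesis
    using MVT2[of 0 1 "\<lambda>t. f (x + t *\<^sub>R v)" "\<lambda>s. \<Sum>i\<in>UNIV. v $ i * f' i (x + s *\<^sub>R v)"] along_curve[OF c]
    by auto
qed

lemma lipschitz:
  assumes "\<And>i x. \<bar>f' i x\<bar> \<le> B"
  shows "\<bar>f (x + v) - f x\<bar> \<le> l1norm v * B"
proof -
  obtain z where z: "f (x + v) - f x = (\<Sum>i\<in>UNIV. v $ i * f' i (x + z *\<^sub>R v))"
    using mean_value[of x v] by blast
  show ?thesis unfolding z by (rule abs_weighted_sum_le[OF assms])
qed

lemma affine: "has_partials (\<lambda>y. f (x + c *\<^sub>R y)) (\<lambda>i y. c * f' i (x + c *\<^sub>R y))"
proof
  fix y
  have "((\<lambda>y. x + c *\<^sub>R y) has_derivative (\<lambda>h. c *\<^sub>R h)) (at y)"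
    by (auto intro!: derivative_eq_intros)
  from has_derivative_compose[OF this deriv]
  show "((\<lambda>y. f (x + c *\<^sub>R y)) has_derivative (\<lambda>h. \<Sum>i\<in>UNIV. h $ i * (c * f' i (x + c *\<^sub>R y)))) (at y)"
    by (simp add: mult_ac)
qed

lemma scaled: "has_partials (\<lambda>x. c * f x) (\<lambda>i x. c * f' i x)"
proof
  fix x
  show "((\<lambda>x. c * f x) has_derivative (\<lambda>h. \<Sum>i\<in>UNIV. h $ i * (c * f' i x))) (at x)"
    using has_derivative_mult_right[OF deriv, of c x] by (simp add: sum_distrib_left mult_ac)
qed

end

text \<open>Only the second derivatives are bounded: \<open>D1\<close> may grow linearly and
  \<open>g\<close> quadratically, which second moments can still integrate. \<open>D2 i j\<close>
  differentiates first in \<open>i\<close>, then in \<open>j\<close>.\<close>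

locale C2_bounded = has_partials g D1 for g :: "real^'d::finite \<Rightarrow> real" and D1 +
  fixes D2 :: "'d \<Rightarrow> 'd \<Rightarrow> real^'d \<Rightarrow> real" and K :: real
  assumes second: "\<And>i. has_partials (D1 i) (D2 i)"
    and bound: "\<And>i j x. \<bar>D2 i j x\<bar> \<le> K"
    and cont2: "\<And>i j. continuous_on UNIV (D2 i j)"
begin

lemma K_nonneg: "0 \<le> K" using bound[of undefined undefined 0] by linarith

lemma measurable_derivs[measurable]: "g \<in> borel_measurable borel" "D1 i \<in> borel_measurable borel" "D2 i j \<in> borel_measurable borel"
  using borel has_partials.borel[OF second] borel_measurable_continuous_onI[OF cont2] by auto

text \<open>Freezing one argument of the interpolation leaves a function of this form; each
  derivative brings out a factor \<open>c\<close>.\<close>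

lemma affine_C2: "C2_bounded (\<lambda>y. g (x + c *\<^sub>R y)) (\<lambda>i y. c * D1 i (x + c *\<^sub>R y)) (\<lambda>i j y. c * (c * D2 i j (x + c *\<^sub>R y))) (c\<^sup>2 * K)"
proof (intro C2_bounded.intro C2_bounded_axioms.intro affine)
  show "has_partials (\<lambda>y. c * D1 i (x + c *\<^sub>R y)) (\<lambda>j y. c * (c * D2 i j (x + c *\<^sub>R y)))" for i
    by (rule has_partials.scaled[OF has_partials.affine[OF second]])
  show "\<bar>c * (c * D2 i j (x + c *\<^sub>R y))\<bar> \<le> c\<^sup>2 * K" for i j y
    using mult_left_mono[OF bound[of i j "x + c *\<^sub>R y"], of "c\<^sup>2"] by (simp add: abs_mult power2_eq_square mult.assoc)
  show "continuous_on UNIV (\<lambda>y. c * (c * D2 i j (x + c *\<^sub>R y)))" for i j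
    by (intro continuous_intros continuous_on_compose2[OF cont2]) auto
qed

definition grad0 where "grad0 = (\<Sum>i\<in>UNIV. \<bar>D1 i 0\<bar>)"

lemma D1_growth: "\<bar>D1 i x\<bar> \<le> grad0 + K * l1norm x"
proof -
  have "\<bar>D1 i (0 + x) - D1 i 0\<bar> \<le> l1norm x * K"
    by (rule has_partials.lipschitz[OF second bound])
  moreover have "\<bar>D1 i 0\<bar> \<le> grad0" unfolding grad0_def by (rule member_le_sum) auto
  ultimately show ?thesis by (simp add: mult.commute)
qed

text \<open>Bounding direction and point by the same \<open>s\<close> yields
  \<open>s * (grad0 + K * s)\<close>, the shape of the dominating functions in the later
  interchanges of limit and expectation.\<close>

lemma gradient_growth:
  assumes "l1norm v \<le> s" "l1norm x \<le> s"
  shows "\<bar>\<Sum>i\<in>UNIV. v $ i * D1 i x\<bar> \<le> s * (grad0 + K * s)"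
proof -
  have "\<bar>D1 i x\<bar> \<le> grad0 + K * s" for i
    using D1_growth[of i x] mult_left_mono[OF assms(2) K_nonneg] by linarith
  then have "\<bar>\<Sum>i\<in>UNIV. v $ i * D1 i x\<bar> \<le> l1norm v * (grad0 + K * s)" by (rule abs_weighted_sum_le)
  also have "\<dots> \<le> s * (grad0 + K * s)"
    using assms l1norm_nonneg[of v] K_nonneg by (intro mult_right_mono) (auto simp: grad0_def intro!: add_nonneg_nonneg sum_nonneg)
  finally show ?thesis .
qed

lemma growth: "l1norm x \<le> s \<Longrightarrow> \<bar>g x\<bar> \<le> \<bar>g 0\<bar> + s * (grad0 + K * s)"
proof -
  assume s: "l1norm x \<le> s"
  obtain z where z: "0 < z" "z < 1" "g (0 + x) - g 0 = (\<Sum>i\<in>UNIV. x $ i * D1 i (0 + z *\<^sub>R x))"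
    using mean_value[of 0 x] by blast
  have "l1norm (z *\<^sub>R x) \<le> l1norm x"
    using z l1norm_nonneg[of x] by (simp add: l1norm_scale mult_left_le_one_le)
  then have "\<bar>\<Sum>i\<in>UNIV. x $ i * D1 i (z *\<^sub>R x)\<bar> \<le> s * (grad0 + K * s)"
    using s by (intro gradient_growth) auto
  then show ?thesis using z(3) by simp
qed

lemma integrable_quadratic_growth:
  assumes "prob_space M" "square_integrable M S" "f \<in> borel_measurable M"
    "\<And>x. \<bar>f x\<bar> \<le> b + S x * (grad0 + K * S x)"
  shows "integrable M f"
proof -
  interpret prob_space M by fact
  have "integrable M S" "integrable M (\<lambda>x. (S x)\<^sup>2)"
    using square_integrable_imp_integrable[OF assms(2)] assms(2) by (auto simp: square_integrable_def)
  then have "integrable M (\<lambda>x. b + S x * (grad0 + K * S x))"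
    by (simp add: distrib_left power2_eq_square mult_ac)
  then show ?thesis
  proof (rule Bochner_Integration.integrable_bound)
    show "AE x in M. norm (f x) \<le> norm (b + S x * (grad0 + K * S x))"
      using order_trans[OF assms(4) abs_ge_self] by simp
  qed (rule assms(3))
qed

lemma gradient_square_integrable:
  fixes Z :: "'b \<Rightarrow> real^'d"
  assumes P: "prob_space P" and [measurable]: "Z \<in> borel_measurable P" and Z: "\<And>j. square_integrable P (\<lambda>x. Z x $ j)"
  shows "square_integrable P (\<lambda>x. D1 i (Z x))"
proof -
  interpret prob_space P by fact
  show ?thesis
  proof (rule square_integrable_abs_bound)
    show "square_integrable P (\<lambda>x. grad0 + K * l1norm (Z x))"
      unfolding l1norm_def
      by (intro square_integrable_add square_integrable_const square_integrable_cmult square_integrable_sum square_integrable_abs Z)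
    show "\<bar>D1 i (Z x)\<bar> \<le> \<bar>grad0 + K * l1norm (Z x)\<bar>" for x
      by (rule order_trans[OF D1_growth abs_ge_self])
  qed measurable
qed

text \<open>Sine and cosine are bounded by 1, so the sum of the two l1 norms dominates both the path
  and its velocity at every angle. The resulting integrable bound does not depend on
  \<open>r\<close>.\<close>

lemma rotation_has_derivative:
  fixes U V :: "'b \<Rightarrow> real^'d"
  assumes P: "prob_space P" and [measurable]: "U \<in> borel_measurable P" "V \<in> borel_measurable P"
    and U: "\<And>i. square_integrable P (\<lambda>x. U x $ i)" and V: "\<And>i. square_integrable P (\<lambda>x. V x $ i)"
  shows "integrable P (\<lambda>x. g (sin r *\<^sub>R U x + cos r *\<^sub>R V x))" (is ?g)
    and "((\<lambda>r. \<integral>x. g (sin r *\<^sub>R U x + cos r *\<^sub>R V x) \<partial>P) has_real_derivative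
     (\<integral>x. (\<Sum>i\<in>UNIV. (cos r *\<^sub>R U x + (- sin r) *\<^sub>R V x) $ i * D1 i (sin r *\<^sub>R U x + cos r *\<^sub>R V x)) \<partial>P)) (at r)" (is ?d)
proof -
  interpret prob_space P by fact
  define S where "S x = l1norm (U x) + l1norm (V x)" for x
  have [measurable]: "S \<in> borel_measurable P" unfolding S_def by measurable
  have S2: "square_integrable P S"
    unfolding S_def l1norm_def by (intro square_integrable_add square_integrable_sum square_integrable_abs U V)
  have S0: "0 \<le> S x" for x by (simp add: S_def l1norm_nonneg)
  have comb: "l1norm (a *\<^sub>R U x + b *\<^sub>R V x) \<le> S x" if "\<bar>a\<bar> \<le> 1" "\<bar>b\<bar> \<le> 1" for a b x
  proof -
    have "\<bar>a\<bar> * l1norm (U x) \<le> l1norm (U x)" "\<bar>b\<bar> * l1norm (V x) \<le> l1norm (V x)"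
      by (rule mult_left_le_one_le[OF l1norm_nonneg abs_ge_zero that(1)],
          rule mult_left_le_one_le[OF l1norm_nonneg abs_ge_zero that(2)])
    then show ?thesis using l1norm_add[of "a *\<^sub>R U x" "b *\<^sub>R V x"] by (simp add: S_def l1norm_scale)
  qed
  have gi: "integrable P (\<lambda>x. g (sin r *\<^sub>R U x + cos r *\<^sub>R V x))" for r
    by (rule integrable_quadratic_growth[OF P S2, of _ "\<bar>g 0\<bar>"]) (auto intro!: growth comb)
  then show ?g .
  show ?d
  proof (rule has_real_derivative_expectation[OF gi])
    show "integrable P (\<lambda>x. S x * (grad0 + K * S x))"
      by (rule integrable_quadratic_growth[OF P S2, of _ 0])
         (use S0 K_nonneg in \<open>auto simp: abs_mult grad0_def intro!: add_nonneg_nonneg sum_nonneg\<close>)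
    fix r x
    have "((\<lambda>r. sin r *\<^sub>R U x + cos r *\<^sub>R V x) has_vector_derivative (cos r *\<^sub>R U x + (- sin r) *\<^sub>R V x)) (at r)"
      by (auto intro!: derivative_eq_intros simp: has_real_derivative_iff_has_vector_derivative[symmetric])
    then show "((\<lambda>r. g (sin r *\<^sub>R U x + cos r *\<^sub>R V x)) has_real_derivative
        (\<Sum>i\<in>UNIV. (cos r *\<^sub>R U x + (- sin r) *\<^sub>R V x) $ i * D1 i (sin r *\<^sub>R U x + cos r *\<^sub>R V x))) (at r)"
      by (rule along_curve)
    show "\<bar>\<Sum>i\<in>UNIV. (cos r *\<^sub>R U x + (- sin r) *\<^sub>R V x) $ i * D1 i (sin r *\<^sub>R U x + cos r *\<^sub>R V x)\<bar> \<le> S x * (grad0 + K * S x)"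
      by (rule gradient_growth; rule comb; simp)
  qed measurable
qed

end

section \<open>The Stein identity for Gaussian vectors\<close>

locale centered_gaussian = prob_space N for N :: "'b measure" +
  fixes Y :: "'b \<Rightarrow> real^'d::finite" and C :: "real^'d^'d"
  assumes gaussian: "centered_gaussian_vector N Y C"
begin

lemma Y_measurable[measurable]: "Y \<in> borel_measurable N"
  using gaussian by (simp add: centered_gaussian_vector_def gaussian_vector_def)

lemma projection_law: "\<exists>m s. s \<ge> 0 \<and> distr N borel (\<lambda>w. t \<bullet> Y w) = gaussian_law m s"
  using gaussian by (simp add: centered_gaussian_vector_def gaussian_vector_def)

lemma Y_square_integrable: "square_integrable N (\<lambda>w. Y w $ i)"
proof -
  obtain m s where "s \<ge> 0" "distr N borel (\<lambda>w. axis i 1 \<bullet> Y w) = gaussian_law m s"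
    using projection_law by blast
  then have "integrable N (\<lambda>w. (axis i 1 \<bullet> Y w)\<^sup>2)"
    by (intro gaussian_law_square_integrable[of _ m s]) auto
  then show ?thesis by (simp add: square_integrable_def inner_axis')
qed

lemma Y_integrable: "integrable N (\<lambda>w. Y w $ i)"
  by (rule square_integrable_imp_integrable[OF Y_square_integrable])

lemma Y_mean: "expectation (\<lambda>w. Y w $ i) = 0"
  using gaussian by (simp add: centered_gaussian_vector_def)

lemma Y_cov: "expectation (\<lambda>w. Y w $ i * Y w $ j) = C $ i $ j"
proof -
  have "covariance N (\<lambda>w. Y w $ i) (\<lambda>w. Y w $ j) = C $ i $ j"
    using gaussian by (simp add: centered_gaussian_vector_def)
  then show ?thesis by (simp add: covariance_def Y_mean)
qed

lemma projection_trig: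
  "\<exists>s. \<forall>r. expectation (\<lambda>w. cos (r * (t \<bullet> Y w))) = exp (- ((r * s)\<^sup>2 / 2)) \<and> expectation (\<lambda>w. sin (r * (t \<bullet> Y w))) = 0"
proof -
  obtain m s where "s \<ge> 0" "distr N borel (\<lambda>w. t \<bullet> Y w) = gaussian_law m s"
    using projection_law by blast
  moreover have "expectation (\<lambda>w. t \<bullet> Y w) = 0"
    by (simp add: inner_vec_def Y_integrable Y_mean)
  ultimately show ?thesis
    using gaussian_law_char[of "\<lambda>w. t \<bullet> Y w" m s] by (intro exI[of _ s]) auto
qed

text \<open>Along a direction \<open>t\<close> both copies are Gaussian with the same
  \<open>s\<close>; by independence their characteristic functions multiply, and
  \<open>a\<^sup>2 + b\<^sup>2 = 1\<close> restores \<open>exp (- (s\<^sup>2 / 2))\<close>. Only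
  one-dimensional projections enter, so a singular covariance causes no trouble.\<close>

lemma rotation_invariance:
  assumes "a\<^sup>2 + b\<^sup>2 = 1"
  shows "distr (N \<Otimes>\<^sub>M N) borel (\<lambda>z. a *\<^sub>R Y (fst z) + b *\<^sub>R Y (snd z)) = distr N borel Y"
proof (rule measure_eqI_trig_integrals)
  interpret PN: pair_prob_space N N ..
  have P: "prob_space N" by unfold_locales
  let ?W = "\<lambda>z. a *\<^sub>R Y (fst z) + b *\<^sub>R Y (snd z)"
  show "finite_measure (distr (N \<Otimes>\<^sub>M N) borel ?W)" "finite_measure (distr N borel Y)"
    by (intro prob_space.finite_measure prob_space.prob_space_distr[OF P] prob_space.prob_space_distr[OF PN.P.prob_space_axioms], measurable)+
  fix t :: "real^'d"
  obtain s where s: "\<And>r. expectation (\<lambda>w. cos (r * (t \<bullet> Y w))) = exp (- ((r * s)\<^sup>2 / 2))"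
    "\<And>r. expectation (\<lambda>w. sin (r * (t \<bullet> Y w))) = 0" using projection_trig[of t] by blast
  have i: "integrable N (\<lambda>w. cos (r * (t \<bullet> Y w)))" "integrable N (\<lambda>w. sin (r * (t \<bullet> Y w)))" for r
    by (rule trig_integrable; simp add: finite_measure_axioms)+
  note p = pair_integral_product[OF P P]
  have W: "t \<bullet> ?W z = a * (t \<bullet> Y (fst z)) + b * (t \<bullet> Y (snd z))" for z
    by (simp add: inner_add_right)
  have "(a * s)\<^sup>2 + (b * s)\<^sup>2 = s\<^sup>2"
    using assms by (metis distrib_right mult_1 power_mult_distrib)
  then have "exp (- ((a * s)\<^sup>2 / 2)) * exp (- ((b * s)\<^sup>2 / 2)) = exp (- (s\<^sup>2 / 2))"
    by (simp flip: exp_add add_divide_distrib)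
  then have "(\<integral>z. cos (t \<bullet> ?W z) \<partial>(N \<Otimes>\<^sub>M N)) = exp (- (s\<^sup>2 / 2))"
    unfolding W cos_add using p[OF i(1)[of a] i(1)[of b]] p[OF i(2)[of a] i(2)[of b]] by (simp add: s)
  moreover have "(\<integral>z. sin (t \<bullet> ?W z) \<partial>(N \<Otimes>\<^sub>M N)) = 0"
    unfolding W sin_add using p[OF i(2)[of a] i(1)[of b]] p[OF i(1)[of a] i(2)[of b]] by (simp add: s)
  ultimately show "(\<integral>x. cos (t \<bullet> x) \<partial>distr (N \<Otimes>\<^sub>M N) borel ?W) = (\<integral>x. cos (t \<bullet> x) \<partial>distr N borel Y)"
    "(\<integral>x. sin (t \<bullet> x) \<partial>distr (N \<Otimes>\<^sub>M N) borel ?W) = (\<integral>x. sin (t \<bullet> x) \<partial>distr N borel Y)"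
    using s[of 1] by (simp_all add: integral_distr)
qed auto

text \<open>Differentiating the constant function r \<open>\<mapsto>\<close> E g(sin r Y' + cos r Y), with Y' an independent copy
  of Y, and letting r tend to 0 gives the Stein identity, also for singular C.\<close>

theorem stein_identity:
  assumes "C2_bounded g D1 D2 K"
  shows "expectation (\<lambda>w. \<Sum>i\<in>UNIV. Y w $ i * D1 i (Y w)) =
     (\<Sum>i\<in>UNIV. \<Sum>j\<in>UNIV. C $ i $ j * expectation (\<lambda>w. D2 i j (Y w)))"
proof -
  interpret C2_bounded g D1 D2 K by fact
  interpret PN: pair_prob_space N N ..
  have P1: "prob_space N" by unfold_locales
  have P: "prob_space (N \<Otimes>\<^sub>M N)" by unfold_locales
  let ?N2 = "N \<Otimes>\<^sub>M N"
  define U V where "U z = Y (snd z)" and "V z = Y (fst z)" for z :: "'b \<times> 'b"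
  have [measurable]: "U \<in> borel_measurable ?N2" "V \<in> borel_measurable ?N2" unfolding U_def V_def by measurable
  have Y2: "integrable N (\<lambda>w. (Y w $ i)\<^sup>2)" for i using Y_square_integrable by (simp add: square_integrable_def)
  have U2: "square_integrable ?N2 (\<lambda>z. U z $ i)" for i
    unfolding square_integrable_def using pair_lift_snd(1)[OF P1 P1 Y2] by (auto simp: U_def)
  have V2: "square_integrable ?N2 (\<lambda>z. V z $ i)" for i
    unfolding square_integrable_def using pair_lift_fst(1)[OF P1 P1 Y2] by (auto simp: V_def)
  define Z where "Z r z = sin r *\<^sub>R U z + cos r *\<^sub>R V z" for r z
  have [measurable]: "Z r \<in> borel_measurable ?N2" for r unfolding Z_def by measurable
  have "(\<integral>z. g (Z r z) \<partial>?N2) = expectation (\<lambda>w. g (Y w))" for r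
  proof -
    have "distr ?N2 borel (Z r) = distr N borel Y"
      using rotation_invariance[of "cos r" "sin r"] by (simp add: Z_def[abs_def] U_def V_def add.commute)
    then have "(\<integral>x. g x \<partial>distr ?N2 borel (Z r)) = (\<integral>x. g x \<partial>distr N borel Y)" by simp
    then show ?thesis by (simp add: integral_distr)
  qed
  then have "((\<lambda>r. \<integral>z. g (Z r z) \<partial>?N2) has_real_derivative 0) (at r)" for r by simp
  from DERIV_unique[OF rotation_has_derivative(2)[OF P _ _ U2 V2, folded Z_def] this]
  have z: "(\<integral>x. (\<Sum>i\<in>UNIV. (cos r *\<^sub>R U x + (- sin r) *\<^sub>R V x) $ i * D1 i (Z r x)) \<partial>?N2) = 0" for r
    by simp
  \<comment> \<open>Angles tending to 0 within (0, 1], where the sine is positive and can be divided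
    by.\<close>
  define s where "s n = inverse (real (Suc n))" for n
  have s: "0 < s n" "s n \<le> 1" for n by (simp_all add: s_def inverse_le_1_iff)
  have s_lim: "s \<longlonglongrightarrow> 0" unfolding s_def by (rule LIMSEQ_inverse_real_of_nat)
  have sin_s: "0 < sin (s n)" for n using s[of n] pi_gt3 by (intro sin_gt_zero) auto
  have U_int: "integrable ?N2 (\<lambda>z. U z $ i * D1 i (Z r z))" "integrable ?N2 (\<lambda>z. U z $ i * D1 i (cos r *\<^sub>R V z))"
     "integrable ?N2 (\<lambda>z. V z $ i * D1 i (Z r z))" "integrable ?N2 (\<lambda>z. V z $ i * D1 i (V z))" for i r
  proof -
    have Z2: "square_integrable ?N2 (\<lambda>z. Z r z $ j)" for j
      unfolding Z_def by (simp, intro square_integrable_add square_integrable_cmult U2 V2)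
    have cV2: "square_integrable ?N2 (\<lambda>z. (cos r *\<^sub>R V z) $ j)" for j
      by (simp, intro square_integrable_cmult V2)
    show "integrable ?N2 (\<lambda>z. U z $ i * D1 i (Z r z))" "integrable ?N2 (\<lambda>z. U z $ i * D1 i (cos r *\<^sub>R V z))"
      "integrable ?N2 (\<lambda>z. V z $ i * D1 i (Z r z))" "integrable ?N2 (\<lambda>z. V z $ i * D1 i (V z))"
      by (intro square_integrable_mult_integrable U2 V2 gradient_square_integrable[OF P] Z2 cV2; measurable)+
  qed
  \<comment> \<open>\<open>U\<close> is centered and independent of \<open>V\<close>. Subtracting
    \<open>D1 i\<close> at \<open>cos r *\<^sub>R V z\<close> therefore changes no expectation, but
    turns the U-term into a difference quotient that survives division by
    \<open>sin r\<close>.\<close>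
  have U0: "(\<integral>z. U z $ i * D1 i (cos r *\<^sub>R V z) \<partial>?N2) = 0" for i r
  proof -
    have i: "integrable ?N2 (\<lambda>z. U z $ i * D1 i (cos r *\<^sub>R V z))" by (rule U_int)
    show ?thesis
      using PN.integral_fst'[OF i] by (simp add: U_def V_def Y_mean)
  qed
  let ?q = "\<lambda>i n z. (D1 i (Z (s n) z) - D1 i (cos (s n) *\<^sub>R V z)) / sin (s n)"
  have identity: "(\<integral>z. (\<Sum>i\<in>UNIV. V z $ i * D1 i (Z (s n) z)) \<partial>?N2) =
     cos (s n) * (\<integral>z. (\<Sum>i\<in>UNIV. U z $ i * ?q i n z) \<partial>?N2)" for n
  proof -
    let ?r = "s n"
    have "0 = cos ?r * (\<Sum>i\<in>UNIV. \<integral>z. U z $ i * D1 i (Z ?r z) \<partial>?N2) - sin ?r * (\<Sum>i\<in>UNIV. \<integral>z. V z $ i * D1 i (Z ?r z) \<partial>?N2)"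
      using z[of ?r] by (simp add: distrib_right left_diff_distrib mult.assoc U_int sum_subtractf flip: sum_distrib_left)
    then have "(\<Sum>i\<in>UNIV. \<integral>z. V z $ i * D1 i (Z ?r z) \<partial>?N2) = cos ?r * (\<Sum>i\<in>UNIV. \<integral>z. U z $ i * D1 i (Z ?r z) \<partial>?N2) / sin ?r"
      using sin_s[of n] by (simp add: field_simps)
    moreover have q: "(\<integral>z. U z $ i * ((D1 i (Z ?r z) - D1 i (cos ?r *\<^sub>R V z)) / sin ?r) \<partial>?N2) = (\<integral>z. U z $ i * D1 i (Z ?r z) \<partial>?N2) / sin ?r"
       "integrable ?N2 (\<lambda>z. U z $ i * ((D1 i (Z ?r z) - D1 i (cos ?r *\<^sub>R V z)) / sin ?r))" for i
      by (simp_all add: right_diff_distrib U_int U0 times_divide_eq_right)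
    have "(\<integral>z. (\<Sum>i\<in>UNIV. U z $ i * ((D1 i (Z ?r z) - D1 i (cos ?r *\<^sub>R V z)) / sin ?r)) \<partial>?N2)
       = (\<Sum>i\<in>UNIV. (\<integral>z. U z $ i * D1 i (Z ?r z) \<partial>?N2) / sin ?r)"
      by (subst Bochner_Integration.integral_sum[OF q(2)]) (simp only: q(1))
    moreover have "(\<integral>z. (\<Sum>i\<in>UNIV. V z $ i * D1 i (Z ?r z)) \<partial>?N2) = (\<Sum>i\<in>UNIV. \<integral>z. V z $ i * D1 i (Z ?r z) \<partial>?N2)"
      by (rule Bochner_Integration.integral_sum[OF U_int(3)])
    ultimately show ?thesis by (simp only: sum_divide_distrib[symmetric] times_divide_eq_right)
  qed
  have Zlim: "(\<lambda>n. Z (s n) z) \<longlonglongrightarrow> V z" for z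
  proof -
    have "(\<lambda>n. sin (s n) *\<^sub>R U z + cos (s n) *\<^sub>R V z) \<longlonglongrightarrow> sin 0 *\<^sub>R U z + cos 0 *\<^sub>R V z"
      by (intro tendsto_intros s_lim)
    then show ?thesis by (simp add: Z_def)
  qed
  define S where "S x = l1norm (U x) + l1norm (V x)" for x
  have [measurable]: "S \<in> borel_measurable ?N2" unfolding S_def by measurable
  have S2: "square_integrable ?N2 S"
    unfolding S_def l1norm_def by (intro square_integrable_add square_integrable_sum square_integrable_abs U2 V2)
  have S0: "0 \<le> S x" for x by (simp add: S_def l1norm_nonneg)
  have Sdom: "integrable ?N2 (\<lambda>x. S x * (grad0 + K * S x))"
    by (rule integrable_quadratic_growth[OF P S2, of _ 0])
       (use S0 K_nonneg in \<open>auto simp: abs_mult grad0_def intro!: add_nonneg_nonneg sum_nonneg\<close>)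
  have comb: "l1norm (Z r x) \<le> S x" for r x
  proof -
    have "\<bar>sin r\<bar> * l1norm (U x) \<le> l1norm (U x)" "\<bar>cos r\<bar> * l1norm (V x) \<le> l1norm (V x)"
      by (rule mult_left_le_one_le[OF l1norm_nonneg abs_ge_zero abs_sin_le_one],
          rule mult_left_le_one_le[OF l1norm_nonneg abs_ge_zero abs_cos_le_one])
    then show ?thesis using l1norm_add[of "sin r *\<^sub>R U x" "cos r *\<^sub>R V x"] by (simp add: S_def Z_def l1norm_scale)
  qed
  have D1c: "isCont (D1 i) x" and D2c: "isCont (D2 i j) x" for i j x
    using has_partials.cont[OF second] cont2 by (auto simp: continuous_on_eq_continuous_at)
  have lim1: "(\<lambda>n. \<integral>z. (\<Sum>i\<in>UNIV. V z $ i * D1 i (Z (s n) z)) \<partial>?N2) \<longlonglongrightarrow> (\<integral>z. (\<Sum>i\<in>UNIV. V z $ i * D1 i (V z)) \<partial>?N2)"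
  proof (rule integral_dominated_convergence[OF _ _ Sdom])
    show "AE z in ?N2. (\<lambda>n. \<Sum>i\<in>UNIV. V z $ i * D1 i (Z (s n) z)) \<longlonglongrightarrow> (\<Sum>i\<in>UNIV. V z $ i * D1 i (V z))"
      by (intro AE_I2 tendsto_intros isCont_tendsto_compose[OF D1c] Zlim)
    show "AE z in ?N2. norm (\<Sum>i\<in>UNIV. V z $ i * D1 i (Z (s n) z)) \<le> S z * (grad0 + K * S z)" for n
      unfolding real_norm_def using comb l1norm_nonneg by (intro AE_I2 gradient_growth) (auto simp: S_def)
  qed measurable
  \<comment> \<open>The mean value theorem turns the quotient into second derivatives at a point
    that is forced towards \<open>V z\<close> as the angle vanishes. The same formula supplies the
    dominating bound.\<close>
  have quot: "\<exists>\<xi>. l1norm (\<xi> - cos r *\<^sub>R V z) \<le> \<bar>sin r\<bar> * l1norm (U z) \<and>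
      (D1 i (Z r z) - D1 i (cos r *\<^sub>R V z)) / sin r = (\<Sum>j\<in>UNIV. U z $ j * D2 i j \<xi>)" if "sin r > 0" for i r z
  proof -
    obtain t where t: "0 < t" "t < 1" "D1 i (cos r *\<^sub>R V z + sin r *\<^sub>R U z) - D1 i (cos r *\<^sub>R V z) =
        (\<Sum>j\<in>UNIV. (sin r *\<^sub>R U z) $ j * D2 i j (cos r *\<^sub>R V z + t *\<^sub>R sin r *\<^sub>R U z))"
      using has_partials.mean_value[OF second] by blast
    have "l1norm (t *\<^sub>R sin r *\<^sub>R U z) \<le> \<bar>sin r\<bar> * l1norm (U z)"
      unfolding l1norm_scale using t(1,2) l1norm_nonneg[of "U z"] by (simp add: mult_left_le_one_le)
    moreover have "(D1 i (Z r z) - D1 i (cos r *\<^sub>R V z)) / sin r = (\<Sum>j\<in>UNIV. U z $ j * D2 i j (cos r *\<^sub>R V z + t *\<^sub>R sin r *\<^sub>R U z))"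
      using t(3) that by (simp add: Z_def add.commute mult.assoc sum_distrib_left[symmetric] field_simps)
    ultimately show ?thesis by (intro exI[of _ "cos r *\<^sub>R V z + t *\<^sub>R sin r *\<^sub>R U z"]) auto
  qed
  have lim2: "(\<lambda>n. \<integral>z. (\<Sum>i\<in>UNIV. U z $ i * ?q i n z) \<partial>?N2)
     \<longlonglongrightarrow> (\<integral>z. (\<Sum>i\<in>UNIV. U z $ i * (\<Sum>j\<in>UNIV. U z $ j * D2 i j (V z))) \<partial>?N2)"
  proof (rule integral_dominated_convergence[OF _ _ Sdom])
    show "AE z in ?N2. (\<lambda>n. \<Sum>i\<in>UNIV. U z $ i * ?q i n z)
        \<longlonglongrightarrow> (\<Sum>i\<in>UNIV. U z $ i * (\<Sum>j\<in>UNIV. U z $ j * D2 i j (V z)))"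
    proof (rule AE_I2, intro tendsto_sum tendsto_mult tendsto_const)
      fix z i
      have "\<forall>n. \<exists>\<xi>. l1norm (\<xi> - cos (s n) *\<^sub>R V z) \<le> \<bar>sin (s n)\<bar> * l1norm (U z) \<and>
         ?q i n z = (\<Sum>j\<in>UNIV. U z $ j * D2 i j \<xi>)"
        using quot[OF sin_s] by blast
      then obtain \<xi> where \<xi>: "\<And>n. l1norm (\<xi> n - cos (s n) *\<^sub>R V z) \<le> \<bar>sin (s n)\<bar> * l1norm (U z)"
        "\<And>n. ?q i n z = (\<Sum>j\<in>UNIV. U z $ j * D2 i j (\<xi> n))"
        by metis
      have "(\<lambda>n. \<xi> n - cos (s n) *\<^sub>R V z) \<longlonglongrightarrow> 0"
      proof (rule tendsto_norm_zero_cancel, rule tendsto_sandwich[OF _ _ tendsto_const])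
        show "\<forall>\<^sub>F n in sequentially. 0 \<le> norm (\<xi> n - cos (s n) *\<^sub>R V z)" by simp
        show "\<forall>\<^sub>F n in sequentially. norm (\<xi> n - cos (s n) *\<^sub>R V z) \<le> \<bar>sin (s n)\<bar> * l1norm (U z)"
          unfolding l1norm_def
          by (intro always_eventually allI order_trans[OF norm_le_l1_cart \<xi>(1)[unfolded l1norm_def]])
        have "(\<lambda>n. \<bar>sin (s n)\<bar> * l1norm (U z)) \<longlonglongrightarrow> \<bar>sin 0\<bar> * l1norm (U z)"
          by (intro tendsto_intros s_lim)
        then show "(\<lambda>n. \<bar>sin (s n)\<bar> * l1norm (U z)) \<longlonglongrightarrow> 0" by simp
      qed
      moreover have "(\<lambda>n. cos (s n) *\<^sub>R V z) \<longlonglongrightarrow> cos 0 *\<^sub>R V z" by (intro tendsto_intros s_lim)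
      ultimately have "(\<lambda>n. (\<xi> n - cos (s n) *\<^sub>R V z) + cos (s n) *\<^sub>R V z) \<longlonglongrightarrow> 0 + cos 0 *\<^sub>R V z"
        by (rule tendsto_add)
      then have "\<xi> \<longlonglongrightarrow> V z" by simp
      then show "(\<lambda>n. ?q i n z) \<longlonglongrightarrow> (\<Sum>j\<in>UNIV. U z $ j * D2 i j (V z))"
        unfolding \<xi>(2) by (intro tendsto_intros isCont_tendsto_compose[OF D2c])
    qed
    show "AE z in ?N2. norm (\<Sum>i\<in>UNIV. U z $ i * ?q i n z) \<le> S z * (grad0 + K * S z)" for n
    proof (rule AE_I2)
      fix z
      have "\<bar>?q i n z\<bar> \<le> l1norm (U z) * K" for i
      proof -
        obtain \<xi> where \<xi>: "?q i n z = (\<Sum>j\<in>UNIV. U z $ j * D2 i j \<xi>)"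
          using quot[OF sin_s[of n]] by blast
        show ?thesis unfolding \<xi> by (rule abs_weighted_sum_le[OF bound])
      qed
      then have "norm (\<Sum>i\<in>UNIV. U z $ i * ?q i n z) \<le> l1norm (U z) * (l1norm (U z) * K)"
        unfolding real_norm_def by (rule abs_weighted_sum_le)
      also have "\<dots> \<le> S z * (S z * K)"
        using l1norm_nonneg K_nonneg by (intro mult_mono) (auto simp: S_def intro!: mult_nonneg_nonneg)
      also have "\<dots> \<le> S z * (grad0 + K * S z)"
        using S0[of z] by (intro mult_left_mono) (auto simp: grad0_def sum_nonneg)
      finally show "norm (\<Sum>i\<in>UNIV. U z $ i * ?q i n z) \<le> S z * (grad0 + K * S z)" .
    qed
  qed measurable
  have "(\<lambda>n. cos (s n)) \<longlonglongrightarrow> cos 0" by (intro tendsto_intros s_lim)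
  from tendsto_mult[OF this lim2] lim1
  have "(\<integral>z. (\<Sum>i\<in>UNIV. V z $ i * D1 i (V z)) \<partial>?N2) = cos 0 * (\<integral>z. (\<Sum>i\<in>UNIV. U z $ i * (\<Sum>j\<in>UNIV. U z $ j * D2 i j (V z))) \<partial>?N2)"
    unfolding identity by (rule LIMSEQ_unique[rotated])
  moreover have "(\<integral>z. (\<Sum>i\<in>UNIV. V z $ i * D1 i (V z)) \<partial>?N2) = expectation (\<lambda>w. \<Sum>i\<in>UNIV. Y w $ i * D1 i (Y w))"
  proof -
    have "integrable ?N2 (\<lambda>z. \<Sum>i\<in>UNIV. V z $ i * D1 i (V z))" using U_int by simp
    from PN.integral_fst'[OF this] show ?thesis by (simp add: V_def prob_space)
  qed
  \<comment> \<open>In the limit \<open>U\<close> and \<open>V\<close> occur in separate factors;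
    independence splits them, and the second moments of \<open>U\<close> give
    \<open>C\<close>.\<close>
  moreover have "(\<integral>z. (\<Sum>i\<in>UNIV. U z $ i * (\<Sum>j\<in>UNIV. U z $ j * D2 i j (V z))) \<partial>?N2) =
      (\<Sum>i\<in>UNIV. \<Sum>j\<in>UNIV. C $ i $ j * expectation (\<lambda>w. D2 i j (Y w)))"
  proof -
    have D2i: "integrable N (\<lambda>w. D2 i j (Y w))" for i j
      by (rule integrable_const_bound[where B=K]) (use bound in auto)
    have YY: "integrable N (\<lambda>w. Y w $ i * Y w $ j)" for i j
      by (rule square_integrable_mult_integrable[OF Y_square_integrable Y_square_integrable])
    have "integrable ?N2 (\<lambda>z. U z $ i * (U z $ j * D2 i j (V z)))"
      "(\<integral>z. U z $ i * (U z $ j * D2 i j (V z)) \<partial>?N2) = C $ i $ j * expectation (\<lambda>w. D2 i j (Y w))" for i j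
      using pair_integral_product[OF P1 P1 D2i[of i j] YY[of i j]] by (simp_all add: U_def V_def mult_ac Y_cov)
    then show ?thesis by (simp add: sum_distrib_left)
  qed
  ultimately show ?thesis by simp
qed

end

section \<open>Integration by parts for quadratic forms\<close>

lemma borel_measurable_vecI:
  fixes f :: "'a \<Rightarrow> real^'d::finite"
  assumes "\<And>i. (\<lambda>x. f x $ i) \<in> borel_measurable M"
  shows "f \<in> borel_measurable M"
proof (subst borel_measurable_euclidean_space, rule ballI)
  fix b :: "real^'d" assume "b \<in> Basis"
  then obtain i where "b = axis i 1" by (auto simp: Basis_vec_def)
  then show "(\<lambda>x. f x \<bullet> b) \<in> borel_measurable M"
    using assms[of i] by (simp add: inner_axis)
qed

text \<open>Power mean inequality, obtained by summing the tangent line of the cube at the mean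
  \<open>t\<close> of the entries \<open>\<bar>v $ i\<bar>\<close>. This is the origin of the
  squared dimension in the theorem.\<close>

lemma l1norm_cube_le:
  "l1norm (v :: real^'d::finite) ^ 3 \<le> (real CARD('d))\<^sup>2 * (\<Sum>i\<in>UNIV. \<bar>v $ i\<bar> ^ 3)"
proof -
  define d t where "d = real CARD('d)" and "t = l1norm v / real CARD('d)"
  have d: "d > 0" and t: "t \<ge> 0" "d * t = l1norm v" by (simp_all add: d_def t_def l1norm_nonneg)
  have *: "3 * t\<^sup>2 * x - 2 * t ^ 3 \<le> x ^ 3" if "x \<ge> 0" for x
  proof -
    have "0 \<le> (x - t)\<^sup>2 * (x + 2 * t)" using that t by simp
    then show ?thesis by (simp add: power2_eq_square power3_eq_cube algebra_simps)
  qed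
  have "d * t ^ 3 = (\<Sum>i\<in>UNIV. 3 * t\<^sup>2 * \<bar>v $ i\<bar> - 2 * t ^ 3)"
    using t(2) by (simp add: sum_subtractf l1norm_def d_def flip: sum_distrib_left)
      (simp add: power2_eq_square power3_eq_cube algebra_simps)
  also have "\<dots> \<le> (\<Sum>i\<in>UNIV. \<bar>v $ i\<bar> ^ 3)" by (intro sum_mono *) auto
  finally have "d\<^sup>2 * (d * t ^ 3) \<le> d\<^sup>2 * (\<Sum>i\<in>UNIV. \<bar>v $ i\<bar> ^ 3)" by (intro mult_left_mono) auto
  then show ?thesis using t(2)[symmetric] by (simp add: d_def power2_eq_square power3_eq_cube mult_ac)
qed

text \<open>\<open>m\<close> is any common bound on the fourth moments: the maximum over finitely
  many variables for the quantitative bound, one bound for all of them for the convergence.\<close>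

locale quadratic_forms = indep_standardized M X I for M :: "'a measure" and X I +
  fixes a :: "'d::finite \<Rightarrow> nat \<Rightarrow> nat \<Rightarrow> real" and m :: real
  assumes finite_I: "finite I"
    and sym: "\<And>i u v. u \<in> I \<Longrightarrow> v \<in> I \<Longrightarrow> a i u v = a i v u"
    and diag: "\<And>i u. u \<in> I \<Longrightarrow> a i u u = 0"
    and fourth_le: "\<And>v. v \<in> I \<Longrightarrow> expectation (\<lambda>w. X v w ^ 4) \<le> m"
    and m_ge_1: "1 \<le> m"
begin

text \<open>\<open>A k\<close> is the partial derivative of \<open>F\<close> in variable
  \<open>k\<close> and is free of that variable. The random vectors are kept as functionals of a
  sequence \<open>p\<close> so that \<open>indep_split\<close> applies to expressions built from
  them.\<close>

definition A :: "nat \<Rightarrow> (nat \<Rightarrow> real) \<Rightarrow> real^'d" where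
  "A k p = (\<chi> i. \<Sum>v\<in>I. a i k v * p v)"

definition F :: "(nat \<Rightarrow> real) \<Rightarrow> real^'d" where
  "F p = (\<chi> i. (\<Sum>u\<in>I. p u * A u p $ i) / 2)"

definition W :: "nat \<Rightarrow> (nat \<Rightarrow> real) \<Rightarrow> real^'d" where
  "W k p = (\<chi> i. (\<Sum>u\<in>I-{k}. p u * (\<Sum>v\<in>I-{k}. a i u v * p v)) / 2)"

text \<open>Half the inner product of the discrete gradients of \<open>F p $ i\<close> and
  \<open>F p $ j\<close>, the half being one over the degree of the forms. It plays the part of a
  random covariance matrix.\<close>

definition \<Gamma> :: "'d \<Rightarrow> 'd \<Rightarrow> (nat \<Rightarrow> real) \<Rightarrow> real" where
  "\<Gamma> i j p = (\<Sum>k\<in>I. A k p $ i * A k p $ j) / 2"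

abbreviation x :: "'a \<Rightarrow> nat \<Rightarrow> real" where "x w \<equiv> (\<lambda>v. X v w)"

lemma A_without: "k \<in> I \<Longrightarrow> A k p $ i = (\<Sum>v\<in>I-{k}. a i k v * p v)"
  by (simp add: A_def sum.remove[OF finite_I, of k] diag)

text \<open>The summands with \<open>u = k\<close> and those with \<open>v = k\<close> coincide by
  symmetry, which absorbs the factor 1/2; the diagonal one is zero.\<close>

lemma F_split:
  assumes k: "k \<in> I"
  shows "F p = W k p + p k *\<^sub>R A k p"
proof (rule vec_eq_iff[THEN iffD2, rule_format])
  fix i
  have "(\<Sum>u\<in>I. p u * A u p $ i) = p k * A k p $ i + (\<Sum>u\<in>I-{k}. p u * A u p $ i)"
    using sum.remove[OF finite_I k] .
  also have "(\<Sum>u\<in>I-{k}. p u * A u p $ i) = (\<Sum>u\<in>I-{k}. p u * (a i u k * p k + (\<Sum>v\<in>I-{k}. a i u v * p v)))"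
    by (simp add: A_def sum.remove[OF finite_I k])
  also have "\<dots> = p k * (\<Sum>u\<in>I-{k}. a i u k * p u) + (\<Sum>u\<in>I-{k}. p u * (\<Sum>v\<in>I-{k}. a i u v * p v))"
    by (simp add: distrib_left sum.distrib sum_distrib_left mult_ac)
  also have "(\<Sum>u\<in>I-{k}. a i u k * p u) = A k p $ i"
    unfolding A_without[OF k] using sym k by (intro sum.cong) auto
  finally show "F p $ i = (W k p + p k *\<^sub>R A k p) $ i"
    by (simp add: F_def W_def)
qed

lemma A_dep: "k \<in> I \<Longrightarrow> A k (restrict p (I-{k})) = A k p"
  by (simp add: vec_eq_iff A_without)

lemma W_dep: "W k (restrict p (I-{k})) = W k p"
  by (simp add: W_def)

lemma A_functional_measurable:
  assumes "k \<in> I" shows "A k \<in> borel_measurable (PiM (I-{k}) (\<lambda>_. borel))"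
proof (rule borel_measurable_vecI)
  fix i show "(\<lambda>p. A k p $ i) \<in> borel_measurable (PiM (I-{k}) (\<lambda>_. borel))"
    unfolding A_without[OF assms] by (rule linear_form_functional_measurable)
qed

lemma W_functional_measurable: "W k \<in> borel_measurable (PiM (I-{k}) (\<lambda>_. borel))"
proof (rule borel_measurable_vecI)
  fix i show "(\<lambda>p. W k p $ i) \<in> borel_measurable (PiM (I-{k}) (\<lambda>_. borel))"
    unfolding W_def vec_lambda_beta
    by (intro borel_measurable_divide borel_measurable_sum borel_measurable_times borel_measurable_const measurable_component_singleton)
qed

lemma A_measurable[measurable]: "(\<lambda>w. A k (x w)) \<in> borel_measurable M"
  by (rule borel_measurable_vecI) (simp add: A_def linear_form_measurable)

lemma F_square_integrable: "square_integrable M (\<lambda>w. F (x w) $ i)"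
proof -
  have "square_integrable M (\<lambda>w. (1/2) * (\<Sum>u\<in>I. \<Sum>v\<in>I. a i u v * (X u w * X v w)))"
    by (intro square_integrable_cmult quadratic_form_square_integrable) auto
  then show ?thesis by (simp add: F_def A_def sum_distrib_left sum_divide_distrib mult_ac)
qed

lemma W_square_integrable: "square_integrable M (\<lambda>w. W k (x w) $ i)"
proof -
  have "square_integrable M (\<lambda>w. (1/2) * (\<Sum>u\<in>I-{k}. \<Sum>v\<in>I-{k}. a i u v * (X u w * X v w)))"
    by (intro square_integrable_cmult quadratic_form_square_integrable) auto
  then show ?thesis by (simp add: W_def sum_distrib_left sum_divide_distrib mult_ac)
qed

lemma F_measurable[measurable]: "(\<lambda>w. F (x w)) \<in> borel_measurable M"
  and W_measurable[measurable]: "(\<lambda>w. W k (x w)) \<in> borel_measurable M"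
  using F_square_integrable W_square_integrable by (auto intro!: borel_measurable_vecI simp: square_integrable_def)

lemma A_fourth_integrable: "integrable M (\<lambda>w. (A k (x w) $ i) ^ 4)"
  by (simp add: A_def linear_form_fourth_integrable[OF finite_I])

lemma A_square_integrable: "square_integrable M (\<lambda>w. A k (x w) $ i)"
  by (simp add: A_def linear_form_square_integrable)

lemma abs_cube_integrable:
  fixes f :: "'a \<Rightarrow> real"
  assumes "f \<in> borel_measurable M" "integrable M (\<lambda>w. f w ^ 4)"
  shows "integrable M (\<lambda>w. \<bar>f w\<bar> ^ 3)"
  using integrable_abs[OF integrable_power_fourth[OF assms, of 3]] by (simp add: power_abs)

text \<open>Cauchy-Schwarz between the second and fourth moments of a linear form gives the power
  3/2; \<open>sqrt 3 * sqrt m\<close> comes from \<open>linear_form_fourth_moment\<close>.\<close>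

lemma A_cube_bound:
  shows A_cube_integrable: "integrable M (\<lambda>w. l1norm (A k (x w)) ^ 3)"
    and "expectation (\<lambda>w. l1norm (A k (x w)) ^ 3) \<le> (real CARD('d))\<^sup>2 * (sqrt 3 * sqrt m * (\<Sum>i\<in>UNIV. (\<Sum>v\<in>I. (a i k v)\<^sup>2) powr (3/2)))"
proof -
  have i: "integrable M (\<lambda>w. \<bar>A k (x w) $ i\<bar> ^ 3)" for i
    by (rule abs_cube_integrable[OF _ A_fourth_integrable]) measurable
  have si: "integrable M (\<lambda>w. (real CARD('d))\<^sup>2 * (\<Sum>i\<in>UNIV. \<bar>A k (x w) $ i\<bar> ^ 3))" using i by simp
  show li: "integrable M (\<lambda>w. l1norm (A k (x w)) ^ 3)"
  proof (rule Bochner_Integration.integrable_bound[OF si])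
    show "AE w in M. norm (l1norm (A k (x w)) ^ 3) \<le> norm ((real CARD('d))\<^sup>2 * (\<Sum>i\<in>UNIV. \<bar>A k (x w) $ i\<bar> ^ 3))"
      by (intro AE_I2, unfold real_norm_def abs_of_nonneg[OF zero_le_power[OF l1norm_nonneg]])
         (rule order_trans[OF l1norm_cube_le abs_ge_self])
  qed measurable
  have "expectation (\<lambda>w. l1norm (A k (x w)) ^ 3) \<le> expectation (\<lambda>w. (real CARD('d))\<^sup>2 * (\<Sum>i\<in>UNIV. \<bar>A k (x w) $ i\<bar> ^ 3))"
    by (rule integral_mono[OF li si]) (rule l1norm_cube_le)
  also have "\<dots> = (real CARD('d))\<^sup>2 * (\<Sum>i\<in>UNIV. expectation (\<lambda>w. \<bar>A k (x w) $ i\<bar> ^ 3))"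
    using i by simp
  also have "\<dots> \<le> (real CARD('d))\<^sup>2 * (\<Sum>i\<in>UNIV. sqrt 3 * sqrt m * (\<Sum>v\<in>I. (a i k v)\<^sup>2) powr (3/2))"
  proof (intro mult_left_mono sum_mono)
    fix i
    let ?s = "\<Sum>v\<in>I. (a i k v)\<^sup>2"
    have s0: "?s \<ge> 0" by (intro sum_nonneg) auto
    have "expectation (\<lambda>w. \<bar>A k (x w) $ i\<bar> ^ 3) \<le> sqrt (expectation (\<lambda>w. (A k (x w) $ i)\<^sup>2)) * sqrt (expectation (\<lambda>w. (A k (x w) $ i) ^ 4))"
      by (rule expectation_abs_cube_le[OF _ A_fourth_integrable]) measurable
    also have "\<dots> \<le> sqrt ?s * sqrt (3 * m * ?s\<^sup>2)"
    proof (rule mult_mono)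
      show "sqrt (expectation (\<lambda>w. (A k (x w) $ i)\<^sup>2)) \<le> sqrt ?s"
        using linear_form_second_moment[OF finite_I subset_refl, of "a i k"] by (simp add: A_def)
      show "sqrt (expectation (\<lambda>w. (A k (x w) $ i) ^ 4)) \<le> sqrt (3 * m * ?s\<^sup>2)"
        using linear_form_fourth_moment[OF finite_I subset_refl m_ge_1 fourth_le, of "a i k"] by (simp add: A_def)
    qed (use s0 in auto)
    also have "\<dots> = sqrt 3 * sqrt m * (?s * sqrt ?s)"
      using s0 by (simp add: real_sqrt_mult)
    also have "?s * sqrt ?s = ?s powr (3/2)"
      using s0 powr_add[of ?s 1 "1/2"] by (cases "?s = 0") (simp_all add: powr_half_sqrt)
    finally show "expectation (\<lambda>w. \<bar>A k (x w) $ i\<bar> ^ 3) \<le> sqrt 3 * sqrt m * ?s powr (3/2)" .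
  qed auto
  finally show "expectation (\<lambda>w. l1norm (A k (x w)) ^ 3) \<le> (real CARD('d))\<^sup>2 * (sqrt 3 * sqrt m * (\<Sum>i\<in>UNIV. (\<Sum>v\<in>I. (a i k v)\<^sup>2) powr (3/2)))"
    by (simp add: sum_distrib_left)
qed

lemma \<Gamma>_integrable: "integrable M (\<lambda>w. \<Gamma> i j (x w))"
  unfolding \<Gamma>_def using square_integrable_mult_integrable[OF A_square_integrable A_square_integrable] by simp

text \<open>Up to its mean, \<Gamma> is half a centered quadratic form whose matrix is the
  contraction \<open>B\<close> of the coefficients, so its variance is known from
  \<open>quadratic_form_variance\<close>.\<close>

lemma \<Gamma>_deviation:
  assumes K: "2 \<le> K" "\<And>v. v \<in> I \<Longrightarrow> expectation (\<lambda>w. X v w ^ 4) - 1 \<le> K"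
  shows "expectation (\<lambda>w. \<bar>\<Gamma> i j (x w) - expectation (\<lambda>w. \<Gamma> i j (x w))\<bar>)
     \<le> sqrt (K * (\<Sum>u\<in>I. \<Sum>v\<in>I. (\<Sum>k\<in>I. a i k u * a j k v)\<^sup>2)) / 2"
proof -
  define B where "B u v = (\<Sum>k\<in>I. a i k u * a j k v)" for u v
  define Q where "Q p = (\<Sum>u\<in>I. \<Sum>v\<in>I. B u v * (p u * p v)) - (\<Sum>u\<in>I. B u u)" for p :: "nat \<Rightarrow> real"
  have \<Gamma>Q: "\<Gamma> i j p = Q p / 2 + (\<Sum>u\<in>I. B u u) / 2" for p
  proof -
    have "(\<Sum>k\<in>I. A k p $ i * A k p $ j) = (\<Sum>k\<in>I. \<Sum>u\<in>I. \<Sum>v\<in>I. a i k u * a j k v * (p u * p v))"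
      by (simp add: A_def sum_product mult_ac)
    also have "\<dots> = (\<Sum>u\<in>I. \<Sum>k\<in>I. \<Sum>v\<in>I. a i k u * a j k v * (p u * p v))" by (rule sum.swap)
    also have "\<dots> = (\<Sum>u\<in>I. \<Sum>v\<in>I. \<Sum>k\<in>I. a i k u * a j k v * (p u * p v))"
      by (intro sum.cong refl sum.swap)
    also have "\<dots> = (\<Sum>u\<in>I. \<Sum>v\<in>I. B u v * (p u * p v))" by (simp add: B_def sum_distrib_right)
    finally show ?thesis by (simp add: \<Gamma>_def Q_def diff_divide_distrib)
  qed
  have Q: "expectation (\<lambda>w. Q (x w)) = 0" "expectation (\<lambda>w. (Q (x w))\<^sup>2) \<le> K * (\<Sum>u\<in>I. \<Sum>v\<in>I. (B u v)\<^sup>2)"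
    using quadratic_form_variance[OF finite_I subset_refl K, of B] by (simp_all add: Q_def)
  have Qs: "square_integrable M (\<lambda>w. Q (x w))"
    using square_integrable_add[OF quadratic_form_square_integrable[OF subset_refl, of B] square_integrable_const[of "- (\<Sum>u\<in>I. B u u)"]]
    by (simp add: Q_def)
  have dev: "\<bar>\<Gamma> i j (x w) - expectation (\<lambda>w. \<Gamma> i j (x w))\<bar> = \<bar>Q (x w)\<bar> / 2" for w
    unfolding \<Gamma>Q using Q(1) square_integrable_imp_integrable[OF Qs] by (simp add: prob_space)
  have "expectation (\<lambda>w. \<bar>\<Gamma> i j (x w) - expectation (\<lambda>w. \<Gamma> i j (x w))\<bar>) = expectation (\<lambda>w. \<bar>Q (x w)\<bar>) / 2"
    unfolding dev by simp
  also have "\<dots> \<le> sqrt (expectation (\<lambda>w. (Q (x w))\<^sup>2)) / 2"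
    using expectation_abs_le_sqrt[OF Qs] by simp
  also have "\<dots> \<le> sqrt (K * (\<Sum>u\<in>I. \<Sum>v\<in>I. (B u v)\<^sup>2)) / 2" using Q(2) by simp
  finally show ?thesis by (simp add: B_def)
qed

text \<open>The two powers are those of the Taylor errors in the integration by parts: three factors
  \<open>\<bar>X v\<bar>\<close> from expanding \<open>D1\<close>, one from moving \<open>D2\<close>
  from \<open>W\<close> to \<open>F\<close>. Each mean is at most \<open>sqrt m\<close>.\<close>

lemma X_abs_moments:
  assumes "v \<in> I"
  shows "integrable M (\<lambda>w. \<bar>X v w\<bar> ^ 3 + \<bar>X v w\<bar>)" "expectation (\<lambda>w. \<bar>X v w\<bar> ^ 3 + \<bar>X v w\<bar>) \<le> 2 * sqrt m"
proof -
  have i: "integrable M (\<lambda>w. \<bar>X v w\<bar> ^ 3)" "integrable M (\<lambda>w. \<bar>X v w\<bar>)"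
    using abs_cube_integrable[OF X_measurable fourth] X_integrable assms by auto
  then show "integrable M (\<lambda>w. \<bar>X v w\<bar> ^ 3 + \<bar>X v w\<bar>)" by simp
  have "expectation (\<lambda>w. \<bar>X v w\<bar> ^ 3) \<le> sqrt m"
    using expectation_abs_cube_le[OF X_measurable fourth, OF assms assms] unit_variance[OF assms] fourth_le[OF assms]
    by (simp add: order_trans)
  moreover have "expectation (\<lambda>w. \<bar>X v w\<bar>) \<le> sqrt m"
    using expectation_abs_le_sqrt[OF X_square_integrable[OF assms]] real_sqrt_ge_one[OF m_ge_1]
    unfolding unit_variance[OF assms] real_sqrt_one by linarith
  ultimately show "expectation (\<lambda>w. \<bar>X v w\<bar> ^ 3 + \<bar>X v w\<bar>) \<le> 2 * sqrt m" using i by simp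
qed

text \<open>Expand D1 at W k, which is independent of X k and differs from F by X k A k.\<close>

lemma integration_by_parts:
  assumes g: "C2_bounded g D1 D2 K"
    and lip: "\<And>i j y v. \<bar>D2 i j (y + v) - D2 i j y\<bar> \<le> l1norm v * T"
  shows "\<bar>(\<Sum>i\<in>UNIV. expectation (\<lambda>w. F (x w) $ i * D1 i (F (x w))))
      - (\<Sum>i\<in>UNIV. \<Sum>j\<in>UNIV. expectation (\<lambda>w. \<Gamma> i j (x w) * D2 i j (F (x w))))\<bar>
    \<le> T * sqrt m * (\<Sum>k\<in>I. expectation (\<lambda>w. l1norm (A k (x w)) ^ 3))"
proof -
  interpret C2_bounded g D1 D2 K by fact
  note dmeas = measurable_derivs
  \<comment> \<open>Testing \<open>lip\<close> on a unit vector forces this sign.\<close>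
  have T0: "0 \<le> T"
  proof -
    have "l1norm (axis undefined 1 :: real^'d) > 0"
      using l1norm_component[of "axis undefined 1 :: real^'d" undefined] by (simp add: axis_def)
    moreover have "0 \<le> l1norm (axis undefined 1 :: real^'d) * T"
      using lip[of undefined undefined 0 "axis undefined 1"] by linarith
    ultimately show ?thesis by (simp add: zero_le_mult_iff)
  qed
  note D1sq = gradient_square_integrable[OF prob_space_axioms]
  have AAi: "integrable M (\<lambda>w. A k (x w) $ i * A k (x w) $ j)" for i j k
    by (rule square_integrable_mult_integrable[OF A_square_integrable A_square_integrable])
  have bdd: "integrable M (\<lambda>w. f w * D2 i j (Z w))"
    if f: "integrable M f" and [measurable]: "Z \<in> borel_measurable M" for f Z i j
  proof (rule Bochner_Integration.integrable_bound)
    show "integrable M (\<lambda>w. K * f w)" using f by simp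
    show "AE w in M. norm (f w * D2 i j (Z w)) \<le> norm (K * f w)"
      using mult_right_mono[OF bound abs_ge_zero] K_nonneg by (simp add: abs_mult mult.commute)
  qed (use f in measurable)
  let ?L = "\<lambda>k. \<Sum>i\<in>UNIV. expectation (\<lambda>w. X k w * A k (x w) $ i * D1 i (F (x w)))"
  let ?R = "\<lambda>k. \<Sum>i\<in>UNIV. \<Sum>j\<in>UNIV. expectation (\<lambda>w. A k (x w) $ i * A k (x w) $ j * D2 i j (F (x w)))"
  have summand: "\<bar>?L k - ?R k\<bar>
       \<le> 2 * (T * sqrt m * expectation (\<lambda>w. l1norm (A k (x w)) ^ 3))"
    and summandi: "integrable M (\<lambda>w. X k w * A k (x w) $ i * D1 i (F (x w)))"
    if k: "k \<in> I" for k i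
  proof -
    let ?DW = "\<lambda>i j w. A k (x w) $ i * A k (x w) $ j * D2 i j (W k (x w))"
    let ?DF = "\<lambda>i j w. A k (x w) $ i * A k (x w) $ j * D2 i j (F (x w))"
    let ?XF = "\<lambda>i w. X k w * A k (x w) $ i * D1 i (F (x w))"
    let ?XW = "\<lambda>i w. X k w * (A k (x w) $ i * D1 i (W k (x w)))"
    have kJ: "k \<notin> I - {k}" "I - {k} \<subseteq> I" by auto
    note [measurable] = A_functional_measurable[OF k] W_functional_measurable[of k] X_measurable[OF k]
    have XA: "square_integrable M (\<lambda>w. X k w * A k (x w) $ i)" for i
      by (rule square_integrable_mult[OF _ _ fourth[OF k] A_fourth_integrable]) measurable
    have DF: "square_integrable M (\<lambda>w. D1 i (F (x w)))" for i by (rule D1sq[OF F_measurable F_square_integrable])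
    have DW: "square_integrable M (\<lambda>w. D1 i (W k (x w)))" for i by (rule D1sq[OF W_measurable W_square_integrable])
    have i1: "integrable M (\<lambda>w. ?XF i w)" for i
      by (rule square_integrable_mult_integrable[OF XA DF])
    show "integrable M (\<lambda>w. ?XF i w)" by (rule i1)
    \<comment> \<open>\<open>X k\<close> is centered and independent of the factor built from
      \<open>A k\<close> and \<open>W k\<close>, so this term may be subtracted for free.\<close>
    have zi: "integrable M (\<lambda>w. ?XW i w)"
      "expectation (\<lambda>w. ?XW i w) = 0" for i
      using indep_split[OF k kJ, of "\<lambda>x. x" "\<lambda>p. A k p $ i * D1 i (W k p)"] A_dep[OF k] W_dep
        X_integrable[OF k] mean[OF k] square_integrable_mult_integrable[OF A_square_integrable[of k i] DW[of i]]
      by auto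
    have AW: "integrable M (\<lambda>w. ?DW i j w)" for i j
      by (rule bdd[OF AAi]) measurable
    have AF: "integrable M (\<lambda>w. ?DF i j w)" for i j
      by (rule bdd[OF AAi]) measurable
    \<comment> \<open>By unit variance and independence, inserting \<open>(X k)\<^sup>2\<close>
      leaves the expectation unchanged; it produces the first-order Taylor term of
      \<open>D1\<close>.\<close>
    have sq: "integrable M (\<lambda>w. (X k w)\<^sup>2 * (?DW i j w))"
      "expectation (\<lambda>w. (X k w)\<^sup>2 * (?DW i j w))
        = expectation (\<lambda>w. ?DW i j w)" for i j
      using indep_split[OF k kJ, of "\<lambda>x. x\<^sup>2" "\<lambda>p. A k p $ i * A k p $ j * D2 i j (W k p)"] A_dep[OF k] W_dep
        X_power_integrable[OF k, of 2] unit_variance[OF k] AW[of i j]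
      by auto
    \<comment> \<open>A pointwise remainder with expectation \<open>?L k - ?R k\<close>: the
      auxiliary terms at \<open>W k\<close> have mean zero or cancel each other.\<close>
    define R where "R w = (\<Sum>i\<in>UNIV. ?XF i w - ?XW i w)
        - (\<Sum>i\<in>UNIV. \<Sum>j\<in>UNIV. (X k w)\<^sup>2 * (?DW i j w))
        + (\<Sum>i\<in>UNIV. \<Sum>j\<in>UNIV. ?DW i j w - ?DF i j w)" for w
    have Ri: "integrable M R" and ER: "expectation R = ?L k - ?R k"
    proof -
      show "integrable M R" unfolding R_def
        by (intro Bochner_Integration.integrable_add Bochner_Integration.integrable_diff Bochner_Integration.integrable_sum i1 zi sq AW AF)
      show "expectation R = ?L k - ?R k"
        unfolding R_def by (simp add: i1 zi sq AW AF sum_subtractf)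
    qed
    have Rb: "\<bar>R w\<bar> \<le> T * ((\<bar>X k w\<bar> ^ 3 + \<bar>X k w\<bar>) * l1norm (A k (x w)) ^ 3)" for w
    proof -
      let ?X = "X k w" and ?A = "A k (x w)" and ?W = "W k (x w)" and ?F = "F (x w)"
      let ?l = "l1norm ?A"
      have F: "?F = ?W + ?X *\<^sub>R ?A" using F_split[OF k, of "x w"] .
      have l0: "?l \<ge> 0" by (rule l1norm_nonneg)
      have D: "\<bar>D2 i j (?W + z *\<^sub>R ?X *\<^sub>R ?A) - D2 i j ?W\<bar> \<le> \<bar>?X\<bar> * ?l * T" if "0 \<le> z" "z \<le> 1" for z i j
      proof -
        have "\<bar>D2 i j (?W + z *\<^sub>R ?X *\<^sub>R ?A) - D2 i j ?W\<bar> \<le> l1norm (z *\<^sub>R ?X *\<^sub>R ?A) * T" by (rule lip)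
        also have "\<dots> = z * (\<bar>?X\<bar> * ?l) * T"
          using that by (simp add: l1norm_scale abs_mult mult.assoc del: scaleR_scaleR)
        also have "\<dots> \<le> \<bar>?X\<bar> * ?l * T"
          using that l0 T0 by (intro mult_right_mono mult_left_le_one_le) auto
        finally show ?thesis .
      qed
      have e1: "\<bar>D1 i ?F - D1 i ?W - ?X * (\<Sum>j\<in>UNIV. ?A $ j * D2 i j ?W)\<bar> \<le> \<bar>?X\<bar> * (?l * (\<bar>?X\<bar> * ?l * T))" for i
      proof -
        obtain z where z: "0 < z" "z < 1" "D1 i (?W + ?X *\<^sub>R ?A) - D1 i ?W = (\<Sum>j\<in>UNIV. (?X *\<^sub>R ?A) $ j * D2 i j (?W + z *\<^sub>R ?X *\<^sub>R ?A))"
          using has_partials.mean_value[OF C2_bounded.second[OF g]] by blast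
        have "D1 i ?F - D1 i ?W - ?X * (\<Sum>j\<in>UNIV. ?A $ j * D2 i j ?W)
           = ?X * (\<Sum>j\<in>UNIV. ?A $ j * (D2 i j (?W + z *\<^sub>R ?X *\<^sub>R ?A) - D2 i j ?W))"
          unfolding F z(3) by (simp add: sum_distrib_left sum_subtractf right_diff_distrib mult_ac)
        also have "\<bar>\<dots>\<bar> \<le> \<bar>?X\<bar> * (?l * (\<bar>?X\<bar> * ?l * T))"
          unfolding abs_mult[of ?X] using z(1,2) by (intro mult_left_mono abs_weighted_sum_le D) auto
        finally show ?thesis .
      qed
      have e2: "\<bar>\<Sum>j\<in>UNIV. ?A $ j * (D2 i j ?W - D2 i j ?F)\<bar> \<le> ?l * (\<bar>?X\<bar> * ?l * T)" for i
        by (rule abs_weighted_sum_le) (use D[of 1] in \<open>simp add: F abs_minus_commute\<close>)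
      \<comment> \<open>Regrouped as \<open>X k * A k\<close> times the first-order Taylor remainder
        of \<open>D1\<close> at \<open>W k\<close>, plus the change of \<open>D2\<close> between
        \<open>W k\<close> and \<open>F\<close>.\<close>
      have R_eq: "R w = ?X * (\<Sum>i\<in>UNIV. ?A $ i * (D1 i ?F - D1 i ?W - ?X * (\<Sum>j\<in>UNIV. ?A $ j * D2 i j ?W)))
          + (\<Sum>i\<in>UNIV. ?A $ i * (\<Sum>j\<in>UNIV. ?A $ j * (D2 i j ?W - D2 i j ?F)))"
        unfolding R_def by (simp add: sum_distrib_left sum_subtractf sum.distrib right_diff_distrib power2_eq_square mult_ac)
      have "\<bar>R w\<bar> \<le> \<bar>?X\<bar> * (?l * (\<bar>?X\<bar> * (?l * (\<bar>?X\<bar> * ?l * T)))) + ?l * (?l * (\<bar>?X\<bar> * ?l * T))"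
        unfolding R_eq
        by (rule order_trans[OF abs_triangle_ineq add_mono[OF
              order_trans[OF eq_refl[OF abs_mult] mult_left_mono[OF abs_weighted_sum_le[OF e1] abs_ge_zero]]
              abs_weighted_sum_le[OF e2]]])
      also have "\<dots> = T * ((\<bar>?X\<bar> ^ 3 + \<bar>?X\<bar>) * ?l ^ 3)"
        by algebra
      finally show ?thesis .
    qed
    have Bi: "integrable M (\<lambda>w. (\<bar>X k w\<bar> ^ 3 + \<bar>X k w\<bar>) * l1norm (A k (x w)) ^ 3)"
     and EB: "expectation (\<lambda>w. (\<bar>X k w\<bar> ^ 3 + \<bar>X k w\<bar>) * l1norm (A k (x w)) ^ 3)
        = expectation (\<lambda>w. \<bar>X k w\<bar> ^ 3 + \<bar>X k w\<bar>) * expectation (\<lambda>w. l1norm (A k (x w)) ^ 3)"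
      using indep_split[OF k kJ, of "\<lambda>x. \<bar>x\<bar> ^ 3 + \<bar>x\<bar>" "\<lambda>p. l1norm (A k p) ^ 3"] A_dep[OF k]
        X_abs_moments(1)[OF k] A_cube_integrable[of k] by auto
    have "\<bar>expectation R\<bar> \<le> expectation (\<lambda>w. \<bar>R w\<bar>)" by (rule integral_abs_bound)
    also have "\<dots> \<le> expectation (\<lambda>w. T * ((\<bar>X k w\<bar> ^ 3 + \<bar>X k w\<bar>) * l1norm (A k (x w)) ^ 3))"
      by (rule integral_mono) (use Ri Bi Rb in auto)
    also have "\<dots> = T * (expectation (\<lambda>w. \<bar>X k w\<bar> ^ 3 + \<bar>X k w\<bar>) * expectation (\<lambda>w. l1norm (A k (x w)) ^ 3))"
      by (simp only: integral_mult_right_zero EB)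
    also have "\<dots> \<le> T * (2 * sqrt m * expectation (\<lambda>w. l1norm (A k (x w)) ^ 3))"
      by (intro mult_left_mono mult_right_mono X_abs_moments(2)[OF k] T0 Bochner_Integration.integral_nonneg zero_le_power l1norm_nonneg)
    finally show "\<bar>?L k - ?R k\<bar>
       \<le> 2 * (T * sqrt m * expectation (\<lambda>w. l1norm (A k (x w)) ^ 3))"
      unfolding ER by (simp add: mult_ac)
  qed
  have AFi: "integrable M (\<lambda>w. A k (x w) $ i * A k (x w) $ j * D2 i j (F (x w)))" for i j k
    by (rule bdd[OF AAi F_measurable])
  have L: "expectation (\<lambda>w. F (x w) $ i * D1 i (F (x w))) = (\<Sum>k\<in>I. expectation (\<lambda>w. X k w * A k (x w) $ i * D1 i (F (x w)))) / 2" for i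
  proof -
    have eq: "F (x w) $ i * D1 i (F (x w)) = (\<Sum>k\<in>I. X k w * A k (x w) $ i * D1 i (F (x w))) / 2" for w
      by (subst (1) F_def) (simp add: sum_distrib_right)
    show ?thesis unfolding eq by (simp add: summandi)
  qed
  have R: "expectation (\<lambda>w. \<Gamma> i j (x w) * D2 i j (F (x w))) = (\<Sum>k\<in>I. expectation (\<lambda>w. A k (x w) $ i * A k (x w) $ j * D2 i j (F (x w)))) / 2" for i j
    by (simp add: \<Gamma>_def sum_distrib_right AFi)
  let ?t = "\<lambda>k. ?L k - ?R k"
  have total: "(\<Sum>i\<in>UNIV. expectation (\<lambda>w. F (x w) $ i * D1 i (F (x w))))
      - (\<Sum>i\<in>UNIV. \<Sum>j\<in>UNIV. expectation (\<lambda>w. \<Gamma> i j (x w) * D2 i j (F (x w)))) = (\<Sum>k\<in>I. ?t k) / 2"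
  proof -
    have s1: "(\<Sum>i\<in>UNIV. \<Sum>k\<in>I. f i k) = (\<Sum>k\<in>I. \<Sum>i\<in>UNIV. f i k)" for f :: "'d \<Rightarrow> nat \<Rightarrow> real" by (rule sum.swap)
    show ?thesis unfolding L R by (simp add: s1 sum_subtractf diff_divide_distrib flip: sum_divide_distrib)
  qed
  \<comment> \<open>The 1/2 common to \<open>F\<close> and \<Gamma> cancels the 2 of
    \<open>summand\<close>.\<close>
  have "\<bar>(\<Sum>k\<in>I. ?t k) / 2\<bar> \<le> (\<Sum>k\<in>I. \<bar>?t k\<bar>) / 2" using sum_abs[of ?t I] by simp
  also have "\<dots> \<le> (\<Sum>k\<in>I. 2 * (T * sqrt m * expectation (\<lambda>w. l1norm (A k (x w)) ^ 3))) / 2"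
    by (intro divide_right_mono sum_mono summand) auto
  also have "\<dots> = T * sqrt m * (\<Sum>k\<in>I. expectation (\<lambda>w. l1norm (A k (x w)) ^ 3))"
    by (simp only: sum_distrib_left[symmetric])
  finally show ?thesis unfolding total .
qed

lemma \<Gamma>_commute: "\<Gamma> i j p = \<Gamma> j i p"
  by (simp add: \<Gamma>_def mult.commute)

text \<open>For a quadratic test function the remainder in \<open>integration_by_parts\<close> vanishes.\<close>

lemma F_second_moment:
  "expectation (\<lambda>w. F (x w) $ i * F (x w) $ j) = expectation (\<lambda>w. \<Gamma> i j (x w))"
proof -
  \<comment> \<open>Derivatives of \<open>y $ i * y $ j\<close>. For \<open>i = j\<close> both
    conditionals fire and produce the factor 2. \<open>D2\<close> is constant, so 0 is a Lipschitz
    constant; the resulting identity is twice the claim.\<close>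
  define D1 where "D1 l y = (if l = i then y $ j else 0) + (if l = j then y $ i else 0)" for l and y :: "real^'d"
  define D2 where "D2 l q y = (if l = i then if q = j then 1 else 0 else 0) + (if l = j then if q = i then 1 else 0 else (0::real))"
    for l q and y :: "real^'d"
  have C2: "C2_bounded (\<lambda>y :: real^'d. y $ i * y $ j) D1 D2 2"
  proof
    fix y :: "real^'d"
    have "((\<lambda>y :: real^'d. y $ i * y $ j) has_derivative (\<lambda>h. y $ i * h $ j + h $ i * y $ j)) (at y)"
      by (intro has_derivative_mult bounded_linear_imp_has_derivative bounded_linear_vec_nth)
    moreover have "(\<Sum>l\<in>UNIV. h $ l * D1 l y) = y $ i * h $ j + h $ i * y $ j" for h
      by (simp add: D1_def distrib_left sum.distrib mult_delta_right)
    ultimately show "((\<lambda>y. y $ i * y $ j) has_derivative (\<lambda>h. \<Sum>l\<in>UNIV. h $ l * D1 l y)) (at y)" by simp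
    fix l
    have eq: "(\<Sum>q\<in>UNIV. h $ q * D2 l q y) = (if l = i then h $ j else 0) + (if l = j then h $ i else 0)" for h
      by (cases "l = i"; cases "l = j") (simp_all add: D2_def distrib_left sum.distrib mult_delta_right)
    have lin: "((\<lambda>y. if b then y $ k else 0) has_derivative (\<lambda>h. if b then h $ k else 0)) (at y)" for b k
      by (cases b) (auto intro: bounded_linear_imp_has_derivative bounded_linear_vec_nth)
    show "(D1 l has_derivative (\<lambda>h. \<Sum>q\<in>UNIV. h $ q * D2 l q y)) (at y)"
      unfolding eq D1_def by (intro has_derivative_add lin)
  qed (auto simp: D2_def)
  have "\<bar>(\<Sum>l\<in>UNIV. expectation (\<lambda>w. F (x w) $ l * D1 l (F (x w))))
      - (\<Sum>l\<in>UNIV. \<Sum>q\<in>UNIV. expectation (\<lambda>w. \<Gamma> l q (x w) * D2 l q (F (x w))))\<bar> \<le> 0"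
    using integration_by_parts[OF C2, of 0] by (simp add: D2_def)
  then have main: "(\<Sum>l\<in>UNIV. expectation (\<lambda>w. F (x w) $ l * D1 l (F (x w))))
      = (\<Sum>l\<in>UNIV. \<Sum>q\<in>UNIV. expectation (\<lambda>w. \<Gamma> l q (x w) * D2 l q (F (x w))))" by simp
  have FF: "integrable M (\<lambda>w. F (x w) $ i * F (x w) $ j)" for i j
    by (rule square_integrable_mult_integrable[OF F_square_integrable F_square_integrable])
  have l: "expectation (\<lambda>w. F (x w) $ l * D1 l (F (x w))) =
      (if l = i then expectation (\<lambda>w. F (x w) $ i * F (x w) $ j) else 0)
      + (if l = j then expectation (\<lambda>w. F (x w) $ i * F (x w) $ j) else 0)" for l
    using FF by (simp add: D1_def distrib_left mult.commute)
  have r: "expectation (\<lambda>w. \<Gamma> l q (x w) * D2 l q (F (x w))) =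
      (if l = i then if q = j then expectation (\<lambda>w. \<Gamma> i j (x w)) else 0 else 0)
      + (if l = j then if q = i then expectation (\<lambda>w. \<Gamma> i j (x w)) else 0 else 0)" for l q
    using \<Gamma>_integrable by (simp add: D2_def distrib_left \<Gamma>_commute[of j i])
  have "(\<Sum>q\<in>UNIV. if b then if q = k then c else 0 else 0) = (if b then c else (0::real))" for b c and k :: 'd
    by (cases b) auto
  then show ?thesis using main unfolding l r by (simp add: sum.distrib)
qed

end

section \<open>Interpolation\<close>

context quadratic_forms
begin

definition "third = (\<Sum>k\<in>I. expectation (\<lambda>w. l1norm (A k (x w)) ^ 3))"

lemma integration_by_parts_affine:
  assumes g: "C2_bounded g D1 D2 K"
    and lip: "\<And>i j y v. \<bar>D2 i j (y + v) - D2 i j y\<bar> \<le> l1norm v * T"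
    and s: "s > 0"
  shows "\<bar>(\<Sum>i\<in>UNIV. expectation (\<lambda>w. F (x w) $ i * D1 i (y + s *\<^sub>R F (x w))))
      - s * (\<Sum>i\<in>UNIV. \<Sum>j\<in>UNIV. expectation (\<lambda>w. \<Gamma> i j (x w) * D2 i j (y + s *\<^sub>R F (x w))))\<bar>
    \<le> s\<^sup>2 * (T * sqrt m * third)"
proof -
  let ?p = "\<Sum>i\<in>UNIV. expectation (\<lambda>w. F (x w) $ i * D1 i (y + s *\<^sub>R F (x w)))"
  let ?q = "\<Sum>i\<in>UNIV. \<Sum>j\<in>UNIV. expectation (\<lambda>w. \<Gamma> i j (x w) * D2 i j (y + s *\<^sub>R F (x w)))"
  note C2 = C2_bounded.affine_C2[OF g, of y s]
  have lip': "\<bar>s * (s * D2 i j (y + s *\<^sub>R (z + v))) - s * (s * D2 i j (y + s *\<^sub>R z))\<bar> \<le> l1norm v * (s ^ 3 * T)" for i j z v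
  proof -
    have "s * (s * D2 i j (y + s *\<^sub>R (z + v))) - s * (s * D2 i j (y + s *\<^sub>R z))
       = s\<^sup>2 * (D2 i j ((y + s *\<^sub>R z) + s *\<^sub>R v) - D2 i j (y + s *\<^sub>R z))"
      by (simp add: power2_eq_square algebra_simps)
    also have "\<bar>\<dots>\<bar> = s\<^sup>2 * \<bar>D2 i j ((y + s *\<^sub>R z) + s *\<^sub>R v) - D2 i j (y + s *\<^sub>R z)\<bar>"
      by (simp add: abs_mult)
    also have "\<dots> \<le> s\<^sup>2 * (l1norm (s *\<^sub>R v) * T)" by (intro mult_left_mono lip) simp
    also have "\<dots> = l1norm v * (s ^ 3 * T)"
      using s by (simp add: l1norm_scale power2_eq_square power3_eq_cube)
    finally show ?thesis .
  qed
  have "\<bar>s * ?p - s * (s * ?q)\<bar> \<le> s ^ 3 * T * sqrt m * third"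
    using integration_by_parts[OF C2 lip'] by (simp add: third_def sum_distrib_left mult.left_commute mult.assoc)
  then have "s * \<bar>?p - s * ?q\<bar> \<le> s * (s\<^sup>2 * (T * sqrt m * third))"
    using s by (simp add: abs_mult power3_eq_cube power2_eq_square mult_ac flip: right_diff_distrib)
  then show ?thesis using s by simp
qed

text \<open>One argument is frozen at a time: \<open>stein_identity\<close> acts on \<open>Y\<close>
  with \<open>F\<close> fixed, \<open>integration_by_parts_affine\<close> on \<open>F\<close> with
  \<open>Y\<close> fixed, and Fubini's theorem joins the fibers.\<close>

theorem smooth_test_bound:
  fixes N :: "'b measure"
  assumes gauss: "centered_gaussian N Y C" and g: "C2_bounded g D1 D2 K"
    and lip: "\<And>i j y v. \<bar>D2 i j (y + v) - D2 i j y\<bar> \<le> l1norm v * T"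
  shows "\<bar>expectation (\<lambda>w. g (F (x w))) - (\<integral>w. g (Y w) \<partial>N)\<bar> \<le>
    K / 2 * (\<Sum>i\<in>UNIV. \<Sum>j\<in>UNIV. expectation (\<lambda>w. \<bar>\<Gamma> i j (x w) - C $ i $ j\<bar>)) + T * sqrt m * third / 3"
proof -
  interpret g: C2_bounded g D1 D2 K by fact
  interpret Y: centered_gaussian N Y C by fact
  interpret MN: pair_prob_space M N ..
  let ?P = "M \<Otimes>\<^sub>M N"
  note [measurable] = g.measurable_derivs
  have PM: "prob_space M" and PN: "prob_space N" and P: "prob_space ?P" by unfold_locales
  define U V where "U z = F (x (fst z))" and "V z = Y (snd z)" for z :: "'a \<times> 'b"
  have [measurable]: "U \<in> borel_measurable ?P" "V \<in> borel_measurable ?P" unfolding U_def V_def by measurable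
  have U2: "square_integrable ?P (\<lambda>z. U z $ i)" for i
    unfolding square_integrable_def using pair_lift_fst(1)[OF PM PN] F_square_integrable[of i]
    by (auto simp: U_def square_integrable_def)
  have V2: "square_integrable ?P (\<lambda>z. V z $ i)" for i
    unfolding square_integrable_def using pair_lift_snd(1)[OF PM PN] Y.Y_square_integrable[of i]
    by (auto simp: V_def square_integrable_def)
  define Z where "Z r z = sin r *\<^sub>R U z + cos r *\<^sub>R V z" for r z
  have [measurable]: "Z r \<in> borel_measurable ?P" for r unfolding Z_def by measurable
  have Z2: "square_integrable ?P (\<lambda>z. Z r z $ j)" for r j
    unfolding Z_def by (simp, intro square_integrable_add square_integrable_cmult U2 V2)
  define \<phi> where "\<phi> r = (\<integral>z. g (Z r z) \<partial>?P)" for r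
  define \<phi>' where "\<phi>' r = (\<integral>z. (\<Sum>i\<in>UNIV. (cos r *\<^sub>R U z + (- sin r) *\<^sub>R V z) $ i * D1 i (Z r z)) \<partial>?P)" for r
  have d\<phi>: "(\<phi> has_real_derivative \<phi>' r) (at r)" for r
    unfolding \<phi>_def \<phi>'_def Z_def by (rule g.rotation_has_derivative(2)[OF P _ _ U2 V2]) measurable
  define \<Delta> where "\<Delta> = (\<Sum>i\<in>UNIV. \<Sum>j\<in>UNIV. expectation (\<lambda>w. \<bar>\<Gamma> i j (x w) - C $ i $ j\<bar>))"
  have UD: "integrable ?P (\<lambda>z. U z $ i * D1 i (Z r z))" and VD: "integrable ?P (\<lambda>z. V z $ i * D1 i (Z r z))" for i r
    by (intro square_integrable_mult_integrable U2 V2 g.gradient_square_integrable[OF P] Z2; measurable)+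
  have \<Gamma>P: "integrable ?P (\<lambda>z. \<Gamma> i j (x (fst z)))" for i j
    by (rule pair_lift_fst(1)[OF PM PN \<Gamma>_integrable])
  have bdd: "integrable ?P (\<lambda>z. f z * D2 i j (Z r z))" if f: "integrable ?P f" for f i j r
  proof (rule Bochner_Integration.integrable_bound)
    show "integrable ?P (\<lambda>z. K * f z)" using f by simp
    show "AE z in ?P. norm (f z * D2 i j (Z r z)) \<le> norm (K * f z)"
      using mult_right_mono[OF g.bound abs_ge_zero] g.K_nonneg by (simp add: abs_mult mult.commute)
  qed (use f in measurable)
  have \<Gamma>D: "integrable ?P (\<lambda>z. \<Gamma> i j (x (fst z)) * D2 i j (Z r z))" for i j r
    by (rule bdd[OF \<Gamma>P])
  have D2i: "integrable ?P (\<lambda>z. D2 i j (Z r z))" for i j r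
    using bdd[of "\<lambda>_. 1" i j r] MN.P.integrable_const by simp
  have V_part: "(\<Sum>i\<in>UNIV. \<integral>z. V z $ i * D1 i (Z r z) \<partial>?P) = cos r * (\<Sum>i\<in>UNIV. \<Sum>j\<in>UNIV. C $ i $ j * (\<integral>z. D2 i j (Z r z) \<partial>?P))"
    if r: "cos r > 0" for r
  proof -
    let ?z = "\<lambda>w y. sin r *\<^sub>R F (x w) + cos r *\<^sub>R Y y"
    \<comment> \<open>Stein's identity on the fiber has \<open>cos r\<close> on the left and its
      square on the right; positivity lets one factor cancel.\<close>
    have fib: "(\<integral>y. (\<Sum>i\<in>UNIV. Y y $ i * D1 i (?z w y)) \<partial>N)
       = cos r * (\<Sum>i\<in>UNIV. \<Sum>j\<in>UNIV. C $ i $ j * (\<integral>y. D2 i j (?z w y) \<partial>N))" for w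
    proof -
      have "cos r * (\<integral>y. (\<Sum>i\<in>UNIV. Y y $ i * D1 i (?z w y)) \<partial>N)
       = cos r * (cos r * (\<Sum>i\<in>UNIV. \<Sum>j\<in>UNIV. C $ i $ j * (\<integral>y. D2 i j (?z w y) \<partial>N)))"
        using Y.stein_identity[OF g.affine_C2[of "sin r *\<^sub>R F (x w)" "cos r"]]
        by (simp add: mult.left_commute flip: sum_distrib_left)
      then show ?thesis using r by simp
    qed
    have iV: "integrable ?P (\<lambda>z. \<Sum>i\<in>UNIV. V z $ i * D1 i (Z r z))" using VD by simp
    have "(\<Sum>i\<in>UNIV. \<integral>z. V z $ i * D1 i (Z r z) \<partial>?P) = (\<integral>z. (\<Sum>i\<in>UNIV. V z $ i * D1 i (Z r z)) \<partial>?P)"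
      using VD by simp
    also have "\<dots> = expectation (\<lambda>w. \<integral>y. (\<Sum>i\<in>UNIV. Y y $ i * D1 i (?z w y)) \<partial>N)"
      using MN.integral_fst'[OF iV] by (simp add: U_def V_def Z_def)
    also have "\<dots> = expectation (\<lambda>w. cos r * (\<Sum>i\<in>UNIV. \<Sum>j\<in>UNIV. C $ i $ j * (\<integral>y. D2 i j (?z w y) \<partial>N)))"
      by (simp only: fib)
    also have "\<dots> = cos r * (\<Sum>i\<in>UNIV. \<Sum>j\<in>UNIV. C $ i $ j * expectation (\<lambda>w. \<integral>y. D2 i j (?z w y) \<partial>N))"
      using MN.integrable_fst'[OF D2i] by (simp add: U_def V_def Z_def)
    also have "\<dots> = cos r * (\<Sum>i\<in>UNIV. \<Sum>j\<in>UNIV. C $ i $ j * (\<integral>z. D2 i j (Z r z) \<partial>?P))"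
      using MN.integral_fst'[OF D2i] by (simp add: U_def V_def Z_def)
    finally show ?thesis .
  qed
  have U_part: "\<bar>(\<Sum>i\<in>UNIV. \<integral>z. U z $ i * D1 i (Z r z) \<partial>?P) - sin r * (\<Sum>i\<in>UNIV. \<Sum>j\<in>UNIV. \<integral>z. \<Gamma> i j (x (fst z)) * D2 i j (Z r z) \<partial>?P)\<bar>
       \<le> (sin r)\<^sup>2 * (T * sqrt m * third)" if r: "sin r > 0" for r
  proof -
    let ?z = "\<lambda>w y. cos r *\<^sub>R Y y + sin r *\<^sub>R F (x w)"
    define R where "R z = (\<Sum>i\<in>UNIV. U z $ i * D1 i (Z r z)) - sin r * (\<Sum>i\<in>UNIV. \<Sum>j\<in>UNIV. \<Gamma> i j (x (fst z)) * D2 i j (Z r z))" for z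
    have Ri: "integrable ?P R" unfolding R_def using UD \<Gamma>D by simp
    have RI: "(\<integral>z. R z \<partial>?P) = (\<Sum>i\<in>UNIV. \<integral>z. U z $ i * D1 i (Z r z) \<partial>?P) - sin r * (\<Sum>i\<in>UNIV. \<Sum>j\<in>UNIV. \<integral>z. \<Gamma> i j (x (fst z)) * D2 i j (Z r z) \<partial>?P)"
      unfolding R_def using UD \<Gamma>D by simp
    have Ri': "integrable ?P (case_prod (\<lambda>w y. R (w, y)))" using Ri by simp
    have fib: "\<bar>\<integral>w. R (w, y) \<partial>M\<bar> \<le> (sin r)\<^sup>2 * (T * sqrt m * third)" for y
    proof -
      have D1s: "square_integrable M (\<lambda>w. D1 i (?z w y))" for i
      proof (rule g.gradient_square_integrable[OF PM])
        show "square_integrable M (\<lambda>w. (?z w y) $ j)" for j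
          using square_integrable_add[OF square_integrable_const square_integrable_cmult[OF F_square_integrable]] by simp
      qed measurable
      have i1: "integrable M (\<lambda>w. F (x w) $ i * D1 i (?z w y))" for i
        by (rule square_integrable_mult_integrable[OF F_square_integrable D1s])
      have i2: "integrable M (\<lambda>w. \<Gamma> i j (x w) * D2 i j (?z w y))" for i j
      proof (rule Bochner_Integration.integrable_bound)
        show "integrable M (\<lambda>w. K * \<Gamma> i j (x w))" using \<Gamma>_integrable by simp
        show "AE w in M. norm (\<Gamma> i j (x w) * D2 i j (?z w y)) \<le> norm (K * \<Gamma> i j (x w))"
          using mult_right_mono[OF g.bound abs_ge_zero] g.K_nonneg by (simp add: abs_mult mult.commute)
      qed (use \<Gamma>_integrable in measurable)
      have Rfib: "R (w, y) = (\<Sum>i\<in>UNIV. F (x w) $ i * D1 i (?z w y))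
          - sin r * (\<Sum>i\<in>UNIV. \<Sum>j\<in>UNIV. \<Gamma> i j (x w) * D2 i j (?z w y))" for w
        by (simp add: R_def U_def V_def Z_def add.commute)
      have "(\<integral>w. R (w, y) \<partial>M) = (\<Sum>i\<in>UNIV. expectation (\<lambda>w. F (x w) $ i * D1 i (?z w y)))
         - sin r * (\<Sum>i\<in>UNIV. \<Sum>j\<in>UNIV. expectation (\<lambda>w. \<Gamma> i j (x w) * D2 i j (?z w y)))"
        unfolding Rfib using i1 i2 by simp
      then show ?thesis using integration_by_parts_affine[OF g lip r, of "cos r *\<^sub>R Y y"] by simp
    qed
    have "(\<integral>z. R z \<partial>?P) = (\<integral>y. (\<integral>w. R (w, y) \<partial>M) \<partial>N)"
      using MN.integral_snd[OF Ri'] by simp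
    also have "\<bar>\<dots>\<bar> \<le> (\<integral>y. (sin r)\<^sup>2 * (T * sqrt m * third) \<partial>N)"
    proof (rule order_trans[OF integral_abs_bound integral_mono])
      show "integrable N (\<lambda>y. \<bar>\<integral>w. R (w, y) \<partial>M\<bar>)" using MN.integrable_snd[OF Ri'] by simp
    qed (use fib in auto)
    also have "\<dots> = (sin r)\<^sup>2 * (T * sqrt m * third)" by (simp add: Y.prob_space)
    finally show ?thesis unfolding RI .
  qed
  have bound: "\<bar>\<phi>' r\<bar> \<le> sin r * cos r * (K * \<Delta>) + (sin r)\<^sup>2 * cos r * (T * sqrt m * third)" if r: "0 < r" "r < pi / 2" for r
  proof -
    have s: "sin r > 0" and c: "cos r > 0" using r by (auto intro!: sin_gt_zero cos_gt_zero)
    let ?u = "\<Sum>i\<in>UNIV. \<integral>z. U z $ i * D1 i (Z r z) \<partial>?P" and ?v = "\<Sum>i\<in>UNIV. \<integral>z. V z $ i * D1 i (Z r z) \<partial>?P"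
    let ?G = "\<Sum>i\<in>UNIV. \<Sum>j\<in>UNIV. \<integral>z. \<Gamma> i j (x (fst z)) * D2 i j (Z r z) \<partial>?P"
    let ?C = "\<Sum>i\<in>UNIV. \<Sum>j\<in>UNIV. C $ i $ j * (\<integral>z. D2 i j (Z r z) \<partial>?P)"
    have "\<phi>' r = cos r * ?u - sin r * ?v"
      unfolding \<phi>'_def using UD VD
      by (simp add: left_diff_distrib mult.assoc sum_subtractf flip: sum_distrib_left)
    \<comment> \<open>Adding and subtracting the \<Gamma>-term separates the third-order error from
      the mismatch between \<Gamma> and \<open>C\<close>.\<close>
    then have eq: "\<phi>' r = cos r * (?u - sin r * ?G) + sin r * cos r * (?G - ?C)"
      unfolding V_part[OF c] by (simp add: algebra_simps)
    have "\<bar>?G - ?C\<bar> \<le> K * \<Delta>"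
    proof -
      have "?G - ?C = (\<Sum>i\<in>UNIV. \<Sum>j\<in>UNIV. \<integral>z. (\<Gamma> i j (x (fst z)) - C $ i $ j) * D2 i j (Z r z) \<partial>?P)"
        using \<Gamma>D D2i by (simp add: left_diff_distrib sum_subtractf)
      also have "\<bar>\<dots>\<bar> \<le> (\<Sum>i\<in>UNIV. \<Sum>j\<in>UNIV. \<bar>\<integral>z. (\<Gamma> i j (x (fst z)) - C $ i $ j) * D2 i j (Z r z) \<partial>?P\<bar>)"
        by (intro order_trans[OF sum_abs] sum_mono sum_abs)
      also have "\<dots> \<le> (\<Sum>i\<in>UNIV. \<Sum>j\<in>UNIV. K * expectation (\<lambda>w. \<bar>\<Gamma> i j (x w) - C $ i $ j\<bar>))"
      proof (intro sum_mono)
        fix i j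
        have Gi: "integrable M (\<lambda>w. K * \<bar>\<Gamma> i j (x w) - C $ i $ j\<bar>)" using \<Gamma>_integrable by simp
        have iP: "integrable ?P (\<lambda>z. (\<Gamma> i j (x (fst z)) - C $ i $ j) * D2 i j (Z r z))"
          using \<Gamma>P MN.P.integrable_const by (intro bdd) auto
        have "\<bar>\<integral>z. (\<Gamma> i j (x (fst z)) - C $ i $ j) * D2 i j (Z r z) \<partial>?P\<bar> \<le> (\<integral>z. \<bar>(\<Gamma> i j (x (fst z)) - C $ i $ j) * D2 i j (Z r z)\<bar> \<partial>?P)"
          by (rule integral_abs_bound)
        also have "\<dots> \<le> (\<integral>z. K * \<bar>\<Gamma> i j (x (fst z)) - C $ i $ j\<bar> \<partial>?P)"
        proof (rule integral_mono)
          show "integrable ?P (\<lambda>z. K * \<bar>\<Gamma> i j (x (fst z)) - C $ i $ j\<bar>)" by (rule pair_lift_fst(1)[OF PM PN Gi])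
          show "\<bar>(\<Gamma> i j (x (fst z)) - C $ i $ j) * D2 i j (Z r z)\<bar> \<le> K * \<bar>\<Gamma> i j (x (fst z)) - C $ i $ j\<bar>" for z
            unfolding abs_mult by (subst mult.commute) (rule mult_right_mono[OF g.bound abs_ge_zero])
        qed (use iP in auto)
        also have "\<dots> = expectation (\<lambda>w. K * \<bar>\<Gamma> i j (x w) - C $ i $ j\<bar>)"
          by (rule pair_lift_fst(2)[OF PM PN Gi])
        finally show "\<bar>\<integral>z. (\<Gamma> i j (x (fst z)) - C $ i $ j) * D2 i j (Z r z) \<partial>?P\<bar> \<le> K * expectation (\<lambda>w. \<bar>\<Gamma> i j (x w) - C $ i $ j\<bar>)"
          by simp
      qed
      finally show ?thesis by (simp add: \<Delta>_def sum_distrib_left)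
    qed
    then have "sin r * cos r * \<bar>?G - ?C\<bar> \<le> sin r * cos r * (K * \<Delta>)" using s c by (intro mult_left_mono) auto
    moreover have "cos r * \<bar>?u - sin r * ?G\<bar> \<le> cos r * ((sin r)\<^sup>2 * (T * sqrt m * third))"
      using c by (intro mult_left_mono U_part[OF s]) auto
    moreover have "\<bar>\<phi>' r\<bar> \<le> cos r * \<bar>?u - sin r * ?G\<bar> + sin r * cos r * \<bar>?G - ?C\<bar>"
    proof -
      have "\<bar>cos r * p + sin r * cos r * q\<bar> \<le> cos r * \<bar>p\<bar> + sin r * cos r * \<bar>q\<bar>" for p q
        using abs_triangle_ineq[of "cos r * p" "sin r * cos r * q"] s c by (simp add: abs_mult)
      then show ?thesis unfolding eq by blast
    qed
    ultimately show ?thesis by (simp add: mult_ac)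
  qed
  \<comment> \<open>An antiderivative of the bound on \<phi>', so that its increment over the
    quarter turn is the final estimate.\<close>
  define \<psi> where "\<psi> r = (sin r)\<^sup>2 / 2 * (K * \<Delta>) + (sin r) ^ 3 / 3 * (T * sqrt m * third)" for r :: real
  have d\<psi>: "(\<psi> has_real_derivative sin r * cos r * (K * \<Delta>) + (sin r)\<^sup>2 * cos r * (T * sqrt m * third)) (at r)" for r
    unfolding \<psi>_def by (auto intro!: derivative_eq_intros simp: power2_eq_square)
  \<comment> \<open>Instead of integrating \<phi>', the mean value theorem is applied to \<psi> -
    \<phi> and \<psi> + \<phi>, whose derivatives are nonnegative in the open interval.\<close>
  have "\<bar>\<phi> (pi/2) - \<phi> 0\<bar> \<le> \<psi> (pi/2) - \<psi> 0"
  proof -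
    have pi2: "0 < pi / 2" by simp
    obtain r where r: "0 < r" "r < pi / 2" "(\<psi> (pi/2) - \<phi> (pi/2)) - (\<psi> 0 - \<phi> 0) =
        (pi / 2 - 0) * ((sin r * cos r * (K * \<Delta>) + (sin r)\<^sup>2 * cos r * (T * sqrt m * third)) - \<phi>' r)"
      using MVT2[OF pi2 DERIV_diff[OF d\<psi> d\<phi>]] by blast
    have "0 \<le> (\<psi> (pi/2) - \<phi> (pi/2)) - (\<psi> 0 - \<phi> 0)"
      unfolding r(3) using bound[OF r(1,2)] pi2 by (intro mult_nonneg_nonneg) linarith+
    moreover obtain r where r: "0 < r" "r < pi / 2" "(\<psi> (pi/2) + \<phi> (pi/2)) - (\<psi> 0 + \<phi> 0) =
        (pi / 2 - 0) * ((sin r * cos r * (K * \<Delta>) + (sin r)\<^sup>2 * cos r * (T * sqrt m * third)) + \<phi>' r)"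
      using MVT2[OF pi2 DERIV_add[OF d\<psi> d\<phi>]] by blast
    have "0 \<le> (\<psi> (pi/2) + \<phi> (pi/2)) - (\<psi> 0 + \<phi> 0)"
      unfolding r(3) using bound[OF r(1,2)] pi2 by (intro mult_nonneg_nonneg) linarith+
    ultimately show ?thesis by linarith
  qed
  moreover have "\<phi> (pi/2) = expectation (\<lambda>w. g (F (x w)))"
  proof -
    have i: "integrable ?P (\<lambda>z. g (Z (pi/2) z))"
      unfolding Z_def by (rule g.rotation_has_derivative(1)[OF P _ _ U2 V2]) measurable
    show ?thesis using MN.integral_fst'[OF i] by (simp add: \<phi>_def Z_def U_def Y.prob_space)
  qed
  moreover have "\<phi> 0 = (\<integral>w. g (Y w) \<partial>N)"
  proof -
    have i: "integrable ?P (\<lambda>z. g (Z 0 z))"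
      unfolding Z_def by (rule g.rotation_has_derivative(1)[OF P _ _ U2 V2]) measurable
    show ?thesis using MN.integral_fst'[OF i] by (simp add: \<phi>_def Z_def V_def prob_space)
  qed
  ultimately show ?thesis by (simp add: \<psi>_def \<Delta>_def)
qed

end

section \<open>Weak convergence from smooth test functions\<close>

text \<open>Boundedness of the function and of all derivatives up to order \<open>k\<close> makes
  products stay in the class, so it is an algebra to which Stone-Weierstrass applies.\<close>

fun bounded_smooth :: "nat \<Rightarrow> (real^'d::finite \<Rightarrow> real) \<Rightarrow> bool" where
  "bounded_smooth 0 f \<longleftrightarrow> continuous_on UNIV f \<and> bounded (range f)"
| "bounded_smooth (Suc k) f \<longleftrightarrow> continuous_on UNIV f \<and> bounded (range f) \<and>
     (\<forall>i. has_partial_deriv i f \<and> bounded_smooth k (partial_deriv i f))"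

lemma bounded_smooth_cont: "bounded_smooth k f \<Longrightarrow> continuous_on UNIV f"
  and bounded_smooth_bounded: "bounded_smooth k f \<Longrightarrow> bounded (range f)"
  by (cases k; simp)+

lemma bounded_smooth_Suc_imp: "bounded_smooth (Suc k) f \<Longrightarrow> bounded_smooth k f"
  by (induction k arbitrary: f) (auto intro: bounded_smooth_cont bounded_smooth_bounded)

lemma bounded_smooth_times_cont_diff: "bounded_smooth k f \<Longrightarrow> times_cont_diff k f"
  by (induction k arbitrary: f) auto

lemma partial_derivI:
  assumes "\<And>x. ((\<lambda>t. f (x + t *\<^sub>R axis i 1)) has_real_derivative D x) (at 0)"
  shows "has_partial_deriv i f \<and> partial_deriv i f = D"
  using assms DERIV_imp_deriv[OF assms]
  by (auto simp: has_partial_deriv_def partial_deriv_def field_differentiable_def fun_eq_iff)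

lemma has_partial_deriv_at:
  "has_partial_deriv i f \<Longrightarrow> ((\<lambda>t. f (x + t *\<^sub>R axis i 1)) has_real_derivative partial_deriv i f x) (at 0)"
  using has_partial_deriv_line[of i f x 0] by simp

lemma bounded_smooth_const: "bounded_smooth k (\<lambda>x. c)"
proof (induction k arbitrary: c)
  case (Suc k)
  have "has_partial_deriv i (\<lambda>x. c) \<and> partial_deriv i (\<lambda>x. c) = (\<lambda>x. 0)" for i :: 'a
    by (rule partial_derivI) simp
  then show ?case using Suc[of 0] by auto
qed auto

lemma bounded_range_mult:
  fixes f g :: "'a \<Rightarrow> real"
  assumes "bounded (range f)" "bounded (range g)"
  shows "bounded (range (\<lambda>x. f x * g x))"
proof -
  obtain a b where "\<And>x. \<bar>f x\<bar> \<le> a" "\<And>x. \<bar>g x\<bar> \<le> b"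
    using assms by (auto simp: bounded_iff)
  then have "\<bar>f x * g x\<bar> \<le> a * b" for x
    unfolding abs_mult by (intro mult_mono) (auto intro: order_trans[OF abs_ge_zero])
  then show ?thesis by (auto simp: bounded_iff)
qed

lemma bounded_smooth_add:
  "bounded_smooth k f \<Longrightarrow> bounded_smooth k g \<Longrightarrow> bounded_smooth k (\<lambda>x. f x + g x)"
proof (induction k arbitrary: f g)
  case 0 then show ?case by (auto intro: continuous_on_add bounded_plus_comp)
next
  case (Suc k)
  have "has_partial_deriv i (\<lambda>x. f x + g x) \<and> partial_deriv i (\<lambda>x. f x + g x) = (\<lambda>x. partial_deriv i f x + partial_deriv i g x)" for i
    using Suc.prems by (intro partial_derivI DERIV_add has_partial_deriv_at) auto
  then show ?case using Suc by (auto intro: continuous_on_add bounded_plus_comp)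
qed

lemma bounded_smooth_mult:
  "bounded_smooth k f \<Longrightarrow> bounded_smooth k g \<Longrightarrow> bounded_smooth k (\<lambda>x. f x * g x)"
proof (induction k arbitrary: f g)
  case 0 then show ?case by (auto intro: continuous_on_mult bounded_range_mult)
next
  case (Suc k)
  have "has_partial_deriv i (\<lambda>x. f x * g x) \<and> partial_deriv i (\<lambda>x. f x * g x) = (\<lambda>x. partial_deriv i f x * g x + partial_deriv i g x * f x)" for i
  proof (rule partial_derivI)
    fix x
    have "has_partial_deriv i f" "has_partial_deriv i g" using Suc.prems by auto
    from DERIV_mult[OF this[THEN has_partial_deriv_at, of x]]
    show "((\<lambda>t. f (x + t *\<^sub>R axis i 1) * g (x + t *\<^sub>R axis i 1)) has_real_derivative
       partial_deriv i f x * g x + partial_deriv i g x * f x) (at 0)" by simp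
  qed
  moreover have "bounded_smooth k f" "bounded_smooth k g"
    using Suc.prems bounded_smooth_Suc_imp by blast+
  ultimately show ?case
    using Suc.prems by (auto intro!: continuous_on_mult bounded_range_mult bounded_smooth_add Suc.IH)
qed

lemma bounded_smooth_sin_cos:
  "bounded_smooth k f \<Longrightarrow> bounded_smooth k (\<lambda>x. sin (f x)) \<and> bounded_smooth k (\<lambda>x. cos (f x))"
proof (induction k arbitrary: f)
  case 0
  then show ?case
    by (auto intro!: continuous_intros simp: bounded_iff intro: exI[of _ 1] abs_sin_le_one abs_cos_le_one)
next
  case (Suc k)
  have p: "has_partial_deriv i f" for i using Suc.prems by auto
  have s: "has_partial_deriv i (\<lambda>x. sin (f x)) \<and> partial_deriv i (\<lambda>x. sin (f x)) = (\<lambda>x. cos (f x) * partial_deriv i f x)" for i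
    using DERIV_fun_sin[OF has_partial_deriv_at[OF p[of i]]] by (intro partial_derivI) simp
  have c: "has_partial_deriv i (\<lambda>x. cos (f x)) \<and> partial_deriv i (\<lambda>x. cos (f x)) = (\<lambda>x. (-1) * (sin (f x) * partial_deriv i f x))" for i
    using DERIV_fun_cos[OF has_partial_deriv_at[OF p[of i]]] by (intro partial_derivI) simp
  have "bounded_smooth k f" using Suc.prems bounded_smooth_Suc_imp by blast
  from Suc.IH[OF this] have "bounded_smooth k (\<lambda>x. cos (f x) * partial_deriv i f x)"
    and m: "bounded_smooth k (\<lambda>x. sin (f x) * partial_deriv i f x)" for i
    using Suc.prems by (auto intro!: bounded_smooth_mult)
  moreover have "bounded_smooth k (\<lambda>x. (-1) * (sin (f x) * partial_deriv i f x))" for i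
    by (rule bounded_smooth_mult[OF bounded_smooth_const m])
  moreover have "bounded (range (\<lambda>x. sin (f x)))" "bounded (range (\<lambda>x. cos (f x)))"
    by (auto simp: bounded_iff intro!: exI[of _ 1])
  moreover have "continuous_on UNIV (\<lambda>x. sin (f x))" "continuous_on UNIV (\<lambda>x. cos (f x))"
    using Suc.prems by (auto intro!: continuous_intros)
  ultimately show ?case using s c by (simp del: mult_minus_left mult_minus1)
qed

text \<open>Differentiation shifts the phase by \<open>pi / 2\<close>, so a free phase
  \<open>b\<close> closes the induction within sines. These functions will separate points.\<close>

lemma bounded_smooth_sin_coordinate: "bounded_smooth k (\<lambda>x. sin (c * x $ i + b))"
proof (induction k arbitrary: b)
  case 0
  then show ?case by (auto intro!: continuous_intros simp: bounded_iff intro!: exI[of _ 1])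
next
  case (Suc k)
  have "has_partial_deriv j (\<lambda>x. sin (c * x $ i + b)) \<and> partial_deriv j (\<lambda>x. sin (c * x $ i + b))
     = (\<lambda>x. (if j = i then c else 0) * sin (c * x $ i + (b + pi / 2)))" for j
  proof (rule partial_derivI)
    fix x :: "real^'a"
    have "((\<lambda>t. c * (x $ i + t * (if i = j then 1 else 0)) + b) has_real_derivative (if j = i then c else 0)) (at 0)"
      by (auto intro!: derivative_eq_intros)
    from DERIV_fun_sin[OF this]
    show "((\<lambda>t. sin (c * (x + t *\<^sub>R axis j 1) $ i + b)) has_real_derivative (if j = i then c else 0) * sin (c * x $ i + (b + pi / 2))) (at 0)"
      by (simp add: axis_def sin_add[of _ "pi/2"] mult.commute flip: add.assoc)
  qed
  then show ?case
    using Suc.IH by (auto intro!: continuous_intros bounded_smooth_mult bounded_smooth_const simp: bounded_iff intro!: exI[of _ 1])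
qed

text \<open>Stone--Weierstrass is applied to arcsin \<open>\<circ>\<close> h, so that composing the approximant with sin
  keeps it bounded by 1 off the ball as well.\<close>

lemma bounded_smooth_approximation:
  fixes h :: "real^'d::finite \<Rightarrow> real"
  assumes h: "continuous_on UNIV h" and b: "\<And>x. \<bar>h x\<bar> \<le> B" and B: "B > 0" and e: "e > 0"
  shows "\<exists>p. bounded_smooth k p \<and> (\<forall>x. \<bar>p x\<bar> \<le> B) \<and> (\<forall>x\<in>cball 0 r. \<bar>h x - p x\<bar> \<le> B * e)"
proof -
  interpret function_ring_on "{f. bounded_smooth k f}" "cball (0 :: real^'d) r"
  proof
    show "compact (cball (0 :: real^'d) r)" by (rule compact_cball)
    show "continuous_on (cball 0 r) f" if "f \<in> {f. bounded_smooth k f}" for f :: "real^'d \<Rightarrow> real"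
      using that bounded_smooth_cont continuous_on_subset by blast
    fix x y :: "real^'d" assume "x \<noteq> y"
    then obtain i where i: "x $ i \<noteq> y $ i" by (auto simp: vec_eq_iff)
    \<comment> \<open>Scaled so that \<open>c * x $ i\<close> and \<open>c * y $ i\<close> stay in
      the interval where \<open>sin\<close> is injective; the 1 avoids a zero denominator.\<close>
    define c where "c = pi / 2 / (\<bar>x $ i\<bar> + \<bar>y $ i\<bar> + 1)"
    have c: "c > 0" by (simp add: c_def)
    have "\<bar>c * z\<bar> \<le> pi / 2" if "\<bar>z\<bar> \<le> \<bar>x $ i\<bar> + \<bar>y $ i\<bar> + 1" for z
    proof -
      have "\<bar>c * z\<bar> \<le> c * (\<bar>x $ i\<bar> + \<bar>y $ i\<bar> + 1)"
        using c that by (simp add: abs_mult)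
      also have "\<dots> = pi / 2"
      proof -
        have cancel: "a / b * b = a" if "b \<noteq> 0" for a b :: real using that by simp
        show ?thesis unfolding c_def by (rule cancel) linarith
      qed
      finally show ?thesis .
    qed
    then have "\<bar>c * x $ i\<bar> \<le> pi / 2" "\<bar>c * y $ i\<bar> \<le> pi / 2" by auto
    then have "- (pi / 2) \<le> c * x $ i" "c * x $ i \<le> pi / 2" "- (pi / 2) \<le> c * y $ i" "c * y $ i \<le> pi / 2"
      by linarith+
    from sin_inj_pi[OF this] have "sin (c * x $ i) \<noteq> sin (c * y $ i)"
      using i c by auto
    then show "\<exists>f\<in>{f. bounded_smooth k f}. f x \<noteq> f y"
      using bounded_smooth_sin_coordinate[of k c i 0] by (intro bexI[of _ "\<lambda>x. sin (c * x $ i)"]) auto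
  qed (auto intro: bounded_smooth_add bounded_smooth_mult bounded_smooth_const)
  have hb: "-1 \<le> h x / B" "h x / B \<le> 1" for x
    using b[of x] B by (auto simp: field_simps abs_le_iff)
  have "continuous_on (cball 0 r) (\<lambda>x. arcsin (h x / B))"
    using B hb by (intro continuous_on_arcsin continuous_on_divide continuous_on_subset[OF h] continuous_on_const) auto
  from Stone_Weierstrass_basic[OF this e]
  obtain q where q: "bounded_smooth k q" "\<And>x. x \<in> cball 0 r \<Longrightarrow> \<bar>arcsin (h x / B) - q x\<bar> < e" by auto
  define p where "p x = B * sin (q x)" for x
  have "bounded_smooth k p"
    unfolding p_def using bounded_smooth_sin_cos[OF q(1)] by (intro bounded_smooth_mult bounded_smooth_const) auto
  moreover have "\<bar>p x\<bar> \<le> B" for x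
    using B mult_left_mono[OF abs_sin_le_one[of "q x"], of B] by (simp add: p_def abs_mult)
  moreover have "\<bar>h x - p x\<bar> \<le> B * e" if "x \<in> cball 0 r" for x
  proof -
    \<comment> \<open>As \<open>sin\<close> is 1-Lipschitz, the error made for the arcsine passes to
      \<open>p\<close> with factor \<open>B\<close>.\<close>
    have lip: "\<bar>sin s - sin t\<bar> \<le> \<bar>s - t\<bar>" for s t :: real
      using field_differentiable_bound[of UNIV sin cos 1 s t]
      by (auto simp: DERIV_sin has_field_derivative_at_within abs_minus_commute)
    have "h x = B * sin (arcsin (h x / B))" using B hb[of x] by (simp add: sin_arcsin)
    then have "\<bar>h x - p x\<bar> = B * \<bar>sin (arcsin (h x / B)) - sin (q x)\<bar>"
      using B by (metis abs_mult abs_of_pos p_def right_diff_distrib)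
    also have "\<dots> \<le> B * e"
      using order_trans[OF lip less_imp_le[OF q(2)[OF that]]] B by (intro mult_left_mono) auto
    finally show ?thesis .
  qed
  ultimately show ?thesis by blast
qed

text \<open>Inside a ball \<open>p\<close> approximates \<open>h\<close> uniformly. Outside,
  \<open>1 \<le> (norm x)\<^sup>2 / r\<^sup>2\<close>, so the crude bound \<open>2 * B\<close> on
  the difference is paid for by the second moment; this replaces a separate tightness
  argument.\<close>

theorem converges_in_distribution_bounded_smooth:
  fixes X :: "nat \<Rightarrow> 'a \<Rightarrow> real^'d::finite" and Y :: "'b \<Rightarrow> real^'d"
  assumes M: "prob_space M" and N: "prob_space N"
    and [measurable]: "\<And>n. X n \<in> borel_measurable M" "Y \<in> borel_measurable N"
    and X2: "\<And>n. integrable M (\<lambda>w. (norm (X n w))\<^sup>2)" "\<And>n. (\<integral>w. (norm (X n w))\<^sup>2 \<partial>M) \<le> L"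
    and Y2: "integrable N (\<lambda>w. (norm (Y w))\<^sup>2)" "(\<integral>w. (norm (Y w))\<^sup>2 \<partial>N) \<le> L"
    and lim: "\<And>g. bounded_smooth k g \<Longrightarrow> (\<lambda>n. \<integral>w. g (X n w) \<partial>M) \<longlonglongrightarrow> (\<integral>w. g (Y w) \<partial>N)"
  shows "converges_in_distribution M X N Y"
  unfolding converges_in_distribution_def
proof (intro allI impI)
  fix h :: "real^'d \<Rightarrow> real" assume h: "continuous_on UNIV h \<and> bounded (range h)"
  then obtain B where B: "B > 0" "\<And>x. \<bar>h x\<bar> \<le> B"
    by (auto simp: bounded_pos)
  have [measurable]: "h \<in> borel_measurable borel" using h by (intro borel_measurable_continuous_onI) auto
  have L0: "0 \<le> L" by (rule order_trans[OF _ Y2(2)]) (intro Bochner_Integration.integral_nonneg, simp)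
  show "(\<lambda>n. \<integral>w. h (X n w) \<partial>M) \<longlonglongrightarrow> (\<integral>w. h (Y w) \<partial>N)"
  proof (rule LIMSEQ_I)
    fix e :: real assume e: "e > 0"
    \<comment> \<open>Chosen so that \<open>B * e1\<close> and
      \<open>2 * B / r\<^sup>2 * (L + 1)\<close> are both \<open>e / 8\<close>; each replacement of
      \<open>h\<close> by \<open>p\<close> then costs \<open>e / 4\<close>. \<open>L + 1\<close>
      keeps \<open>r\<close> positive when \<open>L = 0\<close>.\<close>
    define e1 r where "e1 = e / (8 * B)" and "r = sqrt (16 * B * (L + 1) / e)"
    have e1: "e1 > 0" and r: "r > 0" "r\<^sup>2 = 16 * B * (L + 1) / e"
      using e B L0 by (auto simp: e1_def r_def)
    obtain p where p: "bounded_smooth k p" "\<And>x. \<bar>p x\<bar> \<le> B" "\<And>x. x \<in> cball 0 r \<Longrightarrow> \<bar>h x - p x\<bar> \<le> B * e1"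
      using bounded_smooth_approximation[of h B e1 k r] h B e1 by blast
    have [measurable]: "p \<in> borel_measurable borel"
      using bounded_smooth_cont[OF p(1)] by (rule borel_measurable_continuous_onI)
    have pt: "\<bar>h x - p x\<bar> \<le> B * e1 + 2 * B / r\<^sup>2 * (norm x)\<^sup>2" for x
    proof (cases "x \<in> cball 0 r")
      case True
      have "0 \<le> 2 * B / r\<^sup>2 * (norm x)\<^sup>2" using B by simp
      then show ?thesis using p(3)[OF True] by linarith
    next
      case False
      then have "r\<^sup>2 \<le> (norm x)\<^sup>2" using r by (intro power_mono) auto
      then have "2 * B * 1 \<le> 2 * B * ((norm x)\<^sup>2 / r\<^sup>2)" using B r(1) by (intro mult_left_mono) auto
      moreover have "\<bar>h x - p x\<bar> \<le> 2 * B" using B(2)[of x] p(2)[of x] by linarith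
      moreover have "0 \<le> B * e1" using B e1 by simp
      ultimately show ?thesis by simp
    qed
    have small: "\<bar>(\<integral>w. h (Z w) \<partial>Q) - (\<integral>w. p (Z w) \<partial>Q)\<bar> \<le> e / 4"
      if Q: "prob_space Q" and [measurable]: "Z \<in> borel_measurable Q"
        and Z2: "integrable Q (\<lambda>w. (norm (Z w))\<^sup>2)" "(\<integral>w. (norm (Z w))\<^sup>2 \<partial>Q) \<le> L" for Q :: "'c measure" and Z
    proof -
      interpret Q: prob_space Q by fact
      have i: "integrable Q (\<lambda>w. h (Z w))" "integrable Q (\<lambda>w. p (Z w))"
        by (rule Q.integrable_const_bound[where B=B]; use B p in simp)+
      have "\<bar>(\<integral>w. h (Z w) \<partial>Q) - (\<integral>w. p (Z w) \<partial>Q)\<bar> = \<bar>\<integral>w. h (Z w) - p (Z w) \<partial>Q\<bar>" using i by simp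
      also have "\<dots> \<le> (\<integral>w. \<bar>h (Z w) - p (Z w)\<bar> \<partial>Q)" by (rule integral_abs_bound)
      also have "\<dots> \<le> (\<integral>w. B * e1 + 2 * B / r\<^sup>2 * (norm (Z w))\<^sup>2 \<partial>Q)"
        by (rule integral_mono) (use i Z2(1) pt in auto)
      also have "\<dots> = B * e1 + 2 * B / r\<^sup>2 * (\<integral>w. (norm (Z w))\<^sup>2 \<partial>Q)" using Z2(1) by (simp add: Q.prob_space)
      also have "\<dots> \<le> B * e1 + 2 * B / r\<^sup>2 * (L + 1)"
        using Z2(2) B by (intro add_left_mono mult_left_mono) auto
      also have "\<dots> = e / 4"
      proof -
        obtain t where t: "L + 1 = t" "t > 0" using L0 by auto
        have "2 * B / r\<^sup>2 * (L + 1) = e / 8" using t(2) B e unfolding r(2) t(1) by (simp add: field_simps)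
        moreover have "B * e1 = e / 8" using B by (simp add: e1_def)
        ultimately show ?thesis by simp
      qed
      finally show ?thesis .
    qed
    obtain n0 where n0: "\<And>n. n \<ge> n0 \<Longrightarrow> \<bar>(\<integral>w. p (X n w) \<partial>M) - (\<integral>w. p (Y w) \<partial>N)\<bar> < e / 4"
      using LIMSEQ_D[OF lim[OF p(1)], of "e/4"] e by auto
    have "norm ((\<integral>w. h (X n w) \<partial>M) - (\<integral>w. h (Y w) \<partial>N)) < e" if "n \<ge> n0" for n
      using small[OF M assms(3) X2(1)[of n] X2(2)[of n]] small[OF N assms(4) Y2] n0[OF that] e
      unfolding real_norm_def by linarith
    then show "\<exists>no. \<forall>n\<ge>no. norm ((\<integral>w. h (X n w) \<partial>M) - (\<integral>w. h (Y w) \<partial>N)) < e" by blast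
  qed
qed

section \<open>The quantitative bound\<close>

lemma times_cont_diff_C2_bounded:
  fixes g :: "real^'d::finite \<Rightarrow> real"
  assumes g: "times_cont_diff 3 g"
    and K: "\<And>i j x. \<bar>partial_deriv j (partial_deriv i g) x\<bar> \<le> K"
  shows "C2_bounded g (\<lambda>i. partial_deriv i g) (\<lambda>i j. partial_deriv j (partial_deriv i g)) K"
proof (intro C2_bounded.intro C2_bounded_axioms.intro)
  have g': "times_cont_diff (Suc (Suc (Suc 0))) g" using g by (simp add: numeral_3_eq_3)
  show "has_partials g (\<lambda>i. partial_deriv i g)"
    using g' by (intro has_partials.intro continuous_partials_has_derivative) auto
  show "has_partials (partial_deriv i g) (\<lambda>j. partial_deriv j (partial_deriv i g))" for i
    using g' by (intro has_partials.intro continuous_partials_has_derivative) auto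
  show "continuous_on UNIV (partial_deriv j (partial_deriv i g))" for i j using g' by auto
qed (rule K)

lemma times_cont_diff_second_lipschitz:
  fixes g :: "real^'d::finite \<Rightarrow> real"
  assumes g: "times_cont_diff 3 g"
    and T: "\<And>i j k x. \<bar>partial_deriv k (partial_deriv j (partial_deriv i g)) x\<bar> \<le> T"
  shows "\<bar>partial_deriv j (partial_deriv i g) (y + v) - partial_deriv j (partial_deriv i g) y\<bar> \<le> l1norm v * T"
proof (rule has_partials.lipschitz[OF _ T])
  have g': "times_cont_diff (Suc (Suc (Suc 0))) g" using g by (simp add: numeral_3_eq_3)
  show "has_partials (partial_deriv j (partial_deriv i g)) (\<lambda>k. partial_deriv k (partial_deriv j (partial_deriv i g)))"
    using g' by (intro has_partials.intro continuous_partials_has_derivative) auto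
qed

context quadratic_forms
begin

text \<open>\<open>K / 4\<close> is the 1/2 of \<open>smooth_test_bound\<close> times the 1/2 of
  \<open>\<Gamma>_deviation\<close>. \<open>sqrt 3 / 3 * m\<close> collects \<open>sqrt m\<close>
  from the moments of \<open>X k\<close>, \<open>sqrt 3 * sqrt m\<close> from
  \<open>A_cube_bound\<close> and the 1/3 of the interpolation. \<open>V\<close> bounds the
  variances of the squares.\<close>

theorem quantitative_bound:
  fixes N :: "'b measure"
  assumes gauss: "centered_gaussian N Y C" and g: "times_cont_diff 3 g"
    and K: "\<And>i j x. \<bar>partial_deriv j (partial_deriv i g) x\<bar> \<le> K"
    and T: "\<And>i j k x. \<bar>partial_deriv k (partial_deriv j (partial_deriv i g)) x\<bar> \<le> T"
    and V: "2 \<le> V" "\<And>v. v \<in> I \<Longrightarrow> expectation (\<lambda>w. X v w ^ 4) - 1 \<le> V"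
  shows "\<bar>expectation (\<lambda>w. g (F (x w))) - (\<integral>w. g (Y w) \<partial>N)\<bar> \<le>
      K / 2 * (\<Sum>i\<in>UNIV. \<Sum>j\<in>UNIV. \<bar>C $ i $ j - expectation (\<lambda>w. F (x w) $ i * F (x w) $ j)\<bar>)
    + K / 4 * (\<Sum>i\<in>UNIV. \<Sum>j\<in>UNIV. sqrt (V * (\<Sum>u\<in>I. \<Sum>v\<in>I. (\<Sum>k\<in>I. a i k u * a j k v)\<^sup>2)))
    + sqrt 3 / 3 * m * T * (real CARD('d))\<^sup>2 * (\<Sum>i\<in>UNIV. \<Sum>k\<in>I. (\<Sum>u\<in>I. (a i k u)\<^sup>2) powr (3/2))"
proof -
  note C2 = times_cont_diff_C2_bounded[OF g K] and lip = times_cont_diff_second_lipschitz[OF g T]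
  have K0: "0 \<le> K" using K[of undefined undefined 0] by linarith
  have T0: "0 \<le> T" using T[of undefined undefined undefined 0] by linarith
  let ?c = "\<lambda>i j. \<bar>C $ i $ j - expectation (\<lambda>w. F (x w) $ i * F (x w) $ j)\<bar>"
  let ?s = "\<lambda>i j. sqrt (V * (\<Sum>u\<in>I. \<Sum>v\<in>I. (\<Sum>k\<in>I. a i k u * a j k v)\<^sup>2))"
  have "(\<Sum>i\<in>UNIV. \<Sum>j\<in>UNIV. expectation (\<lambda>w. \<bar>\<Gamma> i j (x w) - C $ i $ j\<bar>)) \<le> (\<Sum>i\<in>UNIV. \<Sum>j\<in>UNIV. ?c i j + ?s i j / 2)"
  proof (intro sum_mono)
    fix i j
    let ?e = "expectation (\<lambda>w. \<Gamma> i j (x w))"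
    \<comment> \<open>Triangle inequality through the mean of \<Gamma>, which
      \<open>F_second_moment\<close> identifies with the mixed second moment of
      \<open>F\<close>.\<close>
    have "expectation (\<lambda>w. \<bar>\<Gamma> i j (x w) - C $ i $ j\<bar>) \<le> expectation (\<lambda>w. \<bar>\<Gamma> i j (x w) - ?e\<bar> + \<bar>C $ i $ j - ?e\<bar>)"
      using \<Gamma>_integrable by (intro integral_mono) auto
    also have "\<dots> = expectation (\<lambda>w. \<bar>\<Gamma> i j (x w) - ?e\<bar>) + \<bar>C $ i $ j - ?e\<bar>"
      using \<Gamma>_integrable by (simp add: prob_space)
    also have "\<dots> \<le> ?s i j / 2 + ?c i j"
      using \<Gamma>_deviation[OF V, of i j] unfolding F_second_moment by simp
    finally show "expectation (\<lambda>w. \<bar>\<Gamma> i j (x w) - C $ i $ j\<bar>) \<le> ?c i j + ?s i j / 2" by simp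
  qed
  also have "\<dots> = (\<Sum>i\<in>UNIV. \<Sum>j\<in>UNIV. ?c i j) + (\<Sum>i\<in>UNIV. \<Sum>j\<in>UNIV. ?s i j) / 2"
    by (simp add: sum.distrib sum_divide_distrib)
  finally have D: "K / 2 * (\<Sum>i\<in>UNIV. \<Sum>j\<in>UNIV. expectation (\<lambda>w. \<bar>\<Gamma> i j (x w) - C $ i $ j\<bar>))
     \<le> K / 2 * ((\<Sum>i\<in>UNIV. \<Sum>j\<in>UNIV. ?c i j) + (\<Sum>i\<in>UNIV. \<Sum>j\<in>UNIV. ?s i j) / 2)"
    using K0 by (intro mult_left_mono) auto
  let ?p = "\<lambda>i k. (\<Sum>u\<in>I. (a i k u)\<^sup>2) powr (3/2)"
  have "third \<le> (\<Sum>k\<in>I. (real CARD('d))\<^sup>2 * (sqrt 3 * sqrt m * (\<Sum>i\<in>UNIV. ?p i k)))"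
    unfolding third_def by (intro sum_mono A_cube_bound)
  also have "\<dots> = (real CARD('d))\<^sup>2 * (sqrt 3 * sqrt m * (\<Sum>k\<in>I. \<Sum>i\<in>UNIV. ?p i k))"
    by (simp only: sum_distrib_left)
  also have "(\<Sum>k\<in>I. \<Sum>i\<in>UNIV. ?p i k) = (\<Sum>i\<in>UNIV. \<Sum>k\<in>I. ?p i k)" by (rule sum.swap)
  finally have "T * sqrt m * third \<le> T * sqrt m * ((real CARD('d))\<^sup>2 * (sqrt 3 * sqrt m * (\<Sum>i\<in>UNIV. \<Sum>k\<in>I. ?p i k)))"
    using T0 m_ge_1 by (intro mult_left_mono) auto
  also have "\<dots> = (sqrt m * sqrt m) * (sqrt 3 * T * (real CARD('d))\<^sup>2 * (\<Sum>i\<in>UNIV. \<Sum>k\<in>I. ?p i k))"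
    by (simp only: mult_ac)
  also have "sqrt m * sqrt m = m" using m_ge_1 by simp
  finally have "T * sqrt m * third / 3 \<le> sqrt 3 / 3 * m * T * (real CARD('d))\<^sup>2 * (\<Sum>i\<in>UNIV. \<Sum>k\<in>I. ?p i k)"
    by (simp add: mult_ac)
  with smooth_test_bound[OF gauss C2 lip] D show ?thesis
    by (simp add: distrib_left)
qed

lemma sum_norm_F: "expectation (\<lambda>w. (norm (F (x w)))\<^sup>2) = (\<Sum>i\<in>UNIV. expectation (\<lambda>w. F (x w) $ i * F (x w) $ i))"
  "integrable M (\<lambda>w. (norm (F (x w)))\<^sup>2)"
  using square_integrable_mult_integrable[OF F_square_integrable F_square_integrable]
  by (simp_all add: power2_norm_eq_inner inner_vec_def)

end

section \<open>Sums over ordered pairs, derivative bounds and the final assembly\<close>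

lemma symmetric_double_sum:
  fixes f :: "nat \<Rightarrow> nat \<Rightarrow> real"
  assumes "\<And>u v. u \<in> {1..n} \<Longrightarrow> v \<in> {1..n} \<Longrightarrow> f u v = f v u" "\<And>u. u \<in> {1..n} \<Longrightarrow> f u u = 0"
  shows "(\<Sum>u=1..n. \<Sum>v=1..n. f u v) = 2 * (\<Sum>u=1..n. \<Sum>v=u..n. f u v)"
  using assms
proof (induction n)
  case (Suc n)
  have "(\<Sum>v=1..n. f (Suc n) v) = (\<Sum>u=1..n. f u (Suc n))"
    by (intro sum.cong Suc.prems) auto
  moreover have "f (Suc n) (Suc n) = 0" by (rule Suc.prems) simp
  moreover have "(\<Sum>u=1..n. \<Sum>v=1..n. f u v) = 2 * (\<Sum>u=1..n. \<Sum>v=u..n. f u v)"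
    by (rule Suc.IH) (auto intro: Suc.prems)
  ultimately show ?case by (simp add: sum.distrib)
qed simp

text \<open>With \<open>b\<close> the maximal influence, the third-order sum becomes a vanishing
  factor times a convergent total of squares.\<close>

lemma sum_powr_three_halves_le:
  assumes "finite I" "\<And>k. k \<in> I \<Longrightarrow> 0 \<le> s k" "\<And>k. k \<in> I \<Longrightarrow> s k \<le> (b :: real)"
  shows "(\<Sum>k\<in>I. s k powr (3/2)) \<le> sqrt b * (\<Sum>k\<in>I. s k)"
  unfolding sum_distrib_left
proof (rule sum_mono)
  fix k assume k: "k \<in> I"
  have "s k powr (3/2) = sqrt (s k) * s k"
    using assms(2)[OF k] powr_add[of "s k" 1 "1/2"] by (cases "s k = 0") (simp_all add: powr_half_sqrt)
  also have "\<dots> \<le> sqrt b * s k" using assms(2,3)[OF k] by (intro mult_right_mono) auto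
  finally show "s k powr (3/2) \<le> sqrt b * s k" .
qed

lemma deriv_sup_norm_partial_bounds:
  fixes g :: "real^'d::{finite,linorder} \<Rightarrow> real"
  assumes g: "times_cont_diff 3 g" and fin: "deriv_sup_norm 2 g + deriv_sup_norm 3 g < \<infinity>"
  shows "\<bar>partial_deriv j (partial_deriv i g) x\<bar> \<le> enn2real (deriv_sup_norm 2 g)"
    and "\<bar>partial_deriv k (partial_deriv j (partial_deriv i g)) x\<bar> \<le> enn2real (deriv_sup_norm 3 g)"
proof -
  have f: "deriv_sup_norm 2 g < \<infinity>" "deriv_sup_norm 3 g < \<infinity>" using fin by auto
  have l: "length [j, i] = 2" "length [k, j, i] = 3" by simp_all
  have g2: "times_cont_diff 2 g"
    using g times_cont_diff_Suc_imp[of 2 g] by (simp only: eval_nat_numeral)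
  show "\<bar>partial_deriv j (partial_deriv i g) x\<bar> \<le> enn2real (deriv_sup_norm 2 g)"
    using abs_partial_le_deriv_sup_norm[of "[j, i]" g x] g2 f unfolding l by simp
  show "\<bar>partial_deriv k (partial_deriv j (partial_deriv i g)) x\<bar> \<le> enn2real (deriv_sup_norm 3 g)"
    using abs_partial_le_deriv_sup_norm[of "[k, j, i]" g x] g f unfolding l by simp
qed

lemma bounded_smooth_partial_bounds:
  fixes g :: "real^'d::finite \<Rightarrow> real"
  assumes "bounded_smooth 3 g"
  obtains B where "\<And>i j x. \<bar>partial_deriv j (partial_deriv i g) x\<bar> \<le> B"
    "\<And>i j k x. \<bar>partial_deriv k (partial_deriv j (partial_deriv i g)) x\<bar> \<le> B"
proof -
  let ?A = "(\<Union>i. \<Union>j. range (partial_deriv j (partial_deriv i g)))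
    \<union> (\<Union>i. \<Union>j. \<Union>k. range (partial_deriv k (partial_deriv j (partial_deriv i g))))"
  have "bounded_smooth (Suc (Suc (Suc 0))) g" using assms by (simp add: numeral_3_eq_3)
  then have "bounded ?A"
    by (intro bounded_Un[THEN iffD2] conjI bounded_UN finite ballI) auto
  then obtain B where B: "\<forall>y\<in>?A. \<bar>y\<bar> \<le> B" unfolding bounded_iff real_norm_def by (rule exE)
  show ?thesis
    by (rule that[of B]; rule B[THEN bspec]) (rule UnI1, (rule UN_I, rule UNIV_I)+, rule rangeI, rule UnI2, (rule UN_I, rule UNIV_I)+, rule rangeI)
qed

theorem theorem4p3:
  fixes M :: "'a measure" and N :: "'b measure"
    and X :: "nat \<Rightarrow> 'a \<Rightarrow> real"
    and a :: "nat \<Rightarrow> 'd::{finite,linorder} \<Rightarrow> nat \<Rightarrow> nat \<Rightarrow> real"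
    and Y :: "'b \<Rightarrow> (real, 'd) vec" and C :: "((real, 'd) vec, 'd) vec"
  assumes d: "CARD('d) \<ge> 2"
    and M: "prob_space M" and N: "prob_space N"
    and indep: "prob_space.indep_vars M (\<lambda>_. borel) X {1..}"
    and fourth: "\<And>v. v \<ge> 1 \<Longrightarrow> integrable M (\<lambda>\<omega>. X v \<omega> ^ 4)"
    and mean: "\<And>v. v \<ge> 1 \<Longrightarrow> prob_space.expectation M (X v) = 0"
    and var: "\<And>v. v \<ge> 1 \<Longrightarrow> prob_space.variance M (X v) = 1"
    and sym: "\<And>n i u v. n \<ge> 1 \<Longrightarrow> u \<in> {1..n} \<Longrightarrow> v \<in> {1..n} \<Longrightarrow> a n i u v = a n i v u"
    and diag: "\<And>n i u. n \<ge> 1 \<Longrightarrow> u \<in> {1..n} \<Longrightarrow> a n i u u = 0"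
    and Y: "centered_gaussian_vector N Y C"
    and lim_cov: "\<And>i j. (\<lambda>n. prob_space.expectation M (\<lambda>\<omega>. quad_sums a X n \<omega> $ i * quad_sums a X n \<omega> $ j)) \<longlonglongrightarrow> C $ i $ j"
    and lim_sum: "\<And>i j. (\<lambda>n. \<Sum>u=1..n. \<Sum>v=u..n. a n i u v * a n j u v) \<longlonglongrightarrow> C $ i $ j"
    and lim_contr: "\<And>i j. (\<lambda>n. \<Sum>u=1..n. \<Sum>v=1..n. (\<Sum>k=1..n. a n i k u * a n j k v)\<^sup>2) \<longlonglongrightarrow> 0"
    and lim_infl: "\<And>i. (\<lambda>n. MAX u\<in>{1..n}. \<Sum>v=1..n. (a n i u v)\<^sup>2) \<longlonglongrightarrow> 0"
  shows "(bdd_above ((\<lambda>v. prob_space.expectation M (\<lambda>\<omega>. \<bar>X v \<omega>\<bar> ^ 4)) ` {1..})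
            \<longrightarrow> converges_in_distribution M (quad_sums a X) N Y) \<and>
    (\<forall>g n. times_cont_diff 3 g \<and> deriv_sup_norm 2 g + deriv_sup_norm 3 g < \<infinity> \<and> n \<ge> 1 \<longrightarrow>
      \<bar>prob_space.expectation M (\<lambda>\<omega>. g (quad_sums a X n \<omega>)) - prob_space.expectation N (\<lambda>\<omega>. g (Y \<omega>))\<bar> \<le>
        enn2real (deriv_sup_norm 2 g) / 2 *
          (\<Sum>i\<in>UNIV. \<Sum>j\<in>UNIV.
             \<bar>C $ i $ j - prob_space.expectation M (\<lambda>\<omega>. quad_sums a X n \<omega> $ i * quad_sums a X n \<omega> $ j)\<bar>)
      + enn2real (deriv_sup_norm 2 g) / 2 powr (3/2) *
          (\<Sum>i\<in>UNIV. \<Sum>j\<in>UNIV.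
             sqrt (max 2 (MAX u\<in>{1..n}. prob_space.variance M (\<lambda>\<omega>. (X u \<omega>)\<^sup>2)) *
                   (\<Sum>u=1..n. \<Sum>v=1..n. (\<Sum>k=1..n. a n i k u * a n j k v)\<^sup>2)))
      + enn2real (deriv_sup_norm 2 g) / 2 powr (3/2) *
          (\<Sum>i\<in>UNIV. \<Sum>j\<in>UNIV.
             sqrt (8 * (MAX v\<in>{1..n}. prob_space.variance M (\<lambda>\<omega>. (X v \<omega>)\<^sup>2)) *
                   (MAX v\<in>{1..n}. prob_space.expectation M (\<lambda>\<omega>. \<bar>X v \<omega>\<bar> ^ 4)) *
                   (\<Sum>k=1..n. (\<Sum>v=1..n. (a n i k v)\<^sup>2) * (\<Sum>v=1..n. (a n j k v)\<^sup>2))))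
      + 2 powr (3/2) * (MAX v\<in>{1..n}. prob_space.expectation M (\<lambda>\<omega>. \<bar>X v \<omega>\<bar> ^ 4)) *
          enn2real (deriv_sup_norm 3 g) * (real CARD('d))\<^sup>2 / 3 *
          (\<Sum>i\<in>UNIV. \<Sum>k=1..n. (\<Sum>u=1..n. (a n i k u)\<^sup>2) powr (3/2)))"
proof -
  interpret M: prob_space M by (rule M)
  interpret Y: centered_gaussian N Y C
    using N Y by (simp add: centered_gaussian_def centered_gaussian_axioms_def)
  let ?E = "\<lambda>n i j. M.expectation (\<lambda>w. quad_sums a X n w $ i * quad_sums a X n w $ j)"
  let ?S = "\<lambda>n i j. \<Sum>u=1..n. \<Sum>v=1..n. (\<Sum>k=1..n. a n i k u * a n j k v)\<^sup>2"
  let ?P = "\<lambda>n i. \<Sum>k=1..n. (\<Sum>u=1..n. (a n i k u)\<^sup>2) powr (3/2)"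
  let ?I = "\<lambda>n i. MAX u\<in>{1..n}. \<Sum>v=1..n. (a n i u v)\<^sup>2"
  let ?D = "\<lambda>n i. 2 * (\<Sum>u=1..n. \<Sum>v=u..n. a n i u v * a n i u v)"
  have Xm: "X v \<in> borel_measurable M" if "v \<ge> 1" for v
    using indep that by (auto simp: M.indep_vars_def)
  have unit: "M.expectation (\<lambda>w. (X v w)\<^sup>2) = 1" if "v \<ge> 1" for v
    using var[OF that] mean[OF that] by simp
  have std: "indep_standardized M X {1..n}" for n
    using M.indep_vars_subset[OF indep, of "{1..n}"] fourth mean unit
    by (auto simp: indep_standardized_def indep_standardized_axioms_def M)
  have QF: "quadratic_forms M X {1..n} (a n) m"
    if "n \<ge> 1" "1 \<le> m" "\<And>v. v \<in> {1..n} \<Longrightarrow> M.expectation (\<lambda>w. X v w ^ 4) \<le> m" for n m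
    using that sym[OF that(1)] diag[OF that(1)]
    by (intro quadratic_forms.intro[OF std] quadratic_forms_axioms.intro) auto
  have Fq: "quadratic_forms.F {1..n} (a n) (\<lambda>v. X v w) = quad_sums a X n w"
    if "n \<ge> 1" and Q: "quadratic_forms M X {1..n} (a n) m" for n m w
  proof (rule vec_eq_iff[THEN iffD2, rule_format])
    fix i
    \<comment> \<open>The theorem sums over \<open>u \<le> v\<close>, while \<open>F\<close> is half
      the full double sum; the vanishing diagonal makes the two agree.\<close>
    have double: "(\<Sum>u=1..n. \<Sum>v=1..n. a n i u v * X u w * X v w) = 2 * (\<Sum>u=1..n. \<Sum>v=u..n. a n i u v * X u w * X v w)"
      using sym[OF that(1)] diag[OF that(1)] by (intro symmetric_double_sum) (auto simp: mult_ac)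
    have "(\<Sum>u=1..n. X u w * (\<Sum>v=1..n. a n i u v * X v w)) = (\<Sum>u=1..n. \<Sum>v=1..n. a n i u v * X u w * X v w)"
      by (simp add: sum_distrib_left mult_ac)
    then show "quadratic_forms.F {1..n} (a n) (\<lambda>v. X v w) $ i = quad_sums a X n w $ i"
      unfolding quadratic_forms.F_def[OF Q] quadratic_forms.A_def[OF Q] quad_sums_def vec_lambda_beta double by simp
  qed
  have bound: "\<bar>M.expectation (\<lambda>w. g (quad_sums a X n w)) - (\<integral>w. g (Y w) \<partial>N)\<bar> \<le>
      K / 2 * (\<Sum>i\<in>UNIV. \<Sum>j\<in>UNIV. \<bar>C $ i $ j - ?E n i j\<bar>)
    + K / 4 * (\<Sum>i\<in>UNIV. \<Sum>j\<in>UNIV. sqrt (V * (?S n i j)))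
    + sqrt 3 / 3 * m * T * (real CARD('d))\<^sup>2 * (\<Sum>i\<in>UNIV. \<Sum>k=1..n. (\<Sum>u=1..n. (a n i k u)\<^sup>2) powr (3/2))"
    if n: "n \<ge> 1" and g: "times_cont_diff 3 g"
      and K: "\<And>i j x. \<bar>partial_deriv j (partial_deriv i g) x\<bar> \<le> K"
      and T: "\<And>i j k x. \<bar>partial_deriv k (partial_deriv j (partial_deriv i g)) x\<bar> \<le> T"
      and m: "1 \<le> m" "\<And>v. v \<in> {1..n} \<Longrightarrow> M.expectation (\<lambda>w. X v w ^ 4) \<le> m"
      and V: "2 \<le> V" "\<And>v. v \<in> {1..n} \<Longrightarrow> M.expectation (\<lambda>w. X v w ^ 4) - 1 \<le> V" for g n K T m V
  proof -
    have Q: "quadratic_forms M X {1..n} (a n) m" by (rule QF[OF n m])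
    show ?thesis
      unfolding Fq[OF n Q, symmetric]
      by (rule quadratic_forms.quantitative_bound[OF Q Y.centered_gaussian_axioms g K T V])
  qed
  have var_sq: "M.variance (\<lambda>w. (X v w)\<^sup>2) = M.expectation (\<lambda>w. X v w ^ 4) - 1" if "v \<ge> 1" for v
  proof -
    have "M.variance (\<lambda>w. (X v w)\<^sup>2) = M.expectation (\<lambda>w. ((X v w)\<^sup>2)\<^sup>2) - (M.expectation (\<lambda>w. (X v w)\<^sup>2))\<^sup>2"
      using fourth[OF that] M.integrable_power_fourth[OF Xm[OF that] fourth[OF that], of 2] by (intro M.variance_eq) auto
    then show ?thesis using unit[OF that] by simp
  qed
  \<comment> \<open>Nonnegativity of the variance of the square; it makes the maximal fourth moment
    an admissible \<open>m\<close>.\<close>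
  have m4_ge: "1 \<le> M.expectation (\<lambda>w. X v w ^ 4)" if "v \<ge> 1" for v
    using var_sq[OF that] Bochner_Integration.integral_nonneg[of M "\<lambda>w. ((X v w)\<^sup>2 - M.expectation (\<lambda>w. (X v w)\<^sup>2))\<^sup>2"] by simp
  have abs4: "M.expectation (\<lambda>w. \<bar>X v w\<bar> ^ 4) = M.expectation (\<lambda>w. X v w ^ 4)" for v
    by (simp add: power_even_abs)
  show ?thesis
  proof (intro conjI impI allI, goal_cases)
    case (2 g n)
    then have g: "times_cont_diff 3 g" "deriv_sup_norm 2 g + deriv_sup_norm 3 g < \<infinity>" and n: "n \<ge> 1" by auto
    define K T where "K = enn2real (deriv_sup_norm 2 g)" and "T = enn2real (deriv_sup_norm 3 g)"
    have K0: "0 \<le> K" and T0: "0 \<le> T" by (simp_all add: K_def T_def)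
    define m where "m = (MAX v\<in>{1..n}. M.expectation (\<lambda>w. \<bar>X v w\<bar> ^ 4))"
    define W where "W = (MAX u\<in>{1..n}. M.variance (\<lambda>w. (X u w)\<^sup>2))"
    have mv: "M.expectation (\<lambda>w. X v w ^ 4) \<le> m" if "v \<in> {1..n}" for v
      unfolding m_def abs4 using that by (intro Max_ge) auto
    have m1: "1 \<le> m" using mv[of 1] m4_ge[of 1] n by auto
    have Wv: "M.expectation (\<lambda>w. X v w ^ 4) - 1 \<le> W" if "v \<in> {1..n}" for v
      unfolding W_def using that var_sq[of v] by (intro Max_ge) force+
    have W0: "0 \<le> W" using Wv[of 1] m4_ge[of 1] n by auto
    define \<Sigma> \<Theta> where "\<Sigma> = (\<Sum>i\<in>UNIV. \<Sum>j\<in>UNIV. sqrt (max 2 W * (?S n i j)))"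
      and "\<Theta> = (\<Sum>i\<in>UNIV. \<Sum>k=1..n. (\<Sum>u=1..n. (a n i k u)\<^sup>2) powr (3/2))"
    have \<Sigma>0: "0 \<le> \<Sigma>" unfolding \<Sigma>_def by (intro sum_nonneg real_sqrt_ge_zero mult_nonneg_nonneg) auto
    have \<Theta>0: "0 \<le> \<Theta>" unfolding \<Theta>_def by (intro sum_nonneg) auto
    have b: "\<bar>M.expectation (\<lambda>w. g (quad_sums a X n w)) - (\<integral>w. g (Y w) \<partial>N)\<bar> \<le>
        K / 2 * (\<Sum>i\<in>UNIV. \<Sum>j\<in>UNIV. \<bar>C $ i $ j - ?E n i j\<bar>)
        + K / 4 * \<Sigma> + sqrt 3 / 3 * m * T * (real CARD('d))\<^sup>2 * \<Theta>"
      unfolding K_def T_def \<Sigma>_def \<Theta>_def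
      by (rule bound[OF n g(1) deriv_sup_norm_partial_bounds[OF g] m1 mv]) (use Wv in force)+
    \<comment> \<open>The stated constants dominate the proved ones because
      \<open>2 * sqrt 2 \<le> 4\<close> and \<open>sqrt 3 \<le> sqrt 8\<close>.\<close>
    have p: "2 powr (3/2) = 2 * sqrt (2::real)"
      using powr_add[of 2 1 "1/2::real"] by (simp add: powr_half_sqrt)
    have s2: "sqrt (2::real) \<le> 2" by (rule real_le_lsqrt) auto
    have "K / 4 * \<Sigma> \<le> K / 2 powr (3/2) * \<Sigma>"
      unfolding p using K0 \<Sigma>0 s2 by (intro mult_right_mono divide_left_mono) auto
    \<comment> \<open>The third summand of the stated bound is nonnegative, so it may be added to
      the sharper estimate.\<close>
    moreover have "0 \<le> K / 2 powr (3/2) * (\<Sum>i\<in>UNIV. \<Sum>j\<in>UNIV. sqrt (8 * W * m * (\<Sum>k=1..n. (\<Sum>v=1..n. (a n i k v)\<^sup>2) * (\<Sum>v=1..n. (a n j k v)\<^sup>2))))"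
      using K0 W0 m1 by (intro mult_nonneg_nonneg sum_nonneg real_sqrt_ge_zero divide_nonneg_nonneg) auto
    moreover have "sqrt 3 / 3 * m * T * (real CARD('d))\<^sup>2 * \<Theta> \<le> 2 powr (3/2) * m * T * (real CARD('d))\<^sup>2 / 3 * \<Theta>"
    proof -
      have "sqrt (3::real) \<le> sqrt (2\<^sup>2 * 2)" by simp
      also have "\<dots> = 2 powr (3/2)" unfolding p real_sqrt_mult by (simp only: real_sqrt_abs abs_numeral)
      finally have "sqrt 3 * (m * T * (real CARD('d))\<^sup>2 / 3 * \<Theta>) \<le> 2 powr (3/2) * (m * T * (real CARD('d))\<^sup>2 / 3 * \<Theta>)"
        using m1 T0 \<Theta>0 by (intro mult_right_mono mult_nonneg_nonneg divide_nonneg_nonneg) auto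
      then show ?thesis by (simp add: mult_ac)
    qed
    ultimately show ?case
      using b unfolding K_def[symmetric] T_def[symmetric] W_def[symmetric] m_def[symmetric] \<Sigma>_def[symmetric] \<Theta>_def[symmetric]
      by linarith
  next
    case 1
    \<comment> \<open>One bound for all variables keeps the constants of \<open>bound\<close>
      independent of \<open>n\<close>; the maximum over \<open>{1..n}\<close> could grow.\<close>
    then obtain B where B: "\<And>v. v \<ge> 1 \<Longrightarrow> M.expectation (\<lambda>w. X v w ^ 4) \<le> B"
      unfolding abs4 by (auto simp: bdd_above_def)
    have B1: "1 \<le> B" using m4_ge[of 1] B[of 1] by simp
    have qm: "quad_sums a X n \<in> borel_measurable M" for n
      unfolding quad_sums_def[abs_def]
      by (rule borel_measurable_vecI) (auto intro!: borel_measurable_sum borel_measurable_times Xm)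
    have norm_q: "M.expectation (\<lambda>w. (norm (quad_sums a X n w))\<^sup>2) = (\<Sum>i\<in>UNIV. ?E n i i)"
      "integrable M (\<lambda>w. (norm (quad_sums a X n w))\<^sup>2)" for n
    proof -
      have "M.expectation (\<lambda>w. (norm (quad_sums a X n w))\<^sup>2) = (\<Sum>i\<in>UNIV. ?E n i i) \<and>
        integrable M (\<lambda>w. (norm (quad_sums a X n w))\<^sup>2)"
      proof (cases "n \<ge> 1")
        case True
        have Q: "quadratic_forms M X {1..n} (a n) B" by (rule QF[OF True B1 B]) simp
        show ?thesis
          using quadratic_forms.sum_norm_F[OF Q] unfolding Fq[OF True Q] by auto
      next
        \<comment> \<open>For \<open>n = 0\<close> all sums are empty, while \<open>QF\<close>
          starts at 1.\<close>
        case False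
        then have "quad_sums a X n w = 0" for w by (simp add: quad_sums_def vec_eq_iff)
        then show ?thesis by simp
      qed
      then show "M.expectation (\<lambda>w. (norm (quad_sums a X n w))\<^sup>2) = (\<Sum>i\<in>UNIV. ?E n i i)"
        "integrable M (\<lambda>w. (norm (quad_sums a X n w))\<^sup>2)" by auto
    qed
    \<comment> \<open>Convergence of the variances bounds the second moments uniformly in
      \<open>n\<close>, as the weak convergence criterion requires.\<close>
    have "convergent (\<lambda>n. \<Sum>i\<in>UNIV. ?E n i i)"
      by (rule convergentI[where L = "\<Sum>i\<in>UNIV. C $ i $ i"]) (intro tendsto_sum lim_cov)
    from convergent_imp_Bseq[OF this] obtain L1 where L1: "\<And>n. norm (\<Sum>i\<in>UNIV. ?E n i i) \<le> L1"
      unfolding Bseq_def by blast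
    define L where "L = max L1 (\<integral>w. (norm (Y w))\<^sup>2 \<partial>N)"
    show ?case
    proof (rule converges_in_distribution_bounded_smooth[where k = 3 and L = L])
      show "(\<integral>w. (norm (quad_sums a X n w))\<^sup>2 \<partial>M) \<le> L" for n
        unfolding norm_q(1) using L1[of n] by (simp add: L_def)
      show "(\<integral>w. (norm (Y w))\<^sup>2 \<partial>N) \<le> L" by (simp add: L_def)
      show "integrable N (\<lambda>w. (norm (Y w))\<^sup>2)"
        using square_integrable_mult_integrable[OF Y.Y_square_integrable Y.Y_square_integrable]
        by (simp add: power2_norm_eq_inner inner_vec_def)
      fix g :: "(real, 'd) vec \<Rightarrow> real" assume g: "bounded_smooth 3 g"
      obtain K where K: "\<And>i j x. \<bar>partial_deriv j (partial_deriv i g) x\<bar> \<le> K"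
        "\<And>i j k x. \<bar>partial_deriv k (partial_deriv j (partial_deriv i g)) x\<bar> \<le> K"
        using bounded_smooth_partial_bounds[OF g] by blast
      have K0: "0 \<le> K" using K(1)[of undefined undefined 0] by linarith
      \<comment> \<open>The bound with \<open>n\<close>-free constants: \<open>B\<close> serves as
        \<open>m\<close> and \<open>max 2 B\<close> as \<open>V\<close>. The third-order sum is
        replaced by the root of the maximal influence times \<open>?D\<close>, which tends to
        \<open>2 * C $ i $ i\<close>.\<close>
      define \<epsilon> where "\<epsilon> n = K / 2 * (\<Sum>i\<in>UNIV. \<Sum>j\<in>UNIV. \<bar>C $ i $ j - ?E n i j\<bar>)
        + K / 4 * (\<Sum>i\<in>UNIV. \<Sum>j\<in>UNIV. sqrt (max 2 B * (?S n i j)))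
        + sqrt 3 / 3 * B * K * (real CARD('d))\<^sup>2 * (\<Sum>i\<in>UNIV. sqrt (?I n i) * (?D n i))" for n
      have "\<epsilon> \<longlonglongrightarrow> K / 2 * (\<Sum>i\<in>(UNIV::'d set). \<Sum>j\<in>(UNIV::'d set). \<bar>C $ i $ j - C $ i $ j\<bar>)
        + K / 4 * (\<Sum>i\<in>(UNIV::'d set). \<Sum>j\<in>(UNIV::'d set). sqrt (max 2 B * 0))
        + sqrt 3 / 3 * B * K * (real CARD('d))\<^sup>2 * (\<Sum>i\<in>UNIV. sqrt 0 * (2 * C $ i $ i))"
        unfolding \<epsilon>_def by (intro tendsto_intros lim_cov lim_contr lim_infl lim_sum)
      then have \<epsilon>: "\<epsilon> \<longlonglongrightarrow> 0" by simp
      have "\<bar>(\<integral>w. g (quad_sums a X n w) \<partial>M) - (\<integral>w. g (Y w) \<partial>N)\<bar> \<le> \<epsilon> n" if n: "n \<ge> 1" for n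
      proof -
        have "(?P n i) \<le>
           sqrt (?I n i) * (?D n i)" for i
        proof -
          have "(?P n i) \<le>
             sqrt (?I n i) * (\<Sum>k=1..n. \<Sum>u=1..n. (a n i k u)\<^sup>2)"
            by (rule sum_powr_three_halves_le) (auto intro: sum_nonneg Max_ge)
          also have "(\<Sum>k=1..n. \<Sum>u=1..n. (a n i k u)\<^sup>2) = 2 * (\<Sum>u=1..n. \<Sum>v=u..n. (a n i u v)\<^sup>2)"
            using sym[OF n] diag[OF n] by (intro symmetric_double_sum) auto
          finally show ?thesis by (simp add: power2_eq_square)
        qed
        then have le: "sqrt 3 / 3 * B * K * (real CARD('d))\<^sup>2 * (\<Sum>i\<in>UNIV. \<Sum>k=1..n. (\<Sum>u=1..n. (a n i k u)\<^sup>2) powr (3/2)) \<le>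
          sqrt 3 / 3 * B * K * (real CARD('d))\<^sup>2 * (\<Sum>i\<in>UNIV. sqrt (?I n i) * (?D n i))"
          using K0 B1 by (intro mult_left_mono sum_mono) auto
        have Bn: "M.expectation (\<lambda>w. X v w ^ 4) \<le> B" "M.expectation (\<lambda>w. X v w ^ 4) - 1 \<le> max 2 B" if "v \<in> {1..n}" for v
          using B[of v] that by auto
        show ?thesis
          unfolding \<epsilon>_def
          by (rule order_trans[OF bound[OF n bounded_smooth_times_cont_diff[OF g] K B1] add_left_mono[OF le]])
             (rule max.cobounded1 Bn | assumption)+
      qed
      then have "\<forall>\<^sub>F n in sequentially. norm ((\<integral>w. g (quad_sums a X n w) \<partial>M) - (\<integral>w. g (Y w) \<partial>N)) \<le> \<epsilon> n"
        by (auto simp: eventually_sequentially)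
      from Lim_null_comparison[OF this \<epsilon>]
      show "(\<lambda>n. \<integral>w. g (quad_sums a X n w) \<partial>M) \<longlonglongrightarrow> (\<integral>w. g (Y w) \<partial>N)"
        by (rule LIM_zero_cancel)
    qed (use M N qm norm_q(2) in auto)
  qed
qed

end
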